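(* Let $M$ be a complex manifold, $G$ a (possibly discrete) complex Lie group with a holomorphic right action $\rho:M\times G\to M$, and let $(E,M,\pi,\rho,\varphi)$ be a $G$-equivariant holomorphic vector bundle with holomorphic connection $\nabla$, regarded as a $0$-simplex of $\mathbf{Tot}(\mathbf{HVB}([M/G]))$. If the connection $\nabla$ is $G$-invariant, then the image of this $0$-simplex under $$\mathbf{Tot}(\mathbf{Ch}([M/G])):\mathbf{Tot}(\mathbf{HVB}([M/G]))\to\mathbf{Tot}(\mathbf\Omega([M/G]))$$ is zero in all positive holomorphic form degrees.
   Context: $\mathbf{HVB}(U)$ is the nerve of the groupoid of finite rank holomorphic vector bundles with holomorphic connection on $U$, with morphisms all holomorphic bundle isomorphisms (not required to respect connections); it is contravariant in $U$ by pullback (treated as strictly functorial). $\Omega^\bullet_{hol}(U)$ denotes holomorphic forms with zero differential; $u$ is a formal variable of degree $-2$; $\Omega^\bullet_{hol}(U)[u]^{\bullet\le0}$ is $\Omega^\bullet_{hol}(U)\otimes\mathbb Z[u]$ modulo elements of positive degree. $N(\mathbb Z\Delta^k)$ is the normalized chain complex in non-positive degrees: in degree $-\ell$ free on $e_{i_0,\dots,i_\ell}$ ($0\le i_0<\dots<i_\ell\le k$), with alternating face differential. $\mathbf\Omega(U)$ is the simplicial set whose $k$-simplices are the chain maps $N(\mathbb Z\Delta^k)\to\Omega^\bullet_{hol}(U)[u]^{\bullet\le0}$. $\mathbf{Ch}(U):\mathbf{HVB}(U)\to\mathbf\Omega(U)$ sends $E_0\xrightarrow{f_1}\dots\xrightarrow{f_k}E_k$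 to the chain map $e_i\mapsto\dim E_i$, $e_{i_0,\dots,i_\ell}\mapsto\mathrm{tr}\big(\tilde f_{i_\ell,i_0}^{-1}\nabla_{i_\ell,i_{\ell-1}}(\tilde f_{i_\ell,i_{\ell-1}})\cdots\nabla_{i_1,i_0}(\tilde f_{i_1,i_0})\big)u^\ell$ for $\ell>0$, with $\tilde f_{q,p}=f_q\circ\dots\circ f_{p+1}$ and $\nabla_{q,p}$ the induced connection on $Hom(E_p,E_q)$. $[M/G]$ is the simplicial complex manifold with $[M/G]_n=M\times G^{\times n}$, $d_0(x,g_1,\dots,g_n)=(x\cdot g_1,g_2,\dots,g_n)$, $d_j(x,g_1,\dots,g_n)=(x,g_1,\dots,g_jg_{j+1},\dots,g_n)$ for $0<j<n$, $d_n(x,g_1,\dots,g_n)=(x,g_1,\dots,g_{n-1})$, and degeneracies inserting $1$. For a cosimplicial simplicial set $X$, $\mathbf{Tot}(X)$ has as $n$-simplices families of simplicial maps $(F_\ell:\Delta^\ell\times\Delta^n\to X^\ell)_{\ell\ge0}$ with $F_m\circ(\rho_*\times\mathrm{id})=X(\rho)\circ F_k$ for all $\rho:[k]\to[m]$; $\mathbf{Tot}(\mathbf{Ch}([M/G]))$ is postcomposition of $F_\ell$ with $\mathbf{Ch}([M/G]_\ell)$. A $G$-equivariant bundle is a holomorphic vector bundle $\pi:E\to M$ with a holomorphic, fiberwise linear right action $\varphi:E\times G\to E$ with $\pi\circ\varphi=\rho\circ(\pi\times\mathrm{id})$. It induces a bundle isomorphism $\phi:E\times G=pr_1^*E\to\rho^*E$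 over $M\times G$, $\phi_{(m,g)}=\varphi(\cdot,g):E_m\to E_{m\cdot g}$. The associated $0$-simplex of $\mathbf{Tot}(\mathbf{HVB}([M/G]))$ is the family $F_\ell:\Delta^\ell\to\mathbf{HVB}(M\times G^{\times\ell})$ where $F_0$ is $(E,\nabla)$, $F_1$ of the non-degenerate edge is $\phi:d_1^*E\to d_0^*E$ (note $d_1=pr_1$ and $d_0=\rho$ on $M\times G$), and, for each $\ell$, $F_\ell$ of the top simplex is the string of $\ell$ composable isomorphisms whose $t$-th morphism is the pullback of $\phi$ along the map $M\times G^{\times\ell}\to M\times G$ induced by $[1]\to[\ell]$, $0\mapsto t-1,1\mapsto t$; all bundles carry the pullback connections. $\nabla$ is $G$-invariant if $\nabla(\phi):=\nabla^{\rho^*(E)}\circ\phi-\phi\circ\nabla^{E\times G}=0$ in $\Omega^1_{hol}(M\times G,Hom(E\times G,\rho^*(E)))$, where $\nabla^{E\times G}$ and $\nabla^{\rho^*(E)}$ are the pullbacks of $\nabla$ along $pr_1$ and $\rho$. "Zero in all positive holomorphic form degrees" means: writing the image as a family of chain maps $N(\mathbb Z\Delta^\ell)\to\Omega^\bullet_{hol}(M\times G^{\times\ell})[u]^{\bullet\le0}$, all values have vanishing components in $\Omega^j_{hol}$ for $j>0$. *)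

theory Defs
  imports
    "HOL-Analysis.Analysis"
    "HOL-Algebra.Module"
    "HOL-Algebra.Free_Abelian_Groups"
    "HOL-Combinatorics.Permutations"
begin

section \<open>Complex manifolds\<close>

text \<open>
  The dimensions of \<open>M \<times> G\<^sup>\<ell>\<close> vary with \<open>\<ell>\<close> and may be zero, so \<open>\<complex>\<^sup>n\<close> is the set of complex
  sequences vanishing from index \<open>n\<close> on, with the (product) topology of \<open>nat \<Rightarrow> complex\<close>.
\<close>

definition cspace :: "nat \<Rightarrow> (nat \<Rightarrow> complex) set" where
  "cspace n = {z. \<forall>i\<ge>n. z i = 0}"

definition unit_vec :: "nat \<Rightarrow> nat \<Rightarrow> complex" where
  "unit_vec j = (\<lambda>i. if i = j then 1 else 0)"

text \<open>Complex (Frechet) differentiability at a point; \<open>f\<close> only matters near \<open>z\<close>.\<close>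

definition cdifferentiable :: "nat \<Rightarrow> ((nat \<Rightarrow> complex) \<Rightarrow> complex) \<Rightarrow> (nat \<Rightarrow> complex) \<Rightarrow> bool" where
  "cdifferentiable n f z \<longleftrightarrow>
     (\<exists>a. \<forall>e>0. \<forall>\<^sub>F w in at z within cspace n.
        cmod (f w - f z - (\<Sum>i<n. a i * (w i - z i))) \<le> e * (\<Sum>i<n. cmod (w i - z i)))"

text \<open>A chart \<open>(n, U, x)\<close> consists of its dimension, its domain and its coordinate map, which is
  irrelevant outside of the domain. The components of a manifold may have different dimensions, and
  so vector bundles (whose total spaces are manifolds) may have different ranks over different
  components.\<close>

type_synonym 'a chart = "nat \<times> 'a set \<times> ('a \<Rightarrow> nat \<Rightarrow> complex)"

record 'a cmanifold =
  mtop :: "'a topology"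
  atlas :: "'a chart set"

abbreviation pts :: "'a cmanifold \<Rightarrow> 'a set" where
  "pts X \<equiv> topspace (mtop X)"

text \<open>No countability axiom is imposed; in particular every discrete group, countable or not,
  is a complex Lie group of dimension \<open>0\<close>.\<close>

definition complex_manifold :: "'a cmanifold \<Rightarrow> bool" where
  "complex_manifold X \<longleftrightarrow>
     Hausdorff_space (mtop X) \<and>
     (\<Union>(n, U, x)\<in>atlas X. U) = pts X \<and>
     (\<forall>(n, U, x)\<in>atlas X.
        openin (mtop X) U \<and>
        openin (top_of_set (cspace n)) (x ` U) \<and>
        homeomorphic_map (subtopology (mtop X) U) (top_of_set (x ` U)) x) \<and>
     (\<forall>(n, U, x)\<in>atlas X. \<forall>(m, V, y)\<in>atlas X. \<forall>p\<in>U \<inter> V. \<forall>i<m.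
        cdifferentiable n (\<lambda>z. y (inv_into U x z) i) (x p))"

text \<open>Complex differentiability of a function at a single point; it is holomorphic on an open set
  if this holds at all points of the set.\<close>

definition cdiff_at :: "'a cmanifold \<Rightarrow> ('a \<Rightarrow> complex) \<Rightarrow> 'a \<Rightarrow> bool" where
  "cdiff_at X f p \<longleftrightarrow>
     (\<forall>(n, U, x)\<in>atlas X. p \<in> U \<longrightarrow> cdifferentiable n (f \<circ> inv_into U x) (x p))"

definition near :: "'a cmanifold \<Rightarrow> 'a \<Rightarrow> ('a \<Rightarrow> bool) \<Rightarrow> bool" where
  "near X p P \<longleftrightarrow> (\<exists>W. openin (mtop X) W \<and> p \<in> W \<and> (\<forall>q\<in>W. P q))"

definition holo_near :: "'a cmanifold \<Rightarrow> 'a \<Rightarrow> ('a \<Rightarrow> complex) \<Rightarrow> bool" where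
  "holo_near X p f \<longleftrightarrow> near X p (cdiff_at X f)"

definition holo_map :: "'a cmanifold \<Rightarrow> 'b cmanifold \<Rightarrow> ('a \<Rightarrow> 'b) \<Rightarrow> bool" where
  "holo_map X Y f \<longleftrightarrow>
     continuous_map (mtop X) (mtop Y) f \<and>
     (\<forall>p\<in>pts X. \<forall>(n, V, y)\<in>atlas Y. f p \<in> V \<longrightarrow> (\<forall>i<n. cdiff_at X (\<lambda>q. y (f q) i) p))"

subsection \<open>Products, open submanifolds, affine space\<close>

definition cprod :: "'a cmanifold \<Rightarrow> 'b cmanifold \<Rightarrow> ('a \<times> 'b) cmanifold" where
  "cprod X Y =
    \<lparr>mtop = prod_topology (mtop X) (mtop Y),
     atlas = {(n + m, U \<times> V, \<lambda>(p, q) i. if i < n then x p i else y q (i - n)) | n U x m V y.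
                (n, U, x) \<in> atlas X \<and> (m, V, y) \<in> atlas Y}\<rparr>"

text \<open>The \<open>l\<close>-fold power; its points are the extensional functions on \<open>{1..l}\<close>. The coordinates
  of the factors are concatenated.\<close>

definition cpow :: "'a cmanifold \<Rightarrow> nat \<Rightarrow> (nat \<Rightarrow> 'a) cmanifold" where
  "cpow X l =
    \<lparr>mtop = product_topology (\<lambda>_. mtop X) {1..l},
     atlas = {(\<Sum>t=1..l. n t,
               PiE {1..l} U,
               \<lambda>p. nth_default 0 (concat (map (\<lambda>t. map (y t (p t)) [0..<n t]) [1..<l + 1]))) | n U y.
                \<forall>t\<in>{1..l}. (n t, U t, y t) \<in> atlas X}\<rparr>"

definition open_sub :: "'a cmanifold \<Rightarrow> 'a set \<Rightarrow> 'a cmanifold" where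
  "open_sub X W =
    \<lparr>mtop = subtopology (mtop X) W, atlas = {(n, U \<inter> W, x) | n U x. (n, U, x) \<in> atlas X}\<rparr>"

definition affine_cspace :: "nat \<Rightarrow> (nat \<Rightarrow> complex) cmanifold" where
  "affine_cspace r = \<lparr>mtop = top_of_set (cspace r), atlas = {(r, cspace r, id)}\<rparr>"

subsection \<open>Tangent vectors and forms\<close>

text \<open>The holomorphic tangent space at \<open>p\<close> consists of the derivations of the algebra of germs of
  holomorphic functions at \<open>p\<close>. A derivation is represented as a functional on all functions that
  depends only on the germ at \<open>p\<close> and, as a normalisation, vanishes on the functions which are not
  holomorphic near \<open>p\<close>.\<close>

type_synonym 'a tvec = "('a \<Rightarrow> complex) \<Rightarrow> complex"

definition tangent :: "'a cmanifold \<Rightarrow> 'a \<Rightarrow> 'a tvec set" where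
  "tangent X p = {D.
     (\<forall>f g. holo_near X p f \<longrightarrow> holo_near X p g \<longrightarrow>
        D (\<lambda>q. f q + g q) = D f + D g \<and> D (\<lambda>q. f q * g q) = f p * D g + D f * g p) \<and>
     (\<forall>c f. holo_near X p f \<longrightarrow> D (\<lambda>q. c * f q) = c * D f) \<and>
     (\<forall>f g. holo_near X p f \<longrightarrow> near X p (\<lambda>q. f q = g q) \<longrightarrow> D f = D g) \<and>
     (\<forall>f. \<not> holo_near X p f \<longrightarrow> D f = 0)}"

definition push :: "'a cmanifold \<Rightarrow> 'b cmanifold \<Rightarrow> ('a \<Rightarrow> 'b) \<Rightarrow> 'a \<Rightarrow> 'a tvec \<Rightarrow> 'b tvec" where
  "push X Y f p D = (\<lambda>h. if holo_near Y (f p) h then D (h \<circ> f) else 0)"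

text \<open>The coordinate vector \<open>\<partial>/\<partial>x\<^sub>i\<close> at \<open>p\<close>.\<close>

definition coord_vec :: "'a cmanifold \<Rightarrow> 'a chart \<Rightarrow> nat \<Rightarrow> 'a \<Rightarrow> 'a tvec" where
  "coord_vec X = (\<lambda>(n, U, x) i p f.
     if holo_near X p f then deriv (\<lambda>w. f (inv_into U x ((x p)(i := w)))) (x p i) else 0)"

text \<open>A \<open>j\<close>-form \<open>\<omega>\<close> is represented by its values \<open>\<omega> p v\<close> on the tangent vectors
  \<open>v 0, \<dots>, v (j - 1)\<close> at \<open>p\<close>; the other entries of \<open>v\<close> are irrelevant.\<close>

type_synonym 'a form = "'a \<Rightarrow> (nat \<Rightarrow> 'a tvec) \<Rightarrow> complex"

definition form_vanishes :: "'a cmanifold \<Rightarrow> nat \<Rightarrow> 'a form \<Rightarrow> bool" where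
  "form_vanishes X j \<omega> \<longleftrightarrow>
     (\<forall>p\<in>pts X. \<forall>v. (\<forall>i<j. v i \<in> tangent X p) \<longrightarrow> \<omega> p v = 0)"

text \<open>An element of \<open>\<Omega>\<^sup>\<bullet>[u]\<close> is given by its components: \<open>w a j\<close> is the component in \<open>\<Omega>\<^sup>j\<close> of the
  coefficient of \<open>u\<^sup>a\<close>, of total degree \<open>j - 2 * a\<close>.\<close>

type_synonym 'a uform = "nat \<Rightarrow> nat \<Rightarrow> 'a form"

section \<open>Vector bundles and connections\<close>

definition complex_field :: "complex ring" where
  "complex_field = \<lparr>carrier = UNIV, monoid.mult = (*), one = 1, ring.zero = 0, add = (+)\<rparr>"

text \<open>Complex vector spaces are modules in the sense of HOL-Algebra; the fields \<open>mult\<close> and \<open>one\<close>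
  of the record play no role.\<close>

type_synonym 'e cvs = "(complex, 'e) module"

abbreviation complex_vs :: "'e cvs \<Rightarrow> bool" where
  "complex_vs V \<equiv> Module.module complex_field V"

definition linear_coords :: "'e cvs \<Rightarrow> ('e \<Rightarrow> nat \<Rightarrow> complex) \<Rightarrow> bool" where
  "linear_coords V \<psi> \<longleftrightarrow>
     (\<forall>e\<in>carrier V. \<forall>e'\<in>carrier V. \<psi> (e \<oplus>\<^bsub>V\<^esub> e') = (\<lambda>i. \<psi> e i + \<psi> e' i)) \<and>
     (\<forall>c. \<forall>e\<in>carrier V. \<psi> (c \<odot>\<^bsub>V\<^esub> e) = (\<lambda>i. c * \<psi> e i))"

definition is_basis :: "'e cvs \<Rightarrow> nat \<Rightarrow> (nat \<Rightarrow> 'e) \<Rightarrow> bool" where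
  "is_basis V r b \<longleftrightarrow>
     b \<in> {..<r} \<rightarrow> carrier V \<and>
     (\<forall>e\<in>carrier V. \<exists>!c. c \<in> cspace r \<and> e = finsum V (\<lambda>j. c j \<odot>\<^bsub>V\<^esub> b j) {..<r})"

definition coords :: "'e cvs \<Rightarrow> nat \<Rightarrow> (nat \<Rightarrow> 'e) \<Rightarrow> 'e \<Rightarrow> nat \<Rightarrow> complex" where
  "coords V r b e = (THE c. c \<in> cspace r \<and> e = finsum V (\<lambda>j. c j \<odot>\<^bsub>V\<^esub> b j) {..<r})"

definition vdim :: "'e cvs \<Rightarrow> nat" where
  "vdim V = (LEAST r. \<exists>b. is_basis V r b)"

definition trace :: "'e cvs \<Rightarrow> ('e \<Rightarrow> 'e) \<Rightarrow> complex" where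
  "trace V A = (let b = (SOME b. is_basis V (vdim V) b)
                in \<Sum>j<vdim V. coords V (vdim V) b (A (b j)) j)"

subsection \<open>Holomorphic vector bundles with total space\<close>

text \<open>A local trivialisation is a biholomorphism \<open>\<Psi>\<close> from the preimage of \<open>U\<close> under \<open>\<pi>\<close> onto
  \<open>U \<times> \<complex>\<^sup>r\<close> over \<open>U\<close>, linear on the fibres.\<close>

definition local_trivialization ::
  "'e cmanifold \<Rightarrow> 'm cmanifold \<Rightarrow> ('e \<Rightarrow> 'm) \<Rightarrow> ('m \<Rightarrow> 'e cvs)
     \<Rightarrow> 'm set \<Rightarrow> nat \<Rightarrow> ('e \<Rightarrow> 'm \<times> (nat \<Rightarrow> complex)) \<Rightarrow> bool" where
  "local_trivialization E M \<pi> V U r \<Psi> \<longleftrightarrow>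
     openin (mtop M) U \<and>
     (let P = open_sub E {e \<in> pts E. \<pi> e \<in> U}; Q = cprod (open_sub M U) (affine_cspace r)
      in holo_map P Q \<Psi> \<and>
         (\<exists>\<Theta>. holo_map Q P \<Theta> \<and> (\<forall>e\<in>pts P. \<Theta> (\<Psi> e) = e) \<and> (\<forall>z\<in>pts Q. \<Psi> (\<Theta> z) = z)) \<and>
         (\<forall>e\<in>pts P. fst (\<Psi> e) = \<pi> e)) \<and>
     (\<forall>m\<in>U. linear_coords (V m) (\<lambda>e. snd (\<Psi> e)))"

definition holomorphic_vector_bundle ::
  "'e cmanifold \<Rightarrow> 'm cmanifold \<Rightarrow> ('e \<Rightarrow> 'm) \<Rightarrow> ('m \<Rightarrow> 'e cvs) \<Rightarrow> bool" where
  "holomorphic_vector_bundle E M \<pi> V \<longleftrightarrow>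
     complex_manifold E \<and> complex_manifold M \<and> holo_map E M \<pi> \<and>
     (\<forall>m\<in>pts M. carrier (V m) = {e \<in> pts E. \<pi> e = m} \<and> complex_vs (V m)) \<and>
     (\<forall>m\<in>pts M. \<exists>U r \<Psi>. m \<in> U \<and> local_trivialization E M \<pi> V U r \<Psi>)"

subsection \<open>Bundles as families of fibres\<close>

text \<open>
  The objects of \<open>HVB\<close> are given by the family of their fibres, a set of local trivialisations
  \<open>(U, r, \<psi>)\<close> with \<open>\<psi> x\<close> mapping the fibre at \<open>x \<in> U\<close> onto \<open>\<complex>\<^sup>r\<close>, and a connection. In this form the
  fibre at \<open>x\<close> of the pullback along \<open>f\<close> is the fibre at \<open>f x\<close>, so that the pullback of bundles is
  strictly functorial. For a connection, \<open>conn B p v s\<close> is the value at \<open>p\<close> of the covariant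
  derivative of the local section \<open>s\<close> in the direction of the tangent vector \<open>v\<close> at \<open>p\<close>.
\<close>

record ('x, 'e) cbundle =
  fib :: "'x \<Rightarrow> 'e cvs"
  trivs :: "('x set \<times> nat \<times> ('x \<Rightarrow> 'e \<Rightarrow> nat \<Rightarrow> complex)) set"
  conn :: "'x \<Rightarrow> 'x tvec \<Rightarrow> ('x \<Rightarrow> 'e) \<Rightarrow> 'e"

definition bundle_of ::
  "'e cmanifold \<Rightarrow> 'm cmanifold \<Rightarrow> ('e \<Rightarrow> 'm) \<Rightarrow> ('m \<Rightarrow> 'e cvs)
     \<Rightarrow> ('m \<Rightarrow> 'm tvec \<Rightarrow> ('m \<Rightarrow> 'e) \<Rightarrow> 'e) \<Rightarrow> ('m, 'e) cbundle" where
  "bundle_of E M \<pi> V nabla =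
    \<lparr>fib = V,
     trivs = {(U, r, \<lambda>m e. snd (\<Psi> e)) | U r \<Psi>. local_trivialization E M \<pi> V U r \<Psi>},
     conn = nabla\<rparr>"

definition holo_section_on :: "'x cmanifold \<Rightarrow> ('x, 'e) cbundle \<Rightarrow> 'x set \<Rightarrow> ('x \<Rightarrow> 'e) \<Rightarrow> bool" where
  "holo_section_on X B W s \<longleftrightarrow>
     openin (mtop X) W \<and>
     (\<forall>q\<in>W. s q \<in> carrier (fib B q) \<and>
        (\<forall>(U, r, \<psi>)\<in>trivs B. q \<in> U \<longrightarrow> (\<forall>i<r. cdiff_at X (\<lambda>q'. \<psi> q' (s q') i) q)))"

definition holo_section_near :: "'x cmanifold \<Rightarrow> ('x, 'e) cbundle \<Rightarrow> 'x \<Rightarrow> ('x \<Rightarrow> 'e) \<Rightarrow> bool" where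
  "holo_section_near X B p s \<longleftrightarrow> (\<exists>W. p \<in> W \<and> holo_section_on X B W s)"

text \<open>The last clause says that the covariant derivative of a holomorphic section is a holomorphic
  \<open>1\<close>-form with values in the bundle.\<close>

definition holomorphic_connection :: "'x cmanifold \<Rightarrow> ('x, 'e) cbundle \<Rightarrow> bool" where
  "holomorphic_connection X B \<longleftrightarrow>
     (\<forall>p\<in>pts X. \<forall>s. holo_section_near X B p s \<longrightarrow>
        (\<forall>v\<in>tangent X p.
           conn B p v s \<in> carrier (fib B p) \<and>
           (\<forall>w\<in>tangent X p. conn B p (\<lambda>f. v f + w f) s = conn B p v s \<oplus>\<^bsub>fib B p\<^esub> conn B p w s) \<and>
           (\<forall>c. conn B p (\<lambda>f. c * v f) s = c \<odot>\<^bsub>fib B p\<^esub> conn B p v s) \<and>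
           (\<forall>t. holo_section_near X B p t \<longrightarrow>
              conn B p v (\<lambda>q. s q \<oplus>\<^bsub>fib B q\<^esub> t q) = conn B p v s \<oplus>\<^bsub>fib B p\<^esub> conn B p v t) \<and>
           (\<forall>h. holo_near X p h \<longrightarrow>
              conn B p v (\<lambda>q. h q \<odot>\<^bsub>fib B q\<^esub> s q)
                = (v h \<odot>\<^bsub>fib B p\<^esub> s p) \<oplus>\<^bsub>fib B p\<^esub> (h p \<odot>\<^bsub>fib B p\<^esub> conn B p v s)) \<and>
           (\<forall>t. near X p (\<lambda>q. s q = t q) \<longrightarrow> conn B p v s = conn B p v t))) \<and>
     (\<forall>W s. holo_section_on X B W s \<longrightarrow>
        (\<forall>(n, U, x)\<in>atlas X. \<forall>i<n.
           holo_section_on X B (W \<inter> U) (\<lambda>q. conn B q (coord_vec X (n, U, x) i q) s)))"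

text \<open>The frame belonging to a local trivialisation.\<close>

definition frame ::
  "('x, 'e) cbundle \<Rightarrow> ('x \<Rightarrow> 'e \<Rightarrow> nat \<Rightarrow> complex) \<Rightarrow> nat \<Rightarrow> 'x \<Rightarrow> 'e" where
  "frame B \<psi> j x = inv_into (carrier (fib B x)) (\<psi> x) (unit_vec j)"

text \<open>Pullback along \<open>f : X \<rightarrow> Y\<close>. Near \<open>x\<close>, a section \<open>t\<close> of the pullback is
  \<open>\<Sum>\<^sub>j h\<^sub>j (s\<^sub>j \<circ> f)\<close> for a local frame \<open>s\<^sub>j\<close> near \<open>f x\<close>, and its covariant derivative in the
  direction of \<open>v\<close> is \<open>\<Sum>\<^sub>j v(h\<^sub>j) s\<^sub>j(f x) + h\<^sub>j(x) (\<nabla> s\<^sub>j)(f\<^sub>* v)\<close>. This does not depend on the frame.\<close>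

definition pull :: "'x cmanifold \<Rightarrow> 'y cmanifold \<Rightarrow> ('x \<Rightarrow> 'y) \<Rightarrow> ('y, 'e) cbundle \<Rightarrow> ('x, 'e) cbundle" where
  "pull X Y f B =
    \<lparr>fib = (\<lambda>x. fib B (f x)),
     trivs = {({x \<in> pts X. f x \<in> U}, r, \<lambda>x. \<psi> (f x)) | U r \<psi>. (U, r, \<psi>) \<in> trivs B},
     conn = (\<lambda>x v t.
       let (U, r, \<psi>) = (SOME \<tau>. \<tau> \<in> trivs B \<and> f x \<in> fst \<tau>); F = fib B (f x)
       in finsum F (\<lambda>j.
            (v (\<lambda>x'. \<psi> (f x') (t x') j) \<odot>\<^bsub>F\<^esub> frame B \<psi> j (f x)) \<oplus>\<^bsub>F\<^esub>
            (\<psi> (f x) (t x) j \<odot>\<^bsub>F\<^esub> conn B (f x) (push X Y f x v) (frame B \<psi> j))) {..<r})\<rparr>"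

text \<open>The induced connection on \<open>Hom(B, C)\<close>: for a bundle map \<open>f\<close>, a tangent vector \<open>v\<close> at \<open>p\<close> and
  \<open>e\<close> in the fibre of \<open>B\<close> at \<open>p\<close>, \<open>(\<nabla>\<^sub>v f)(e) = \<nabla>\<^sub>v (f s) - f (\<nabla>\<^sub>v s)\<close> for any local holomorphic
  section \<open>s\<close> of \<open>B\<close> with \<open>s p = e\<close>.\<close>

definition nabla_hom ::
  "'x cmanifold \<Rightarrow> ('x, 'e) cbundle \<Rightarrow> ('x, 'e) cbundle \<Rightarrow> ('x \<Rightarrow> 'e \<Rightarrow> 'e)
     \<Rightarrow> 'x \<Rightarrow> 'x tvec \<Rightarrow> 'e \<Rightarrow> 'e" where
  "nabla_hom X B C f p v e =
     (let s = (SOME s. holo_section_near X B p s \<and> s p = e)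
      in conn C p v (\<lambda>q. f q (s q)) \<ominus>\<^bsub>fib C p\<^esub> f p (conn B p v s))"

section \<open>Simplices of \<open>HVB\<close> and the map \<open>Ch\<close>\<close>

text \<open>A \<open>k\<close>-simplex \<open>E\<^sub>0 \<rightarrow> \<dots> \<rightarrow> E\<^sub>k\<close> is the pair of the bundles \<open>E\<^sub>i\<close> for \<open>i \<le> k\<close> and the isomorphisms
  \<open>f\<^sub>t : E\<^bsub>t - 1\<^esub> \<rightarrow> E\<^sub>t\<close> for \<open>1 \<le> t \<le> k\<close>; entries at other indices are irrelevant.\<close>

type_synonym ('x, 'e) hvb_simplex = "(nat \<Rightarrow> ('x, 'e) cbundle) \<times> (nat \<Rightarrow> 'x \<Rightarrow> 'e \<Rightarrow> 'e)"

text \<open>\<open>comp_seg f q p\<close> is \<open>f\<^sub>q \<circ> \<dots> \<circ> f\<^bsub>p + 1\<^esub>\<close>.\<close>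

definition comp_seg :: "(nat \<Rightarrow> 'x \<Rightarrow> 'e \<Rightarrow> 'e) \<Rightarrow> nat \<Rightarrow> nat \<Rightarrow> 'x \<Rightarrow> 'e \<Rightarrow> 'e" where
  "comp_seg f q p x = fold (\<lambda>t. f t x) [p + 1..<q + 1]"

text \<open>The simplicial operator of the nerve for a monotone map \<open>\<theta> : [k] \<rightarrow> [m]\<close>.\<close>

definition hvb_op :: "(nat \<Rightarrow> nat) \<Rightarrow> ('x, 'e) hvb_simplex \<Rightarrow> ('x, 'e) hvb_simplex" where
  "hvb_op \<theta> = (\<lambda>(Es, f). (\<lambda>i. Es (\<theta> i), \<lambda>t. comp_seg f (\<theta> t) (\<theta> (t - 1))))"

text \<open>The generators \<open>e\<^bsub>i\<^sub>0 \<dots> i\<^sub>l\<^esub>\<close> of \<open>N(\<int>\<Delta>\<^sup>k)\<close> are the strictly increasing lists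
  \<open>[i\<^sub>0, \<dots>, i\<^sub>l]\<close>, in degree \<open>-l\<close>.\<close>

definition generators :: "nat \<Rightarrow> nat list set" where
  "generators k = {I. I \<noteq> [] \<and> sorted_wrt (<) I \<and> set I \<subseteq> {0..k}}"

definition normalized_chains :: "nat \<Rightarrow> (nat list \<Rightarrow>\<^sub>0 int) set" where
  "normalized_chains k = carrier (free_Abelian_group (generators k))"

text \<open>The \<open>l\<close>-form
  \<open>tr (f\<^bsub>i\<^sub>l, i\<^sub>0\<^esub>\<^sup>-\<^sup>1 \<nabla>(f\<^bsub>i\<^sub>l, i\<^bsub>l-1\<^esub>\<^esub>) \<dots> \<nabla>(f\<^bsub>i\<^sub>1, i\<^sub>0\<^esub>))\<close> for \<open>I = [i\<^sub>0, \<dots>, i\<^sub>l]\<close>, the product of the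
  \<open>Hom\<close>-valued \<open>1\<close>-forms being the wedge product combined with composition:
  \<open>(\<alpha>\<^sub>l \<dots> \<alpha>\<^sub>1)(v\<^sub>0, \<dots>, v\<^bsub>l-1\<^esub>) = \<Sum>\<^sub>\<sigma> sgn \<sigma> \<cdot> \<alpha>\<^sub>l(v\<^bsub>\<sigma> 0\<^esub>) \<circ> \<dots> \<circ> \<alpha>\<^sub>1(v\<^bsub>\<sigma> (l-1)\<^esub>)\<close>.\<close>

definition ch_form :: "'x cmanifold \<Rightarrow> ('x, 'e) hvb_simplex \<Rightarrow> nat list \<Rightarrow> 'x form" where
  "ch_form X = (\<lambda>(Es, f) I p v.
     let l = length I - 1; i0 = hd I; il = last I
     in \<Sum>\<sigma> | \<sigma> permutes {..<l}.
          of_int (sign \<sigma>) *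
          trace (fib (Es i0) p) (\<lambda>e.
            inv_into (carrier (fib (Es i0) p)) (comp_seg f il i0 p)
              (fold (\<lambda>r. nabla_hom X (Es (I ! (r - 1))) (Es (I ! r)) (comp_seg f (I ! r) (I ! (r - 1)))
                           p (v (\<sigma> (l - r))))
                 [1..<l + 1] e)))"

definition ch_generator :: "'x cmanifold \<Rightarrow> ('x, 'e) hvb_simplex \<Rightarrow> nat list \<Rightarrow> 'x uform" where
  "ch_generator X S I = (\<lambda>a j p v.
     if a = length I - 1 \<and> j = length I - 1
     then (if j = 0 then of_nat (vdim (fib (fst S (hd I)) p)) else ch_form X S I p v)
     else 0)"

text \<open>\<open>Ch X S\<close> is the linear extension to \<open>N(\<int>\<Delta>\<^sup>k)\<close>. Its values on chains of degree \<open>-l\<close> have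
  degree \<open>-l\<close>, so that passing to \<open>\<Omega>\<^sup>\<bullet>[u]\<close> modulo positive degrees discards nothing.\<close>

definition Ch :: "'x cmanifold \<Rightarrow> ('x, 'e) hvb_simplex \<Rightarrow> (nat list \<Rightarrow>\<^sub>0 int) \<Rightarrow> 'x uform" where
  "Ch X S c = (\<lambda>a j p v.
     \<Sum>I\<in>Poly_Mapping.keys c. of_int (Poly_Mapping.lookup c I) * ch_generator X S I a j p v)"

section \<open>Lie group actions and \<open>[M/G]\<close>\<close>

record 'g lie_group = "'g monoid" +
  lie_mfd :: "'g cmanifold"

definition complex_lie_group :: "'g lie_group \<Rightarrow> bool" where
  "complex_lie_group G \<longleftrightarrow>
     group G \<and> complex_manifold (lie_mfd G) \<and> pts (lie_mfd G) = carrier G \<and>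
     holo_map (cprod (lie_mfd G) (lie_mfd G)) (lie_mfd G) (\<lambda>(g, h). g \<otimes>\<^bsub>G\<^esub> h) \<and>
     holo_map (lie_mfd G) (lie_mfd G) (m_inv G)"

definition holomorphic_right_action :: "'m cmanifold \<Rightarrow> 'g lie_group \<Rightarrow> ('m \<times> 'g \<Rightarrow> 'm) \<Rightarrow> bool" where
  "holomorphic_right_action M G \<rho> \<longleftrightarrow>
     holo_map (cprod M (lie_mfd G)) M \<rho> \<and>
     (\<forall>x\<in>pts M. \<rho> (x, \<one>\<^bsub>G\<^esub>) = x) \<and>
     (\<forall>x\<in>pts M. \<forall>g\<in>carrier G. \<forall>h\<in>carrier G. \<rho> (\<rho> (x, g), h) = \<rho> (x, g \<otimes>\<^bsub>G\<^esub> h))"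

text \<open>\<open>[M/G]\<^sub>n = M \<times> G\<^sup>n\<close>\<close>

definition quot :: "'m cmanifold \<Rightarrow> 'g lie_group \<Rightarrow> nat \<Rightarrow> ('m \<times> (nat \<Rightarrow> 'g)) cmanifold" where
  "quot M G n = cprod M (cpow (lie_mfd G) n)"

text \<open>\<open>gseg G g p q\<close> is \<open>g\<^bsub>p + 1\<^esub> \<cdots> g\<^sub>q\<close>.\<close>

definition gseg :: "('g, 'b) monoid_scheme \<Rightarrow> (nat \<Rightarrow> 'g) \<Rightarrow> nat \<Rightarrow> nat \<Rightarrow> 'g" where
  "gseg G g p q = foldr (\<lambda>t h. g t \<otimes>\<^bsub>G\<^esub> h) [p + 1..<q + 1] \<one>\<^bsub>G\<^esub>"

text \<open>The map \<open>[M/G]\<^sub>m \<rightarrow> [M/G]\<^sub>k\<close> induced by a monotone map \<open>\<theta> : [k] \<rightarrow> [m]\<close>. The lemmas below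
  identify the faces and degeneracies.\<close>

definition quot_op ::
  "('g, 'b) monoid_scheme \<Rightarrow> ('m \<times> 'g \<Rightarrow> 'm) \<Rightarrow> nat \<Rightarrow> (nat \<Rightarrow> nat)
     \<Rightarrow> 'm \<times> (nat \<Rightarrow> 'g) \<Rightarrow> 'm \<times> (nat \<Rightarrow> 'g)" where
  "quot_op G \<rho> k \<theta> = (\<lambda>(x, g). (\<rho> (x, gseg G g 0 (\<theta> 0)), \<lambda>i\<in>{1..k}. gseg G g (\<theta> (i - 1)) (\<theta> i)))"

lemma gseg_empty [simp]: "gseg G g p p = \<one>\<^bsub>G\<^esub>"
  by (simp add: gseg_def)

lemma (in monoid) gseg_single: "g (Suc p) \<in> carrier G \<Longrightarrow> gseg G g p (Suc p) = g (Suc p)"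
  by (simp add: gseg_def)

lemma (in monoid) gseg_double:
  "g (Suc p) \<in> carrier G \<Longrightarrow> g (Suc (Suc p)) \<in> carrier G
     \<Longrightarrow> gseg G g p (Suc (Suc p)) = g (Suc p) \<otimes> g (Suc (Suc p))"
  by (simp add: gseg_def)

definition coface :: "nat \<Rightarrow> nat \<Rightarrow> nat" where
  "coface j i = (if i < j then i else Suc i)"

definition codegeneracy :: "nat \<Rightarrow> nat \<Rightarrow> nat" where
  "codegeneracy j i = (if i \<le> j then i else i - 1)"

lemma quot_op_face:
  assumes "complex_lie_group G" "holomorphic_right_action M G \<rho>"
    and "x \<in> pts M" "g \<in> PiE {1..Suc n} (\<lambda>_. carrier G)" "j \<le> Suc n"
  shows "quot_op G \<rho> n (coface j) (x, g) =
    (if j = 0 then (\<rho> (x, g 1), \<lambda>i\<in>{1..n}. g (i + 1))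
     else if j \<le> n then (x, \<lambda>i\<in>{1..n}. if i < j then g i else if i = j then g j \<otimes>\<^bsub>G\<^esub> g (j + 1) else g (i + 1))
     else (x, \<lambda>i\<in>{1..n}. g i))"
proof -
  interpret group G using assms(1) by (simp add: complex_lie_group_def)
  have g: "g i \<in> carrier G" if "1 \<le> i" "i \<le> Suc n" for i
    using assms(4) that by auto
  have act1: "\<rho> (x, \<one>\<^bsub>G\<^esub>) = x"
    using assms(2,3) by (simp add: holomorphic_right_action_def)
  have 1: "gseg G g (coface j (i - 1)) (coface j i) =
      (if i < j then g i else if i = j then g j \<otimes>\<^bsub>G\<^esub> g (j + 1) else g (i + 1))"
    if i: "1 \<le> i" "i \<le> n" for i
  proof -
    obtain i' where i': "i = Suc i'" using i by (cases i) auto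
    then show ?thesis
      using i g[of i] g[of "Suc i"] gseg_single[of g i'] gseg_single[of g "Suc i'"] gseg_double[of g i']
      by (auto simp: coface_def)
  qed
  have 2: "\<rho> (x, gseg G g 0 (coface j 0)) = (if j = 0 then \<rho> (x, g 1) else x)"
    using g[of 1] gseg_single[of g 0] act1 by (auto simp: coface_def)
  show ?thesis
    unfolding quot_op_def using 1 2 assms(5) by (auto simp: fun_eq_iff)
qed

lemma quot_op_degeneracy:
  assumes "complex_lie_group G" "holomorphic_right_action M G \<rho>"
    and "x \<in> pts M" "g \<in> PiE {1..n} (\<lambda>_. carrier G)" "j \<le> n"
  shows "quot_op G \<rho> (Suc n) (codegeneracy j) (x, g) =
    (x, \<lambda>i\<in>{1..Suc n}. if i \<le> j then g i else if i = Suc j then \<one>\<^bsub>G\<^esub> else g (i - 1))"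
proof -
  interpret group G using assms(1) by (simp add: complex_lie_group_def)
  have g: "g i \<in> carrier G" if "1 \<le> i" "i \<le> n" for i
    using assms(4) that by auto
  have act1: "\<rho> (x, \<one>\<^bsub>G\<^esub>) = x"
    using assms(2,3) by (simp add: holomorphic_right_action_def)
  have 1: "gseg G g (codegeneracy j (i - 1)) (codegeneracy j i) =
      (if i \<le> j then g i else if i = Suc j then \<one>\<^bsub>G\<^esub> else g (i - 1))"
    if i: "1 \<le> i" "i \<le> Suc n" for i
  proof -
    obtain i' where i': "i = Suc i'" using i by (cases i) auto
    consider "i \<le> j" | "i = Suc j" | "i > Suc j" by linarith
    then show ?thesis
    proof cases
      case 1
      then show ?thesis using i i' assms(5) g[of i] gseg_single[of g i'] by (auto simp: codegeneracy_def)
    next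
      case 2
      then show ?thesis using i' by (auto simp: codegeneracy_def)
    next
      case 3
      then obtain i'' where "i' = Suc i''" using i' by (cases i') auto
      then show ?thesis using 3 i i' g[of i'] gseg_single[of g i''] by (auto simp: codegeneracy_def)
    qed
  qed
  show ?thesis
    unfolding quot_op_def using 1 act1 by (auto simp: fun_eq_iff codegeneracy_def)
qed

section \<open>Equivariant bundles as simplices of \<open>Tot(HVB([M/G]))\<close>\<close>

definition equivariant_bundle ::
  "'m cmanifold \<Rightarrow> 'g lie_group \<Rightarrow> ('m \<times> 'g \<Rightarrow> 'm) \<Rightarrow> 'e cmanifold \<Rightarrow> ('e \<Rightarrow> 'm)
     \<Rightarrow> ('m \<Rightarrow> 'e cvs) \<Rightarrow> ('e \<times> 'g \<Rightarrow> 'e) \<Rightarrow> bool" where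
  "equivariant_bundle M G \<rho> E \<pi> V \<phi> \<longleftrightarrow>
     holomorphic_vector_bundle E M \<pi> V \<and>
     holomorphic_right_action E G \<phi> \<and>
     (\<forall>e\<in>pts E. \<forall>g\<in>carrier G. \<pi> (\<phi> (e, g)) = \<rho> (\<pi> e, g)) \<and>
     (\<forall>m\<in>pts M. \<forall>g\<in>carrier G. \<forall>e\<in>carrier (V m).
        (\<forall>e'\<in>carrier (V m). \<phi> (e \<oplus>\<^bsub>V m\<^esub> e', g) = \<phi> (e, g) \<oplus>\<^bsub>V (\<rho> (m, g))\<^esub> \<phi> (e', g)) \<and>
        (\<forall>c. \<phi> (c \<odot>\<^bsub>V m\<^esub> e, g) = c \<odot>\<^bsub>V (\<rho> (m, g))\<^esub> \<phi> (e, g)))"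

text \<open>The bundle isomorphism from the pullback along \<open>pr\<^sub>1\<close> to the pullback along \<open>\<rho>\<close>, over \<open>M \<times> G\<close>.\<close>

definition action_iso :: "('e \<times> 'g \<Rightarrow> 'e) \<Rightarrow> 'm \<times> 'g \<Rightarrow> 'e \<Rightarrow> 'e" where
  "action_iso \<phi> = (\<lambda>(m, g) e. \<phi> (e, g))"

definition G_invariant ::
  "'m cmanifold \<Rightarrow> 'g lie_group \<Rightarrow> ('m \<times> 'g \<Rightarrow> 'm) \<Rightarrow> ('m, 'e) cbundle \<Rightarrow> ('e \<times> 'g \<Rightarrow> 'e) \<Rightarrow> bool" where
  "G_invariant M G \<rho> B \<phi> \<longleftrightarrow>
     (let X = cprod M (lie_mfd G); B1 = pull X M fst B; B0 = pull X M \<rho> B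
      in \<forall>p\<in>pts X. \<forall>v\<in>tangent X p. \<forall>e\<in>carrier (fib B1 p).
           nabla_hom X B1 B0 (action_iso \<phi>) p v e = \<zero>\<^bsub>fib B0 p\<^esub>)"

text \<open>The maps \<open>[M/G]\<^sub>l \<rightarrow> [M/G]\<^sub>0 = M\<close> and \<open>[M/G]\<^sub>l \<rightarrow> [M/G]\<^sub>1 = M \<times> G\<close> induced by the \<open>i\<close>-th vertex
  and by the edge \<open>0 \<mapsto> t - 1, 1 \<mapsto> t\<close>; the evident identifications are built in.\<close>

definition vertex_map ::
  "('g, 'b) monoid_scheme \<Rightarrow> ('m \<times> 'g \<Rightarrow> 'm) \<Rightarrow> nat \<Rightarrow> 'm \<times> (nat \<Rightarrow> 'g) \<Rightarrow> 'm" where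
  "vertex_map G \<rho> i y = fst (quot_op G \<rho> 0 (\<lambda>_. i) y)"

definition edge_map ::
  "('g, 'b) monoid_scheme \<Rightarrow> ('m \<times> 'g \<Rightarrow> 'm) \<Rightarrow> nat \<Rightarrow> 'm \<times> (nat \<Rightarrow> 'g) \<Rightarrow> 'm \<times> 'g" where
  "edge_map G \<rho> t y = (let (x, h) = quot_op G \<rho> 1 (\<lambda>i. if i = 0 then t - 1 else t) y in (x, h 1))"

text \<open>The string of \<open>l\<close> isomorphisms over \<open>[M/G]\<^sub>l\<close> that is the value of \<open>F\<^sub>l\<close> on the top simplex.\<close>

definition top_string ::
  "'m cmanifold \<Rightarrow> 'g lie_group \<Rightarrow> ('m \<times> 'g \<Rightarrow> 'm) \<Rightarrow> ('m, 'e) cbundle \<Rightarrow> ('e \<times> 'g \<Rightarrow> 'e)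
     \<Rightarrow> nat \<Rightarrow> ('m \<times> (nat \<Rightarrow> 'g), 'e) hvb_simplex" where
  "top_string M G \<rho> B \<phi> l =
     (\<lambda>i. pull (quot M G l) M (vertex_map G \<rho> i) B,
      \<lambda>t y. action_iso \<phi> (edge_map G \<rho> t y))"

definition std_simplex :: "nat \<Rightarrow> nat \<Rightarrow> (nat \<Rightarrow> nat) set" where
  "std_simplex n k = {\<theta> \<in> {0..k} \<rightarrow>\<^sub>E {0..n}. mono_on {0..k} \<theta>}"

text \<open>A simplex of \<open>Tot\<close> is represented by its underlying family: \<open>F l k (\<theta>, \<eta>)\<close> is the value of
  \<open>F\<^sub>l\<close> on the \<open>k\<close>-simplex \<open>(\<theta>, \<eta>)\<close> of \<open>\<Delta>\<^sup>l \<times> \<Delta>\<^sup>n\<close>.\<close>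

type_synonym 's tot_family = "nat \<Rightarrow> nat \<Rightarrow> (nat \<Rightarrow> nat) \<times> (nat \<Rightarrow> nat) \<Rightarrow> 's"

text \<open>As \<open>F\<^sub>l\<close> is simplicial, its values are determined by the one on the top simplex.\<close>

definition equivariant_simplex ::
  "'m cmanifold \<Rightarrow> 'g lie_group \<Rightarrow> ('m \<times> 'g \<Rightarrow> 'm) \<Rightarrow> ('m, 'e) cbundle \<Rightarrow> ('e \<times> 'g \<Rightarrow> 'e)
     \<Rightarrow> ('m \<times> (nat \<Rightarrow> 'g), 'e) hvb_simplex tot_family" where
  "equivariant_simplex M G \<rho> B \<phi> = (\<lambda>l k (\<theta>, \<eta>). hvb_op \<theta> (top_string M G \<rho> B \<phi> l))"

definition Tot_Ch ::
  "'m cmanifold \<Rightarrow> 'g lie_group \<Rightarrow> ('m \<times> (nat \<Rightarrow> 'g), 'e) hvb_simplex tot_family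
     \<Rightarrow> ((nat list \<Rightarrow>\<^sub>0 int) \<Rightarrow> ('m \<times> (nat \<Rightarrow> 'g)) uform) tot_family" where
  "Tot_Ch M G F = (\<lambda>l k s. Ch (quot M G l) (F l k s))"

text \<open>For a family representing a \<open>0\<close>-simplex of \<open>Tot(\<Omega>([M/G]))\<close>.\<close>

definition zero_in_positive_form_degrees ::
  "'m cmanifold \<Rightarrow> 'g lie_group \<Rightarrow> ((nat list \<Rightarrow>\<^sub>0 int) \<Rightarrow> ('m \<times> (nat \<Rightarrow> 'g)) uform) tot_family \<Rightarrow> bool" where
  "zero_in_positive_form_degrees M G \<Phi> \<longleftrightarrow>
     (\<forall>l k. \<forall>s\<in>std_simplex l k \<times> std_simplex 0 k. \<forall>c\<in>normalized_chains k. \<forall>a j.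
        j > 0 \<longrightarrow> form_vanishes (quot M G l) j (\<Phi> l k s c a j))"

end

theory Submission
  imports Defs
begin

text \<open>
  Each bundle in the string over \<open>[M/G]\<^sub>l\<close> is the pullback of \<open>E\<close> along a vertex map, and the composite
  isomorphism between the vertices \<open>a \<le> b\<close> is \<open>e \<mapsto> \<phi>(e, g\<^bsub>a+1\<^esub> \<cdots> g\<^sub>b)\<close>, hence the pullback of \<open>\<phi>\<close> along
  the holomorphic map \<open>(x, g) \<mapsto> (x g\<^sub>1 \<cdots> g\<^sub>a, g\<^bsub>a+1\<^esub> \<cdots> g\<^sub>b)\<close> to \<open>M \<times> G\<close>. Its covariant derivative is the pullback
  of \<open>\<nabla>(\<phi>) = 0\<close>, so every factor \<open>\<nabla>(f)\<close> in the trace vanishes. To compare \<open>\<nabla>(\<phi>)\<close> with its pullback,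
  expand in local frames: the matrix of \<open>\<nabla>\<^sub>v(\<phi>)\<close> depends on \<open>v\<close> only through its image in the tangent
  space of \<open>M \<times> G\<close>.
\<close>

text \<open>The obstacle is the choices built into the definitions: a pulled back connection is
  computed in a trivialisation picked by \<open>SOME\<close>, and \<open>nabla_hom\<close>
  differentiates a section picked by \<open>SOME\<close>. The first choice depends only on the point
  of \<open>M\<close> that is reached, not on the map leading there. At corresponding points over
  \<open>[M/G]\<close> and over \<open>M x G\<close> the same frames are therefore selected, and the
  two covariant derivatives can be compared entry by entry. The chosen section leaves the formula
  because the terms differentiating its coefficients occur both in the derivative of the image
  section and in the image of the derivative, and cancel. Tangent vectors are functionals on all
  functions, with value zero off the holomorphic germs. With this normalisation, push-forward along
  composites and along the identity satisfies equations between functionals, so that a vector over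
  \<open>M x G\<close> can be substituted literally.\<close>

section \<open>Complex differentiability\<close>

text \<open>Caratheodory's form of the derivative: the increment is a combination of the coordinate
  increments with coefficients continuous at \<open>z\<close>. Product and chain rule then become
  algebra with continuous functions instead of estimates.\<close>

lemma cdifferentiable_iff_slope:
  "cdifferentiable n f z \<longleftrightarrow>
     (\<exists>\<phi>. (\<forall>i<n. continuous (at z within cspace n) (\<phi> i)) \<and>
        (\<forall>\<^sub>F w in at z within cspace n. f w - f z = (\<Sum>i<n. \<phi> i w * (w i - z i))))"
proof
  assume "cdifferentiable n f z"
  then obtain a where a: "\<And>e. e > 0 \<Longrightarrow> \<forall>\<^sub>F w in at z within cspace n.
        cmod (f w - f z - (\<Sum>i<n. a i * (w i - z i))) \<le> e * (\<Sum>i<n. cmod (w i - z i))"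
    unfolding cdifferentiable_def by blast
  define err where "err w = f w - f z - (\<Sum>i<n. a i * (w i - z i))" for w
  define S where "S w = (\<Sum>i<n. cmod (w i - z i))" for w
  \<comment> \<open>\<open>S = \<Sum>\<^sub>i cnj (sgn (w\<^sub>i - z\<^sub>i)) (w\<^sub>i - z\<^sub>i)\<close>, so the remainder can be distributed over the coordinates\<close>
  define \<phi> where "\<phi> i w = a i + err w / of_real (S w) * cnj (sgn (w i - z i))" for i w
  have "continuous (at z within cspace n) (\<phi> i)" if "i < n" for i
    unfolding continuous_within tendsto_iff
  proof (intro allI impI)
    fix e :: real assume e: "e > 0"
    show "\<forall>\<^sub>F w in at z within cspace n. dist (\<phi> i w) (\<phi> i z) < e"
      using a[OF half_gt_zero[OF e]]
    proof eventually_elim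
      case (elim w)
      have "cmod (err w / of_real (S w) * cnj (sgn (w i - z i))) \<le> cmod (err w) / \<bar>S w\<bar> * 1"
        unfolding norm_mult norm_divide by (intro mult_mono) (auto simp: norm_sgn)
      also have "\<dots> \<le> e / 2"
      proof (cases "S w = 0")
        case False
        moreover have "S w \<ge> 0" unfolding S_def by (simp add: sum_nonneg)
        ultimately show ?thesis using elim e
          by (simp add: err_def[symmetric] S_def[symmetric] divide_simps)
      qed (use e in simp)
      \<comment> \<open>At \<open>w = z\<close> the correction term vanishes because
        \<open>sgn 0 = 0\<close>, so \<open>\<phi> i z = a i\<close>.\<close>
      finally show ?case using e by (simp add: \<phi>_def dist_norm S_def)
    qed
  qed
  moreover have "\<forall>\<^sub>F w in at z within cspace n. f w - f z = (\<Sum>i<n. \<phi> i w * (w i - z i))"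
    using a[OF zero_less_one]
  proof eventually_elim
    case (elim w)
    have "cnj (sgn d) * d = of_real (cmod d)" for d :: complex
      by (cases "d = 0")
        (auto simp: sgn_eq complex_norm_square[symmetric] power2_eq_square field_simps)
    then have "(\<Sum>i<n. err w / of_real (S w) * cnj (sgn (w i - z i)) * (w i - z i))
        = err w / of_real (S w) * of_real (S w)"
      by (simp add: S_def sum_distrib_left mult.assoc)
    also have "\<dots> = err w"
    \<comment> \<open>Where the denominator is zero, the estimate with constant \<open>1\<close>
      forces \<open>err w = 0\<close>, so division by zero does no harm.\<close>
    proof (cases "S w = 0")
      case True
      then have "err w = 0" using elim by (simp add: S_def err_def)
      then show ?thesis by simp
    qed simp
    finally have "(\<Sum>i<n. \<phi> i w * (w i - z i)) = (\<Sum>i<n. a i * (w i - z i)) + err w"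
      by (simp only: \<phi>_def distrib_right sum.distrib)
    then show ?case by (simp add: err_def)
  qed
  ultimately show "\<exists>\<phi>. (\<forall>i<n. continuous (at z within cspace n) (\<phi> i)) \<and>
        (\<forall>\<^sub>F w in at z within cspace n. f w - f z = (\<Sum>i<n. \<phi> i w * (w i - z i)))"
    by blast
next
  assume "\<exists>\<phi>. (\<forall>i<n. continuous (at z within cspace n) (\<phi> i)) \<and>
        (\<forall>\<^sub>F w in at z within cspace n. f w - f z = (\<Sum>i<n. \<phi> i w * (w i - z i)))"
  then obtain \<phi> where \<phi>: "\<And>i. i < n \<Longrightarrow> continuous (at z within cspace n) (\<phi> i)"
    and eq: "\<forall>\<^sub>F w in at z within cspace n. f w - f z = (\<Sum>i<n. \<phi> i w * (w i - z i))"
    by blast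
  show "cdifferentiable n f z"
    unfolding cdifferentiable_def
  proof (intro exI[of _ "\<lambda>i. \<phi> i z"] allI impI)
    fix e :: real assume e: "e > 0"
    have "\<forall>\<^sub>F w in at z within cspace n. \<forall>i\<in>{..<n}. dist (\<phi> i w) (\<phi> i z) < e"
      using \<phi> e by (intro eventually_ball_finite) (auto simp: continuous_within tendsto_iff)
    with eq show "\<forall>\<^sub>F w in at z within cspace n.
        cmod (f w - f z - (\<Sum>i<n. \<phi> i z * (w i - z i))) \<le> e * (\<Sum>i<n. cmod (w i - z i))"
    proof eventually_elim
      case (elim w)
      have "cmod (\<Sum>i<n. (\<phi> i w - \<phi> i z) * (w i - z i)) \<le> (\<Sum>i<n. e * cmod (w i - z i))"
        using elim(2) by (intro sum_norm_le) (auto simp: norm_mult dist_norm less_imp_le intro!: mult_right_mono)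
      then show ?case
        by (simp add: elim(1) sum_distrib_left left_diff_distrib sum_subtractf)
    qed
  qed
qed

lemma cdifferentiable_slopeE:
  assumes "cdifferentiable n f z"
  obtains \<phi> where "\<And>i. i < n \<Longrightarrow> continuous (at z within cspace n) (\<phi> i)"
    "\<forall>\<^sub>F w in at z within cspace n. f w - f z = (\<Sum>i<n. \<phi> i w * (w i - z i))"
  using assms unfolding cdifferentiable_iff_slope by blast

section \<open>Rules of complex differentiation\<close>

lemma cdifferentiable_cong:
  assumes "cdifferentiable n g z" "\<forall>\<^sub>F w in at z within cspace n. f w = g w" "f z = g z"
  shows "cdifferentiable n f z"
proof -
  obtain a where a: "\<And>e. e > 0 \<Longrightarrow> \<forall>\<^sub>F w in at z within cspace n.
        cmod (g w - g z - (\<Sum>i<n. a i * (w i - z i))) \<le> e * (\<Sum>i<n. cmod (w i - z i))"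
    using assms(1) unfolding cdifferentiable_def by blast
  show ?thesis
    unfolding cdifferentiable_def
  proof (intro exI[of _ a] allI impI)
    fix e :: real assume "e > 0"
    from assms(2) a[OF this] show "\<forall>\<^sub>F w in at z within cspace n.
        cmod (f w - f z - (\<Sum>i<n. a i * (w i - z i))) \<le> e * (\<Sum>i<n. cmod (w i - z i))"
      by eventually_elim (simp add: assms(3))
  qed
qed

lemma cdifferentiable_const: "cdifferentiable n (\<lambda>_. c) z"
  unfolding cdifferentiable_def by (rule exI[of _ "\<lambda>_. 0"]) (auto simp: sum_nonneg)

lemma cdifferentiable_coordinate:
  assumes "i < n"
  shows "cdifferentiable n (\<lambda>w. w i) z"
  unfolding cdifferentiable_iff_slope
proof (intro exI[of _ "\<lambda>j w. if j = i then 1 else 0"] conjI allI impI always_eventually)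
  fix w :: "nat \<Rightarrow> complex"
  have "(\<Sum>j<n. (if j = i then 1 else 0) * (w j - z j)) = (\<Sum>j<n. if j = i then w j - z j else 0)"
    by (intro sum.cong) auto
  then show "w i - z i = (\<Sum>j<n. (if j = i then 1 else 0) * (w j - z j))"
    using assms by simp
qed simp

lemma tendsto_coordinatewise:
  fixes f :: "'a \<Rightarrow> 'b \<Rightarrow> 'c :: topological_space"
  assumes "\<And>i. ((\<lambda>x. f x i) \<longlongrightarrow> l i) F"
  shows "(f \<longlongrightarrow> l) F"
proof -
  have "limitin (product_topology (\<lambda>_. euclidean) UNIV) f l F"
    using assms by (simp add: limitin_componentwise)
  then show ?thesis by (simp add: euclidean_product_topology)
qed

lemma tendsto_coordinate:
  "((\<lambda>w :: 'b \<Rightarrow> 'c :: topological_space. w i) \<longlongrightarrow> z i) (at z within S)"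
  using continuous_on_product_coordinates[of i]
  by (metis UNIV_I continuous_on_def subset_UNIV tendsto_within_subset)

lemma cdifferentiable_imp_continuous:
  assumes "cdifferentiable n f z"
  shows "continuous (at z within cspace n) f"
proof -
  obtain \<phi> where \<phi>: "\<And>i. i < n \<Longrightarrow> (\<phi> i \<longlongrightarrow> \<phi> i z) (at z within cspace n)"
    and eq: "\<forall>\<^sub>F w in at z within cspace n. f w - f z = (\<Sum>i<n. \<phi> i w * (w i - z i))"
    using assms unfolding cdifferentiable_iff_slope continuous_within by blast
  have "((\<lambda>w. f z + (\<Sum>i<n. \<phi> i w * (w i - z i))) \<longlongrightarrow> f z + (\<Sum>i<n. \<phi> i z * (z i - z i))) (at z within cspace n)"
    using \<phi> tendsto_coordinate by (intro tendsto_intros) auto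
  moreover have "\<forall>\<^sub>F w in at z within cspace n. f z + (\<Sum>i<n. \<phi> i w * (w i - z i)) = f w"
    using eq by eventually_elim (simp add: algebra_simps)
  ultimately show ?thesis
    unfolding continuous_within using Lim_transform_eventually by fastforce
qed

lemma cdifferentiable_add:
  assumes "cdifferentiable n f z" "cdifferentiable n g z"
  shows "cdifferentiable n (\<lambda>w. f w + g w) z"
proof -
  obtain \<phi> where \<phi>: "\<And>i. i < n \<Longrightarrow> continuous (at z within cspace n) (\<phi> i)"
    and f_eq: "\<forall>\<^sub>F w in at z within cspace n. f w - f z = (\<Sum>i<n. \<phi> i w * (w i - z i))"
    using cdifferentiable_slopeE[OF assms(1)] by blast
  obtain \<psi> where \<psi>: "\<And>i. i < n \<Longrightarrow> continuous (at z within cspace n) (\<psi> i)"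
    and g_eq: "\<forall>\<^sub>F w in at z within cspace n. g w - g z = (\<Sum>i<n. \<psi> i w * (w i - z i))"
    using cdifferentiable_slopeE[OF assms(2)] by blast
  show ?thesis
    unfolding cdifferentiable_iff_slope
  proof (intro exI[of _ "\<lambda>i w. \<phi> i w + \<psi> i w"] conjI allI impI)
    from f_eq g_eq show "\<forall>\<^sub>F w in at z within cspace n.
      f w + g w - (f z + g z) = (\<Sum>i<n. (\<phi> i w + \<psi> i w) * (w i - z i))"
      by eventually_elim (simp add: sum.distrib sum_subtractf algebra_simps)
  qed (auto intro!: continuous_intros \<phi> \<psi>)
qed

lemma cdifferentiable_mult:
  assumes "cdifferentiable n f z" "cdifferentiable n g z"
  shows "cdifferentiable n (\<lambda>w. f w * g w) z"
proof -
  obtain \<phi> where \<phi>: "\<And>i. i < n \<Longrightarrow> continuous (at z within cspace n) (\<phi> i)"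
    and f_eq: "\<forall>\<^sub>F w in at z within cspace n. f w - f z = (\<Sum>i<n. \<phi> i w * (w i - z i))"
    using cdifferentiable_slopeE[OF assms(1)] by blast
  obtain \<psi> where \<psi>: "\<And>i. i < n \<Longrightarrow> continuous (at z within cspace n) (\<psi> i)"
    and g_eq: "\<forall>\<^sub>F w in at z within cspace n. g w - g z = (\<Sum>i<n. \<psi> i w * (w i - z i))"
    using cdifferentiable_slopeE[OF assms(2)] by blast
  show ?thesis
    unfolding cdifferentiable_iff_slope
  proof (intro exI[of _ "\<lambda>i w. \<phi> i w * g w + f z * \<psi> i w"] conjI allI impI)
    from f_eq g_eq show "\<forall>\<^sub>F w in at z within cspace n.
      f w * g w - f z * g z = (\<Sum>i<n. (\<phi> i w * g w + f z * \<psi> i w) * (w i - z i))"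
    proof eventually_elim
      case (elim w)
      have "f w * g w - f z * g z = (f w - f z) * g w + f z * (g w - g z)"
        by (simp add: algebra_simps)
      also have "\<dots> = (\<Sum>i<n. (\<phi> i w * g w + f z * \<psi> i w) * (w i - z i))"
        unfolding elim by (simp add: sum_distrib_left sum_distrib_right sum.distrib sum_subtractf algebra_simps)
      finally show ?case .
    qed
  qed (auto intro!: continuous_intros \<phi> \<psi> cdifferentiable_imp_continuous[OF assms(2)])
qed

text \<open>Inserting the slopes \<open>\<phi> i j\<close> of the components into the slopes
  \<open>\<gamma> i\<close> of \<open>g\<close> gives the slopes
  \<open>\<Sum>i<m. \<gamma> i (f w) * \<phi> i j w\<close> of the composite. Since \<open>g\<close>
  is only differentiable within \<open>cspace m\<close>, the values of \<open>f\<close> must stay in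
  that set.\<close>

lemma cdifferentiable_compose:
  assumes f: "\<And>i. i < m \<Longrightarrow> cdifferentiable n (\<lambda>w. f w i) z"
    and sp: "\<forall>\<^sub>F w in at z within cspace n. f w \<in> cspace m" "f z \<in> cspace m"
    and g: "cdifferentiable m g (f z)"
  shows "cdifferentiable n (\<lambda>w. g (f w)) z"
proof -
  have "\<forall>i. \<exists>\<phi>. i < m \<longrightarrow> (\<forall>j<n. continuous (at z within cspace n) (\<phi> j)) \<and>
     (\<forall>\<^sub>F w in at z within cspace n. f w i - f z i = (\<Sum>j<n. \<phi> j w * (w j - z j)))"
    using f unfolding cdifferentiable_iff_slope by blast
  from choice[OF this] obtain \<phi> where
    \<phi>: "\<And>i j. i < m \<Longrightarrow> j < n \<Longrightarrow> continuous (at z within cspace n) (\<phi> i j)" and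
    f_eq: "\<And>i. i < m \<Longrightarrow> \<forall>\<^sub>F w in at z within cspace n. f w i - f z i = (\<Sum>j<n. \<phi> i j w * (w j - z j))"
    by blast
  obtain \<gamma> where \<gamma>: "\<And>i. i < m \<Longrightarrow> continuous (at (f z) within cspace m) (\<gamma> i)"
    and g_eq: "\<forall>\<^sub>F y in at (f z) within cspace m. g y - g (f z) = (\<Sum>i<m. \<gamma> i y * (y i - f z i))"
    using cdifferentiable_slopeE[OF g] by blast
  have f_lim: "(f \<longlongrightarrow> f z) (at z within cspace n)"
  proof (rule tendsto_coordinatewise)
    fix i show "((\<lambda>w. f w i) \<longlongrightarrow> f z i) (at z within cspace n)"
    proof (cases "i < m")
      case True
      then show ?thesis
        using cdifferentiable_imp_continuous[OF f] by (simp add: continuous_within)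
    next
      case False
      \<comment> \<open>Nothing is assumed about the components from \<open>m\<close> on, but they
        vanish on \<open>cspace m\<close>.\<close>
      have "\<forall>\<^sub>F w in at z within cspace n. 0 = f w i"
        using sp(1) by eventually_elim (use False in \<open>simp add: cspace_def\<close>)
      then have "((\<lambda>w. f w i) \<longlongrightarrow> 0) (at z within cspace n)"
        by (rule Lim_transform_eventually[OF tendsto_const])
      then show ?thesis
        using False sp(2) by (simp add: cspace_def)
    qed
  qed
  have \<gamma>f: "continuous (at z within cspace n) (\<lambda>w. \<gamma> i (f w))" if "i < m" for i
    unfolding continuous_within
    by (rule continuous_within_tendsto_compose[OF \<gamma>[OF that] sp(1) f_lim])
  \<comment> \<open>The punctured filter at \<open>f z\<close> is too small, since
    \<open>f w = f z\<close> may happen for \<open>w\<close> different from \<open>z\<close>. The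
    slope equation of \<open>g\<close> is trivial at \<open>f z\<close> itself, hence holds along
    the full neighbourhood filter.\<close>
  have "filterlim f (inf (nhds (f z)) (principal (cspace m))) (at z within cspace n)"
    using f_lim sp(1) by (simp add: filterlim_inf filterlim_principal)
  moreover have "\<forall>\<^sub>F y in inf (nhds (f z)) (principal (cspace m)).
      g y - g (f z) = (\<Sum>i<m. \<gamma> i y * (y i - f z i))"
    using g_eq unfolding eventually_at_filter eventually_inf_principal
    by (rule eventually_mono) auto
  ultimately have gf: "\<forall>\<^sub>F w in at z within cspace n. g (f w) - g (f z) = (\<Sum>i<m. \<gamma> i (f w) * (f w i - f z i))"
    by (rule eventually_compose_filterlim[rotated])
  have "\<forall>\<^sub>F w in at z within cspace n. \<forall>i\<in>{..<m}. f w i - f z i = (\<Sum>j<n. \<phi> i j w * (w j - z j))"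
    using f_eq by (intro eventually_ball_finite) auto
  with gf have "\<forall>\<^sub>F w in at z within cspace n.
      g (f w) - g (f z) = (\<Sum>j<n. (\<Sum>i<m. \<gamma> i (f w) * \<phi> i j w) * (w j - z j))"
  proof eventually_elim
    case (elim w)
    have "g (f w) - g (f z) = (\<Sum>i<m. \<Sum>j<n. \<gamma> i (f w) * \<phi> i j w * (w j - z j))"
      using elim by (simp add: sum_distrib_left mult.assoc)
    then show ?case by (subst (asm) sum.swap) (simp add: sum_distrib_right)
  qed
  then show ?thesis
    unfolding cdifferentiable_iff_slope
    by (intro exI[of _ "\<lambda>j w. \<Sum>i<m. \<gamma> i (f w) * \<phi> i j w"])
      (auto intro!: continuous_intros \<gamma>f \<phi>)
qed

section \<open>Pointwise holomorphic maps\<close>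

subsection \<open>Germs\<close>

lemma near_imp_self: "near X p P \<Longrightarrow> P p"
  by (auto simp: near_def)

lemma near_openI: "openin (mtop X) W \<Longrightarrow> p \<in> W \<Longrightarrow> near X p (\<lambda>q. q \<in> W)"
  by (auto simp: near_def)

lemma near_pts: "p \<in> pts X \<Longrightarrow> near X p (\<lambda>q. q \<in> pts X)"
  by (rule near_openI) auto

lemma near_mono: "near X p P \<Longrightarrow> (\<And>q. q \<in> pts X \<Longrightarrow> P q \<Longrightarrow> Q q) \<Longrightarrow> near X p Q"
  unfolding near_def by (meson openin_subset subsetD)

lemma near_conj: "near X p P \<Longrightarrow> near X p Q \<Longrightarrow> near X p (\<lambda>q. P q \<and> Q q)"
  unfolding near_def by (meson IntD1 IntD2 IntI openin_Int)

lemma near_near: "near X p P \<Longrightarrow> near X p (\<lambda>q. near X q P)"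
  unfolding near_def by blast

lemma near_open_sub:
  assumes "openin (mtop X) W" "p \<in> W"
  shows "near (open_sub X W) p P \<longleftrightarrow> near X p P"
proof
  assume "near X p P"
  then obtain A where "openin (mtop X) A" "p \<in> A" "\<forall>q\<in>A. P q" unfolding near_def by blast
  then show "near (open_sub X W) p P"
    unfolding near_def using assms
    by (intro exI[of _ "A \<inter> W"]) (auto simp: open_sub_def openin_open_subtopology)
qed (use assms in \<open>auto simp: near_def open_sub_def openin_open_subtopology\<close>)

subsection \<open>Charts\<close>

text \<open>The part of the definition of a complex manifold that the chain rule needs. It passes to products,
  powers and open submanifolds without a discussion of separation or of the transition maps.\<close>

definition charted :: "'a cmanifold \<Rightarrow> bool" where
  "charted X \<longleftrightarrow>
     (\<Union>(n, U, x)\<in>atlas X. U) = pts X \<and>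
     (\<forall>(n, U, x)\<in>atlas X. openin (mtop X) U \<and> inj_on x U \<and>
        (\<forall>W. openin (mtop X) W \<longrightarrow> openin (top_of_set (cspace n)) (x ` (U \<inter> W))))"

text \<open>Openness of the images is a local condition, so it is enough to find a neighbourhood for
  each point; in products and powers these come from basic open boxes.\<close>

lemma chartedI:
  assumes "\<And>p. p \<in> pts X \<Longrightarrow> \<exists>n U x. (n, U, x) \<in> atlas X \<and> p \<in> U"
    and "\<And>n U x. (n, U, x) \<in> atlas X \<Longrightarrow> openin (mtop X) U"
    and "\<And>n U x. (n, U, x) \<in> atlas X \<Longrightarrow> inj_on x U"
    and "\<And>n U x p. (n, U, x) \<in> atlas X \<Longrightarrow> p \<in> U \<Longrightarrow> x p \<in> cspace n"
    and "\<And>n U x W p. (n, U, x) \<in> atlas X \<Longrightarrow> openin (mtop X) W \<Longrightarrow> p \<in> U \<Longrightarrow> p \<in> W \<Longrightarrow>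
      \<exists>T. open T \<and> x p \<in> T \<and> T \<inter> cspace n \<subseteq> x ` (U \<inter> W)"
  shows "charted X"
proof -
  have "openin (top_of_set (cspace n)) (x ` (U \<inter> W))"
    if *: "(n, U, x) \<in> atlas X" "openin (mtop X) W" for n U x W
    unfolding openin_subopen[of _ "x ` (U \<inter> W)"]
  proof
    fix z assume "z \<in> x ` (U \<inter> W)"
    then obtain p where p: "z = x p" "p \<in> U" "p \<in> W" by blast
    then obtain T where "open T" "x p \<in> T" "T \<inter> cspace n \<subseteq> x ` (U \<inter> W)"
      using assms(5)[OF * p(2,3)] by blast
    then show "\<exists>T. openin (top_of_set (cspace n)) T \<and> z \<in> T \<and> T \<subseteq> x ` (U \<inter> W)"
      using assms(4) * p
      by (intro exI[of _ "cspace n \<inter> T"]) (auto simp: openin_open)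
  qed
  moreover have "(\<Union>(n, U, x)\<in>atlas X. U) = pts X"
    using assms(1,2) by (force dest: openin_subset)
  ultimately show ?thesis
    unfolding charted_def using assms(2,3) by fast
qed

lemma charted_chart_at:
  assumes "charted X" "p \<in> pts X"
  obtains n U x where "(n, U, x) \<in> atlas X" "p \<in> U"
  using assms unfolding charted_def by blast

lemma charted_open: "charted X \<Longrightarrow> (n, U, x) \<in> atlas X \<Longrightarrow> openin (mtop X) U"
  and charted_inj: "charted X \<Longrightarrow> (n, U, x) \<in> atlas X \<Longrightarrow> inj_on x U"
  and charted_open_image: "charted X \<Longrightarrow> (n, U, x) \<in> atlas X \<Longrightarrow> openin (mtop X) W \<Longrightarrow>
    openin (top_of_set (cspace n)) (x ` (U \<inter> W))"
  unfolding charted_def by fast+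

lemma charted_in_cspace:
  assumes "charted X" "(n, U, x) \<in> atlas X" "p \<in> U"
  shows "x p \<in> cspace n"
  using openin_subset[OF charted_open_image[OF assms(1,2) openin_topspace]] assms
    openin_subset[OF charted_open[OF assms(1,2)]] by auto

lemma charted_open_image_ex:
  assumes "charted X" "(n, U, x) \<in> atlas X" "openin (mtop X) W"
  obtains T where "open T" "x ` (U \<inter> W) = cspace n \<inter> T"
  using charted_open_image[OF assms] unfolding openin_open by blast

text \<open>Translates statements about germs at \<open>p\<close> into statements about the filter
  in coordinate space. Membership in the chart image is included because \<open>inv_into\<close>
  means nothing outside of it.\<close>

lemma chart_eventually:
  assumes X: "charted X" and ch: "(n, U, x) \<in> atlas X" and p: "p \<in> U" and P: "near X p P"
  shows "\<forall>\<^sub>F z in at (x p) within cspace n. z \<in> x ` U \<and> P (inv_into U x z)"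
proof -
  obtain W where W: "openin (mtop X) W" "p \<in> W" "\<forall>q\<in>W. P q" using P unfolding near_def by blast
  obtain T where T: "open T" "x ` (U \<inter> W) = cspace n \<inter> T"
    using charted_open_image_ex[OF X ch W(1)] .
  have "z \<in> x ` U \<and> P (inv_into U x z)" if "z \<in> T" "z \<in> cspace n" for z
  proof -
    have "z \<in> x ` (U \<inter> W)" using T(2) that by blast
    then show ?thesis using W(3) charted_inj[OF X ch] by auto
  qed
  moreover have "x p \<in> T" using T(2) p W(2) by blast
  ultimately show ?thesis
    unfolding eventually_at_topological using T(1) by blast
qed

text \<open>A chart is a homeomorphism onto a set that is itself open in \<open>cspace n\<close>, so
  being open in this image and being open in \<open>cspace n\<close> agree for its subsets.\<close>

lemma complex_manifold_charted:
  assumes "complex_manifold X"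
  shows "charted X"
proof -
  have X: "openin (mtop X) U" "openin (top_of_set (cspace n)) (x ` U)"
    "homeomorphic_map (subtopology (mtop X) U) (top_of_set (x ` U)) x"
    if "(n, U, x) \<in> atlas X" for n U x
    using assms that unfolding complex_manifold_def by fast+
  have inj: "inj_on x U" if ch: "(n, U, x) \<in> atlas X" for n U x
  proof -
    have "topspace (subtopology (mtop X) U) = U"
      using openin_subset[OF X(1)[OF ch]] by auto
    with homeomorphic_imp_injective_map[OF X(3)[OF ch]] show ?thesis by simp
  qed
  have op: "openin (top_of_set (cspace n)) (x ` (U \<inter> W))"
    if ch: "(n, U, x) \<in> atlas X" and W: "openin (mtop X) W" for n U x W
  proof -
    have "openin (subtopology (mtop X) U) (U \<inter> W)"
      using X(1)[OF ch] W by (simp add: openin_open_subtopology openin_Int)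
    then have "openin (top_of_set (x ` U)) (x ` (U \<inter> W))"
      using homeomorphic_imp_open_map[OF X(3)[OF ch]] by (simp add: open_map_def)
    then show ?thesis using X(2)[OF ch] by (rule openin_trans)
  qed
  have "(\<Union>(n, U, x)\<in>atlas X. U) = pts X"
    using assms unfolding complex_manifold_def by fast
  then show ?thesis
    unfolding charted_def using X(1) inj op by fast
qed

subsection \<open>Functions differentiable at a point\<close>

lemma cdiff_at_cong:
  assumes "charted X" "cdiff_at X g p" "near X p (\<lambda>q. f q = g q)"
  shows "cdiff_at X f p"
  unfolding cdiff_at_def
proof clarify
  fix n U x assume ch: "(n, U, x) \<in> atlas X" "p \<in> U"
  show "cdifferentiable n (f \<circ> inv_into U x) (x p)"
  proof (rule cdifferentiable_cong)
    show "cdifferentiable n (g \<circ> inv_into U x) (x p)"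
      using assms(2) ch by (auto simp: cdiff_at_def)
    show "\<forall>\<^sub>F w in at (x p) within cspace n. (f \<circ> inv_into U x) w = (g \<circ> inv_into U x) w"
      using chart_eventually[OF assms(1) ch assms(3)] by eventually_elim simp
    show "(f \<circ> inv_into U x) (x p) = (g \<circ> inv_into U x) (x p)"
      using ch charted_inj[OF assms(1) ch(1)] near_imp_self[OF assms(3)] by simp
  qed
qed

lemma cdiff_at_const: "cdiff_at X (\<lambda>_. c) p"
  by (auto simp: cdiff_at_def comp_def cdifferentiable_const)

lemma cdiff_at_add: "cdiff_at X f p \<Longrightarrow> cdiff_at X g p \<Longrightarrow> cdiff_at X (\<lambda>q. f q + g q) p"
  unfolding cdiff_at_def comp_def using cdifferentiable_add by fast

lemma cdiff_at_mult: "cdiff_at X f p \<Longrightarrow> cdiff_at X g p \<Longrightarrow> cdiff_at X (\<lambda>q. f q * g q) p"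
  unfolding cdiff_at_def comp_def using cdifferentiable_mult by fast

subsection \<open>Maps differentiable at a point\<close>

text \<open>A pointwise form of \<open>holo_map\<close>: local sections and inverse trivialisations
  are total functions that are meaningful only over an open set.\<close>

definition cdiff_map_at :: "'a cmanifold \<Rightarrow> 'b cmanifold \<Rightarrow> ('a \<Rightarrow> 'b) \<Rightarrow> 'a \<Rightarrow> bool" where
  "cdiff_map_at X Y f p \<longleftrightarrow>
     p \<in> pts X \<and> f p \<in> pts Y \<and>
     (\<forall>W. openin (mtop Y) W \<longrightarrow> f p \<in> W \<longrightarrow> near X p (\<lambda>q. f q \<in> W)) \<and>
     (\<forall>(n, V, y)\<in>atlas Y. f p \<in> V \<longrightarrow> (\<forall>i<n. cdiff_at X (\<lambda>q. y (f q) i) p))"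

lemma cdiff_map_at_imp_near:
  assumes "cdiff_map_at X Y f p" "near Y (f p) P"
  shows "near X p (\<lambda>q. P (f q))"
proof -
  obtain W where W: "openin (mtop Y) W" "f p \<in> W" "\<forall>q\<in>W. P q"
    using assms(2) unfolding near_def by blast
  then have "near X p (\<lambda>q. f q \<in> W)" using assms(1) by (simp add: cdiff_map_at_def)
  then show ?thesis by (rule near_mono) (use W in blast)
qed

lemma cdiff_map_at_coordinate:
  "cdiff_map_at X Y f p \<Longrightarrow> (n, V, y) \<in> atlas Y \<Longrightarrow> f p \<in> V \<Longrightarrow> i < n \<Longrightarrow> cdiff_at X (\<lambda>q. y (f q) i) p"
  unfolding cdiff_map_at_def by fast

lemma holo_map_imp_cdiff_map_at:
  assumes "holo_map X Y f" "p \<in> pts X"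
  shows "cdiff_map_at X Y f p"
proof -
  have cont: "continuous_map (mtop X) (mtop Y) f" using assms by (simp add: holo_map_def)
  have "near X p (\<lambda>q. f q \<in> W)" if "openin (mtop Y) W" "f p \<in> W" for W
    unfolding near_def
    by (intro exI[of _ "{q \<in> pts X. f q \<in> W}"])
      (use that assms openin_continuous_map_preimage[OF cont that(1)] in auto)
  moreover have "f p \<in> pts Y" using cont assms(2) by (auto simp: continuous_map_def)
  ultimately show ?thesis
    using assms unfolding cdiff_map_at_def holo_map_def by fast
qed

lemma holo_map_iff_cdiff_map_at:
  "holo_map X Y f \<longleftrightarrow> (\<forall>p\<in>pts X. cdiff_map_at X Y f p)"
proof
  assume f: "\<forall>p\<in>pts X. cdiff_map_at X Y f p"
  have "continuous_map (mtop X) (mtop Y) f"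
    unfolding continuous_map_def
  proof (intro conjI allI impI)
    show "f \<in> pts X \<rightarrow> pts Y" using f by (auto simp: cdiff_map_at_def)
    fix W assume W: "openin (mtop Y) W"
    show "openin (mtop X) {x \<in> pts X. f x \<in> W}"
    proof (subst openin_subopen, intro ballI)
      fix p assume "p \<in> {x \<in> pts X. f x \<in> W}"
      then have "near X p (\<lambda>q. f q \<in> W)" using f W by (auto simp: cdiff_map_at_def)
      then show "\<exists>T. openin (mtop X) T \<and> p \<in> T \<and> T \<subseteq> {x \<in> pts X. f x \<in> W}"
        unfolding near_def by (auto dest: openin_subset)
    qed
  qed
  then show "holo_map X Y f"
    using f unfolding cdiff_map_at_def holo_map_def by fast
qed (simp add: holo_map_imp_cdiff_map_at)

text \<open>In coordinates, insert a chart of \<open>Y\<close> around \<open>f p\<close> and its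
  inverse between \<open>f\<close> and \<open>g\<close>. The continuity clause of
  \<open>cdiff_map_at\<close> keeps nearby values of \<open>f\<close> inside this chart, so that the
  insertion changes nothing near \<open>x p\<close>.\<close>

lemma cdiff_at_compose:
  assumes X: "charted X" and Y: "charted Y"
    and f: "cdiff_map_at X Y f p" and g: "cdiff_at Y g (f p)"
  shows "cdiff_at X (\<lambda>q. g (f q)) p"
  unfolding cdiff_at_def
proof clarify
  fix n U x assume ch: "(n, U, x) \<in> atlas X" "p \<in> U"
  have "f p \<in> pts Y" using f by (simp add: cdiff_map_at_def)
  then obtain m V y where ch': "(m, V, y) \<in> atlas Y" "f p \<in> V"
    by (rule charted_chart_at[OF Y])
  have inv_p: "inv_into U x (x p) = p" using ch charted_inj[OF X ch(1)] by simp
  have inv_fp: "inv_into V y (y q) = q" if "q \<in> V" for q using that charted_inj[OF Y ch'(1)] by simp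
  have ev: "\<forall>\<^sub>F z in at (x p) within cspace n. f (inv_into U x z) \<in> V"
    using chart_eventually[OF X ch cdiff_map_at_imp_near[OF f near_openI[OF charted_open[OF Y ch'(1)] ch'(2)]]]
    by eventually_elim simp
  have "cdifferentiable n (\<lambda>z. (g \<circ> inv_into V y) (y (f (inv_into U x z)))) (x p)"
  proof (rule cdifferentiable_compose[where m = m and f = "\<lambda>z. y (f (inv_into U x z))"])
    show "cdifferentiable n (\<lambda>z. y (f (inv_into U x z)) i) (x p)" if "i < m" for i
      using cdiff_map_at_coordinate[OF f ch' that] ch by (auto simp: cdiff_at_def comp_def)
    show "\<forall>\<^sub>F z in at (x p) within cspace n. y (f (inv_into U x z)) \<in> cspace m"
      using ev by eventually_elim (rule charted_in_cspace[OF Y ch'(1)])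
    show "y (f (inv_into U x (x p))) \<in> cspace m"
      unfolding inv_p by (rule charted_in_cspace[OF Y ch'])
    show "cdifferentiable m (g \<circ> inv_into V y) (y (f (inv_into U x (x p))))"
      unfolding inv_p using g ch' by (auto simp: cdiff_at_def)
  qed
  then show "cdifferentiable n ((\<lambda>q. g (f q)) \<circ> inv_into U x) (x p)"
  proof (rule cdifferentiable_cong)
    show "\<forall>\<^sub>F z in at (x p) within cspace n.
        ((\<lambda>q. g (f q)) \<circ> inv_into U x) z = (g \<circ> inv_into V y) (y (f (inv_into U x z)))"
      using ev by eventually_elim (simp add: inv_fp)
  qed (simp add: inv_p inv_fp ch')
qed

lemma cdiff_map_at_compose:
  assumes "charted X" "charted Y" "cdiff_map_at X Y f p" "cdiff_map_at Y Z g (f p)"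
  shows "cdiff_map_at X Z (\<lambda>q. g (f q)) p"
  unfolding cdiff_map_at_def
proof (intro conjI allI impI)
  show "p \<in> pts X" "g (f p) \<in> pts Z" using assms(3,4) by (simp_all add: cdiff_map_at_def)
  fix W assume "openin (mtop Z) W" "g (f p) \<in> W"
  then show "near X p (\<lambda>q. g (f q) \<in> W)"
    by (intro cdiff_map_at_imp_near[OF assms(3)] cdiff_map_at_imp_near[OF assms(4)] near_openI)
next
  show "\<forall>(n, V, y)\<in>atlas Z. g (f p) \<in> V \<longrightarrow> (\<forall>i<n. cdiff_at X (\<lambda>q. y (g (f q)) i) p)"
    using cdiff_at_compose[OF assms(1-3)] cdiff_map_at_coordinate[OF assms(4)] by fast
qed

lemma cdiff_map_at_cong:
  assumes "charted X" "cdiff_map_at X Y g p" "near X p (\<lambda>q. f q = g q)"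
  shows "cdiff_map_at X Y f p"
  unfolding cdiff_map_at_def
proof (intro conjI allI impI)
  have fp: "f p = g p" using near_imp_self[OF assms(3)] .
  show "p \<in> pts X" "f p \<in> pts Y" using assms(2) fp by (simp_all add: cdiff_map_at_def)
  show "near X p (\<lambda>q. f q \<in> W)" if "openin (mtop Y) W" "f p \<in> W" for W
    by (rule near_mono[OF near_conj[OF assms(3) cdiff_map_at_imp_near[OF assms(2) near_openI]]])
      (use that fp in auto)
  show "\<forall>(n, V, y)\<in>atlas Y. f p \<in> V \<longrightarrow> (\<forall>i<n. cdiff_at X (\<lambda>q. y (f q) i) p)"
  proof clarify
    fix n V y i assume *: "(n, V, y) \<in> atlas Y" "f p \<in> V" "i < n"
    show "cdiff_at X (\<lambda>q. y (f q) i) p"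
      by (rule cdiff_at_cong[OF assms(1) cdiff_map_at_coordinate[OF assms(2) *(1) _ *(3)]])
        (use * fp in \<open>auto intro: near_mono[OF assms(3)]\<close>)
  qed
qed

lemma cdiff_map_at_const: "c \<in> pts Y \<Longrightarrow> p \<in> pts X \<Longrightarrow> cdiff_map_at X Y (\<lambda>_. c) p"
  unfolding cdiff_map_at_def by (auto intro: cdiff_at_const near_mono[OF near_pts])

text \<open>Holomorphy of the identity is holomorphy of the transition maps, the information about a
  manifold that \<open>charted\<close> omits. It is handed on separately in this form.\<close>

lemma complex_manifold_holo_map_id:
  assumes "complex_manifold X"
  shows "holo_map X X (\<lambda>q. q)"
proof -
  have "cdifferentiable n (\<lambda>z. y (inv_into U x z) i) (x p)"
    if "(n, U, x) \<in> atlas X" "(m, V, y) \<in> atlas X" "p \<in> U" "p \<in> V" "i < m" for n U x m V y p i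
    using assms that unfolding complex_manifold_def by fast
  then show ?thesis
    unfolding holo_map_def cdiff_at_def comp_def by auto
qed

subsection \<open>Products, powers and open submanifolds\<close>

text \<open>Charts of products and powers concatenate coordinates; this cuts one block out again,
  padded with zeros so as to lie in \<open>cspace n\<close>.\<close>

definition slice :: "nat \<Rightarrow> nat \<Rightarrow> (nat \<Rightarrow> complex) \<Rightarrow> nat \<Rightarrow> complex" where
  "slice a n z = (\<lambda>i. if i < n then z (a + i) else 0)"

lemma slice_in_cspace: "slice a n z \<in> cspace n"
  by (simp add: slice_def cspace_def)

lemma open_slice_vimage: "open S \<Longrightarrow> open (slice a n -` S)"
proof (rule open_vimage)
  have "continuous_on UNIV (\<lambda>z. slice a n z i)" for i
    by (cases "i < n") (simp_all add: slice_def)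
  then show "continuous_on UNIV (slice a n)"
    by (rule continuous_on_coordinatewise_then_product)
qed

text \<open>Covers both factors of a product and all components of a power: in suitable charts each
  projection extracts a block of consecutive coordinates, and \<open>slice\<close> is differentiable
  because its components are coordinates.\<close>

lemma cdiff_at_projection:
  assumes Z: "charted Z" and X: "charted X" and pZ: "p \<in> pts Z" and g: "cdiff_at X g (pr p)"
    and ch: "\<And>N W w. (N, W, w) \<in> atlas Z \<Longrightarrow> p \<in> W \<Longrightarrow>
      \<exists>n U x a. (n, U, x) \<in> atlas X \<and> a + n \<le> N \<and> (\<forall>q\<in>W. pr q \<in> U \<and> (\<forall>i<n. w q (a + i) = x (pr q) i))"
  shows "cdiff_at Z (\<lambda>q. g (pr q)) p"
  unfolding cdiff_at_def
proof clarify
  fix N W w assume chZ: "(N, W, w) \<in> atlas Z" "p \<in> W"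
  obtain n U x a where chX: "(n, U, x) \<in> atlas X" and a: "a + n \<le> N"
    and pr: "\<And>q. q \<in> W \<Longrightarrow> pr q \<in> U" "\<And>q i. q \<in> W \<Longrightarrow> i < n \<Longrightarrow> w q (a + i) = x (pr q) i"
    using ch[OF chZ] by blast
  have sl: "slice a n (w q) = x (pr q)" if "q \<in> W" for q
    using charted_in_cspace[OF X chX pr(1)[OF that]] that
    by (auto simp: slice_def fun_eq_iff cspace_def pr(2))
  have inv: "inv_into U x (slice a n (w q)) = pr q" "inv_into W w (w q) = q" if "q \<in> W" for q
    using that pr(1) sl charted_inj[OF X chX] charted_inj[OF Z chZ(1)] by simp_all
  have "cdifferentiable N (\<lambda>z. (g \<circ> inv_into U x) (slice a n z)) (w p)"
  proof (rule cdifferentiable_compose[where m = n and f = "slice a n"])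
    show "cdifferentiable N (\<lambda>z. slice a n z i) (w p)" if "i < n" for i
      using that a by (simp add: slice_def cdifferentiable_coordinate)
    show "cdifferentiable n (g \<circ> inv_into U x) (slice a n (w p))"
      using g chX pr(1)[OF chZ(2)] by (auto simp: cdiff_at_def sl[OF chZ(2)])
  qed (simp_all add: slice_in_cspace)
  then show "cdifferentiable N ((\<lambda>q. g (pr q)) \<circ> inv_into W w) (w p)"
  proof (rule cdifferentiable_cong)
    show "\<forall>\<^sub>F z in at (w p) within cspace N.
        ((\<lambda>q. g (pr q)) \<circ> inv_into W w) z = (g \<circ> inv_into U x) (slice a n z)"
      using chart_eventually[OF Z chZ near_pts[OF pZ]]
      by eventually_elim (auto simp: inv)
  qed (simp add: inv chZ)
qed

lemma pts_cprod [simp]: "pts (cprod X Y) = pts X \<times> pts Y"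
  by (simp add: cprod_def)

lemma pts_cpow [simp]: "pts (cpow X l) = PiE {1..l} (\<lambda>_. pts X)"
  by (simp add: cpow_def)

lemma pts_open_sub [simp]: "pts (open_sub X W) = pts X \<inter> W"
  by (simp add: open_sub_def)

lemma pts_affine_cspace [simp]: "pts (affine_cspace r) = cspace r"
  by (simp add: affine_cspace_def)

lemma atlas_cprodI:
  "(n, U, x) \<in> atlas X \<Longrightarrow> (m, V, y) \<in> atlas Y \<Longrightarrow>
    (n + m, U \<times> V, \<lambda>(p, q) i. if i < n then x p i else y q (i - n)) \<in> atlas (cprod X Y)"
  unfolding cprod_def cmanifold.simps by blast

lemma openin_cprodE:
  assumes "openin (mtop (cprod X Y)) W" "(p, q) \<in> W"
  obtains P Q where "openin (mtop X) P" "openin (mtop Y) Q" "p \<in> P" "q \<in> Q" "P \<times> Q \<subseteq> W"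
proof -
  have "\<exists>P Q. openin (mtop X) P \<and> openin (mtop Y) Q \<and> p \<in> P \<and> q \<in> Q \<and> P \<times> Q \<subseteq> W"
    using assms by (simp add: cprod_def openin_prod_topology_alt)
  then show thesis using that by (elim exE conjE)
qed

text \<open>A point of \<open>cspace (n + m)\<close> is determined by its two blocks, so injectivity
  and openness of images can be read off from the factors.\<close>

lemma charted_cprod:
  assumes X: "charted X" and Y: "charted Y"
  shows "charted (cprod X Y)"
proof (rule chartedI)
  fix p assume "p \<in> pts (cprod X Y)"
  then have p: "fst p \<in> pts X" "snd p \<in> pts Y" by auto
  obtain n U x where "(n, U, x) \<in> atlas X" "fst p \<in> U"
    using charted_chart_at[OF X p(1)] by blast
  moreover obtain m V y where "(m, V, y) \<in> atlas Y" "snd p \<in> V"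
    using charted_chart_at[OF Y p(2)] by blast
  ultimately show "\<exists>n U x. (n, U, x) \<in> atlas (cprod X Y) \<and> p \<in> U"
    using atlas_cprodI by (fastforce simp: mem_Times_iff)
next
  fix N A z assume "(N, A, z) \<in> atlas (cprod X Y)"
  then obtain n U x m V y where eq: "N = n + m" "A = U \<times> V"
    "z = (\<lambda>(p, q) i. if i < n then x p i else y q (i - n))"
    and ch: "(n, U, x) \<in> atlas X" "(m, V, y) \<in> atlas Y"
    by (auto simp: cprod_def)
  show "openin (mtop (cprod X Y)) A"
    using charted_open[OF X ch(1)] charted_open[OF Y ch(2)]
    by (simp add: eq cprod_def openin_prod_Times_iff)
  have sl: "slice 0 n (z (p, q)) = x p" "slice n m (z (p, q)) = y q" if "p \<in> U" "q \<in> V" for p q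
    using charted_in_cspace[OF X ch(1) that(1)] charted_in_cspace[OF Y ch(2) that(2)]
    by (auto simp: slice_def fun_eq_iff cspace_def eq)
  show "inj_on z A"
  proof (rule inj_onI, clarsimp simp: eq(2))
    fix p q p' q' assume *: "p \<in> U" "q \<in> V" "p' \<in> U" "q' \<in> V" "z (p, q) = z (p', q')"
    then have "x p = x p'" "y q = y q'" using sl by metis+
    then show "p = p' \<and> q = q'"
      using * charted_inj[OF X ch(1)] charted_inj[OF Y ch(2)] by (auto dest: inj_onD)
  qed
  fix pq assume "pq \<in> A"
  then obtain p q where pq: "pq = (p, q)" "p \<in> U" "q \<in> V" by (auto simp: eq)
  then show "z pq \<in> cspace N"
    using charted_in_cspace[OF Y ch(2) pq(3)] by (auto simp: eq cspace_def)
  fix W assume W: "openin (mtop (cprod X Y)) W" "pq \<in> W"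
  then obtain P Q where PQ: "openin (mtop X) P" "openin (mtop Y) Q" "p \<in> P" "q \<in> Q" "P \<times> Q \<subseteq> W"
    unfolding pq by (rule openin_cprodE)
  obtain S where S: "open S" "x ` (U \<inter> P) = cspace n \<inter> S"
    using charted_open_image_ex[OF X ch(1) PQ(1)] .
  obtain T where T: "open T" "y ` (V \<inter> Q) = cspace m \<inter> T"
    using charted_open_image_ex[OF Y ch(2) PQ(2)] .
  show "\<exists>R. open R \<and> z pq \<in> R \<and> R \<inter> cspace N \<subseteq> z ` (A \<inter> W)"
  proof (intro exI conjI)
    show "open (slice 0 n -` S \<inter> slice n m -` T)"
      using S(1) T(1) by (intro open_Int open_slice_vimage)
    show "z pq \<in> slice 0 n -` S \<inter> slice n m -` T"
      using S(2) T(2) PQ pq by (auto simp: sl)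
    show "slice 0 n -` S \<inter> slice n m -` T \<inter> cspace N \<subseteq> z ` (A \<inter> W)"
    proof
      fix w assume w: "w \<in> slice 0 n -` S \<inter> slice n m -` T \<inter> cspace N"
      then have "slice 0 n w \<in> x ` (U \<inter> P)" "slice n m w \<in> y ` (V \<inter> Q)"
        unfolding S(2) T(2) by (auto simp: slice_in_cspace)
      then obtain p' q' where p': "p' \<in> U \<inter> P" "slice 0 n w = x p'"
        and q': "q' \<in> V \<inter> Q" "slice n m w = y q'" by auto
      have "w i = z (p', q') i" for i
      proof -
        \<comment> \<open>The second case includes indices beyond both blocks, where both sides are
          zero because \<open>w\<close> lies in \<open>cspace N\<close>.\<close>
        consider "i < n" | k where "i = n + k" by (metis le_Suc_ex not_less)
        then show ?thesis
        proof cases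
          case 1
          then show ?thesis using fun_cong[OF p'(2), of i] by (simp add: slice_def eq)
        next
          case (2 k)
          then show ?thesis using fun_cong[OF q'(2), of k] w
            by (auto simp: slice_def eq cspace_def split: if_splits)
        qed
      qed
      then have "w = z (p', q')" by auto
      moreover have "(p', q') \<in> A \<inter> W" using p' q' PQ(5) by (auto simp: eq)
      ultimately show "w \<in> z ` (A \<inter> W)" by blast
    qed
  qed
qed

lemma cdiff_at_fst:
  assumes "charted X" "charted Y" "q \<in> pts Y" "p \<in> pts X" "cdiff_at X g p"
  shows "cdiff_at (cprod X Y) (\<lambda>z. g (fst z)) (p, q)"
proof (rule cdiff_at_projection[OF charted_cprod[OF assms(1,2)] assms(1)])
  fix N W w assume "(N, W, w) \<in> atlas (cprod X Y)" "(p, q) \<in> W"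
  then obtain n U x m V y where eq: "N = n + m" "W = U \<times> V"
    "w = (\<lambda>(p, q) i. if i < n then x p i else y q (i - n))" and ch: "(n, U, x) \<in> atlas X"
    by (auto simp: cprod_def)
  show "\<exists>n U x a. (n, U, x) \<in> atlas X \<and> a + n \<le> N \<and>
      (\<forall>q\<in>W. fst q \<in> U \<and> (\<forall>i<n. w q (a + i) = x (fst q) i))"
    by (rule exI[of _ n], rule exI[of _ U], rule exI[of _ x], rule exI[of _ 0]) (use ch in \<open>auto simp: eq\<close>)
qed (use assms in auto)

lemma cdiff_at_snd:
  assumes "charted X" "charted Y" "q \<in> pts Y" "p \<in> pts X" "cdiff_at Y g q"
  shows "cdiff_at (cprod X Y) (\<lambda>z. g (snd z)) (p, q)"
proof (rule cdiff_at_projection[OF charted_cprod[OF assms(1,2)] assms(2)])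
  fix N W w assume "(N, W, w) \<in> atlas (cprod X Y)" "(p, q) \<in> W"
  then obtain n U x m V y where eq: "N = n + m" "W = U \<times> V"
    "w = (\<lambda>(p, q) i. if i < n then x p i else y q (i - n))" and ch: "(m, V, y) \<in> atlas Y"
    by (auto simp: cprod_def)
  show "\<exists>m V y a. (m, V, y) \<in> atlas Y \<and> a + m \<le> N \<and>
      (\<forall>q\<in>W. snd q \<in> V \<and> (\<forall>i<m. w q (a + i) = y (snd q) i))"
    by (rule exI[of _ m], rule exI[of _ V], rule exI[of _ y], rule exI[of _ n]) (use ch in \<open>auto simp: eq\<close>)
qed (use assms in auto)

text \<open>Coordinates in a chart of \<open>X\<close> must be differentiable with respect to every
  other chart of \<open>X\<close>; the third hypothesis supplies this.\<close>

lemma holo_map_fst: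
  assumes "charted X" "charted Y" "holo_map X X (\<lambda>q. q)"
  shows "holo_map (cprod X Y) X fst"
  unfolding holo_map_def
proof (intro conjI ballI, safe)
  show "continuous_map (mtop (cprod X Y)) (mtop X) fst"
    by (simp add: cprod_def continuous_map_fst)
  fix p q n V y i
  assume "(p, q) \<in> pts (cprod X Y)" "(n, V, y) \<in> atlas X" "fst (p, q) \<in> V" "i < n"
  then show "cdiff_at (cprod X Y) (\<lambda>q. y (fst q) i) (p, q)"
    using assms cdiff_map_at_coordinate[OF holo_map_imp_cdiff_map_at[OF assms(3)]]
    by (intro cdiff_at_fst[where g = "\<lambda>z. y z i"]) auto
qed

lemma holo_map_snd:
  assumes "charted X" "charted Y" "holo_map Y Y (\<lambda>q. q)"
  shows "holo_map (cprod X Y) Y snd"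
  unfolding holo_map_def
proof (intro conjI ballI, safe)
  show "continuous_map (mtop (cprod X Y)) (mtop Y) snd"
    by (simp add: cprod_def continuous_map_snd)
  fix p q n V y i
  assume "(p, q) \<in> pts (cprod X Y)" "(n, V, y) \<in> atlas Y" "snd (p, q) \<in> V" "i < n"
  then show "cdiff_at (cprod X Y) (\<lambda>q. y (snd q) i) (p, q)"
    using assms cdiff_map_at_coordinate[OF holo_map_imp_cdiff_map_at[OF assms(3)]]
    by (intro cdiff_at_snd[where g = "\<lambda>z. y z i"]) auto
qed

lemma cdiff_map_at_pair:
  assumes f: "cdiff_map_at Z X f p" and g: "cdiff_map_at Z Y g p"
  shows "cdiff_map_at Z (cprod X Y) (\<lambda>q. (f q, g q)) p"
  unfolding cdiff_map_at_def
proof (intro conjI allI impI)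
  show "p \<in> pts Z" "(f p, g p) \<in> pts (cprod X Y)"
    using assms by (simp_all add: cdiff_map_at_def)
  fix W assume "openin (mtop (cprod X Y)) W" "(f p, g p) \<in> W"
  then obtain P Q where PQ: "openin (mtop X) P" "openin (mtop Y) Q" "f p \<in> P" "g p \<in> Q" "P \<times> Q \<subseteq> W"
    by (rule openin_cprodE)
  show "near Z p (\<lambda>q. (f q, g q) \<in> W)"
    by (rule near_mono[OF near_conj[OF cdiff_map_at_imp_near[OF f near_openI[OF PQ(1,3)]]
            cdiff_map_at_imp_near[OF g near_openI[OF PQ(2,4)]]]]) (use PQ(5) in auto)
next
  show "\<forall>(N, W, w)\<in>atlas (cprod X Y). (f p, g p) \<in> W \<longrightarrow> (\<forall>i<N. cdiff_at Z (\<lambda>q. w (f q, g q) i) p)"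
  proof clarify
    fix N W w i assume "(N, W, w) \<in> atlas (cprod X Y)" and *: "(f p, g p) \<in> W" "i < N"
    then obtain n U x m V y where eq: "N = n + m" "W = U \<times> V"
      "w = (\<lambda>(p, q) i. if i < n then x p i else y q (i - n))"
      and ch: "(n, U, x) \<in> atlas X" "(m, V, y) \<in> atlas Y"
      by (auto simp: cprod_def)
    show "cdiff_at Z (\<lambda>q. w (f q, g q) i) p"
      using cdiff_map_at_coordinate[OF f ch(1), of i] cdiff_map_at_coordinate[OF g ch(2), of "i - n"] *
      by (cases "i < n") (auto simp: eq)
  qed
qed

lemma charted_open_sub:
  assumes X: "charted X" and W: "openin (mtop X) W"
  shows "charted (open_sub X W)"
proof (rule chartedI)
  fix p assume p: "p \<in> pts (open_sub X W)"
  then obtain n U x where "(n, U, x) \<in> atlas X" "p \<in> U"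
    using charted_chart_at[OF X, of p] by auto
  with p show "\<exists>n U x. (n, U, x) \<in> atlas (open_sub X W) \<and> p \<in> U"
    by (intro exI[of _ n] exI[of _ "U \<inter> W"] exI[of _ x]) (auto simp: open_sub_def)
next
  fix n A x assume "(n, A, x) \<in> atlas (open_sub X W)"
  then obtain U where ch: "(n, U, x) \<in> atlas X" and A: "A = U \<inter> W" by (auto simp: open_sub_def)
  show "openin (mtop (open_sub X W)) A"
    using charted_open[OF X ch] W by (auto simp: A open_sub_def openin_open_subtopology)
  show "inj_on x A" using charted_inj[OF X ch] by (auto simp: A intro: inj_on_subset)
  fix p assume p: "p \<in> A"
  then show "x p \<in> cspace n" using charted_in_cspace[OF X ch] by (simp add: A)
  fix Q assume Q: "openin (mtop (open_sub X W)) Q" "p \<in> Q"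
  then have "openin (mtop X) Q" "Q \<subseteq> W" using W by (simp_all add: open_sub_def openin_open_subtopology)
  then obtain T where "open T" "x ` (U \<inter> Q) = cspace n \<inter> T" "U \<inter> Q = A \<inter> Q"
    using charted_open_image_ex[OF X ch] A by (metis Int_absorb1 inf_assoc)
  then show "\<exists>T. open T \<and> x p \<in> T \<and> T \<inter> cspace n \<subseteq> x ` (A \<inter> Q)"
    using p Q(2) by (intro exI[of _ T]) auto
qed

text \<open>The inverses of a chart and of its restriction to \<open>U \<inter> W\<close> agree on a
  neighbourhood of \<open>x p\<close>, and differentiability sees no more than that.\<close>

lemma cdiff_at_open_sub:
  assumes X: "charted X" and W: "openin (mtop X) W" "p \<in> W"
  shows "cdiff_at (open_sub X W) f p \<longleftrightarrow> cdiff_at X f p"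
proof -
  have "cdifferentiable n (f \<circ> inv_into (U \<inter> W) x) (x p) \<longleftrightarrow> cdifferentiable n (f \<circ> inv_into U x) (x p)"
    if ch: "(n, U, x) \<in> atlas X" "p \<in> U" for n U x
  proof -
    have inv: "inv_into (U \<inter> W) x (x q) = q" "inv_into U x (x q) = q" if "q \<in> U" "q \<in> W" for q
      using that charted_inj[OF X ch(1)] by (auto intro: inv_into_f_f inj_on_subset)
    have ev: "\<forall>\<^sub>F z in at (x p) within cspace n. (f \<circ> inv_into (U \<inter> W) x) z = (f \<circ> inv_into U x) z"
      using chart_eventually[OF X ch near_openI[OF W]]
    proof eventually_elim
      case (elim z)
      then have "inv_into U x z \<in> U" "x (inv_into U x z) = z"
        by (simp_all add: inv_into_into f_inv_into_f)
      with elim inv[of "inv_into U x z"] show ?case by simp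
    qed
    have ev': "\<forall>\<^sub>F z in at (x p) within cspace n. (f \<circ> inv_into U x) z = (f \<circ> inv_into (U \<inter> W) x) z"
      using ev by eventually_elim simp
    have "(f \<circ> inv_into (U \<inter> W) x) (x p) = (f \<circ> inv_into U x) (x p)"
      using inv[OF ch(2) W(2)] by simp
    then show ?thesis
      using cdifferentiable_cong[OF _ ev] cdifferentiable_cong[OF _ ev'] by metis
  qed
  moreover have iff: "(\<forall>(n, U, x)\<in>atlas (open_sub X W). P n U x) \<longleftrightarrow> (\<forall>(n, U, x)\<in>atlas X. P n (U \<inter> W) x)"
    for P :: "nat \<Rightarrow> 'a set \<Rightarrow> ('a \<Rightarrow> nat \<Rightarrow> complex) \<Rightarrow> bool"
    unfolding open_sub_def cmanifold.simps by blast
  ultimately show ?thesis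
    using W(2) unfolding cdiff_at_def iff by auto
qed

lemma cdiff_map_at_open_sub_domain:
  assumes "charted X" "openin (mtop X) W" "p \<in> W"
  shows "cdiff_map_at (open_sub X W) Y f p \<longleftrightarrow> cdiff_map_at X Y f p"
  using assms openin_subset[OF assms(2)] unfolding cdiff_map_at_def
  by (auto simp: near_open_sub cdiff_at_open_sub)

lemma cdiff_map_at_open_sub_codomain:
  assumes "openin (mtop Y) W" "f p \<in> W"
  shows "cdiff_map_at X (open_sub Y W) f p \<longleftrightarrow> cdiff_map_at X Y f p"
proof
  assume f: "cdiff_map_at X (open_sub Y W) f p"
  show "cdiff_map_at X Y f p"
    unfolding cdiff_map_at_def
  proof (intro conjI allI impI)
    show "p \<in> pts X" "f p \<in> pts Y" using f by (auto simp: cdiff_map_at_def)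
    fix A assume "openin (mtop Y) A" "f p \<in> A"
    then show "near X p (\<lambda>q. f q \<in> A)"
      by (intro cdiff_map_at_imp_near[OF f]) (simp add: near_open_sub assms near_openI)
  next
    show "\<forall>(n, V, y)\<in>atlas Y. f p \<in> V \<longrightarrow> (\<forall>i<n. cdiff_at X (\<lambda>q. y (f q) i) p)"
    proof clarify
      fix n V y i assume "(n, V, y) \<in> atlas Y" "f p \<in> V" "i < n"
      then show "cdiff_at X (\<lambda>q. y (f q) i) p"
        using cdiff_map_at_coordinate[OF f, of n "V \<inter> W" y i] assms(2) by (auto simp: open_sub_def)
    qed
  qed
next
  assume f: "cdiff_map_at X Y f p"
  show "cdiff_map_at X (open_sub Y W) f p"
    unfolding cdiff_map_at_def
  proof (intro conjI allI impI)
    show "p \<in> pts X" "f p \<in> pts (open_sub Y W)" using f assms by (auto simp: cdiff_map_at_def)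
    fix A assume "openin (mtop (open_sub Y W)) A" "f p \<in> A"
    then show "near X p (\<lambda>q. f q \<in> A)"
      using assms(1)
      by (intro cdiff_map_at_imp_near[OF f] near_openI) (simp_all add: open_sub_def openin_open_subtopology)
  next
    show "\<forall>(n, V, y)\<in>atlas (open_sub Y W). f p \<in> V \<longrightarrow> (\<forall>i<n. cdiff_at X (\<lambda>q. y (f q) i) p)"
      using cdiff_map_at_coordinate[OF f] by (fastforce simp: open_sub_def)
  qed
qed

section \<open>Affine space\<close>

lemma charted_affine_cspace: "charted (affine_cspace r)"
proof (rule chartedI)
  fix n U x W p
  assume "(n, U, x) \<in> atlas (affine_cspace r)" "openin (mtop (affine_cspace r)) W" "p \<in> U" "p \<in> W"
  then have eq: "n = r" "U = cspace r" "x = id" and "p \<in> W" "\<exists>T. open T \<and> W = cspace r \<inter> T"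
    by (simp_all add: affine_cspace_def openin_open)
  then show "\<exists>T. open T \<and> x p \<in> T \<and> T \<inter> cspace n \<subseteq> x ` (U \<inter> W)"
    by (auto simp: eq)
qed (auto simp: affine_cspace_def)

lemma cdiff_at_affine_coordinate:
  assumes "i < r"
  shows "cdiff_at (affine_cspace r) (\<lambda>z. z i) c"
proof -
  have "cdifferentiable r ((\<lambda>z. z i) \<circ> inv_into (cspace r) id) c" if "c \<in> cspace r"
  proof (rule cdifferentiable_cong)
    show "cdifferentiable r (\<lambda>z. z i) c" using assms by (rule cdifferentiable_coordinate)
    show "\<forall>\<^sub>F w in at c within cspace r. ((\<lambda>z. z i) \<circ> inv_into (cspace r) id) w = w i"
      by (auto simp: eventually_at_filter inv_into_f_f[of id, simplified])
  qed (use that inv_into_f_f[of id] in simp)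
  then show ?thesis by (simp add: cdiff_at_def affine_cspace_def)
qed

lemma holo_map_affine_id: "holo_map (affine_cspace r) (affine_cspace r) (\<lambda>z. z)"
  unfolding holo_map_def
  using cdiff_at_affine_coordinate by (auto simp: affine_cspace_def continuous_map_id[unfolded id_def])

section \<open>Concatenated coordinates on powers of a manifold\<close>

lemma block_bound:
  fixes n :: "nat \<Rightarrow> nat"
  assumes "t \<in> {1..l}"
  shows "(\<Sum>s=1..<t. n s) + n t \<le> (\<Sum>s=1..l. n s)"
proof -
  have "(\<Sum>s=1..<t. n s) + n t = (\<Sum>s\<in>{1..t}. n s)"
    using assms by (simp add: atLeastLessThanSuc_atLeastAtMost[symmetric])
  also have "\<dots> \<le> (\<Sum>s=1..l. n s)" using assms by (intro sum_mono2) auto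
  finally show ?thesis .
qed

text \<open>Induction on the number of blocks: the entry lies in the block appended last, or
  \<open>block_bound\<close> places it inside the shorter list.\<close>

lemma nth_default_concat_blocks:
  assumes "t \<in> {1..l}" "i < n t"
  shows "nth_default d (concat (map (\<lambda>t. map (f t) [0..<n t]) [1..<l + 1])) ((\<Sum>s=1..<t. n s) + i) = f t i"
  using assms
proof (induction l)
  case (Suc l)
  have len: "length (concat (map (\<lambda>t. map (f t) [0..<n t]) [1..<l + 1])) = (\<Sum>s=1..l. n s)"
    by (induction l) (auto simp: length_concat)
  have split: "[1..<Suc l + 1] = [1..<l + 1] @ [Suc l]" by simp
  show ?case
  proof (cases "t = Suc l")
    case True
    then show ?thesis
      using Suc.prems(2) unfolding split map_append concat_append nth_default_append len
      by (simp add: atLeastLessThanSuc_atLeastAtMost nth_default_nth)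
  next
    case False
    then have t: "t \<in> {1..l}" using Suc.prems(1) by auto
    then have "(\<Sum>s=1..<t. n s) + i < (\<Sum>s=1..l. n s)"
      using block_bound[OF t, of n] Suc.prems(2) by simp
    then show ?thesis
      using Suc.IH[OF t Suc.prems(2)]
      by (simp only: split map_append concat_append nth_default_append len if_True nth_default_nth)
  qed
qed simp

lemma block_index:
  fixes n :: "nat \<Rightarrow> nat"
  assumes "k < (\<Sum>s=1..l. n s)"
  obtains t i where "t \<in> {1..l}" "i < n t" "k = (\<Sum>s=1..<t. n s) + i"
  using assms
proof (induction l arbitrary: thesis)
  case (Suc l)
  show ?case
  proof (cases "k < (\<Sum>s=1..l. n s)")
    case True
    obtain t i where "t \<in> {1..l}" "i < n t" "k = (\<Sum>s=1..<t. n s) + i"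
      using Suc.IH[OF _ True] by blast
    then show ?thesis by (intro Suc.prems(1)[of t i]) auto
  next
    case False
    then show ?thesis
      using Suc.prems(2) by (intro Suc.prems(1)[of "Suc l" "k - (\<Sum>s=1..l. n s)"])
        (auto simp: atLeastLessThanSuc_atLeastAtMost)
  qed
qed simp

text \<open>Trades the list concatenation in \<open>cpow\<close> for a description of the coordinate
  map by its blocks; together with \<open>block_index\<close> this determines all coordinates below
  \<open>N\<close>.\<close>

lemma atlas_cpowE:
  assumes X: "charted X" and "(N, W, w) \<in> atlas (cpow X l)"
  obtains n U y where "N = (\<Sum>t=1..l. n t)" "W = PiE {1..l} U"
    "\<forall>t\<in>{1..l}. (n t, U t, y t) \<in> atlas X"
    "\<forall>p. w p \<in> cspace N"
    "\<forall>p. \<forall>t\<in>{1..l}. \<forall>i<n t. w p ((\<Sum>s=1..<t. n s) + i) = y t (p t) i"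
proof -
  obtain n U y where eq: "N = (\<Sum>t=1..l. n t)" "W = PiE {1..l} U"
    "w = (\<lambda>p. nth_default 0 (concat (map (\<lambda>t. map (y t (p t)) [0..<n t]) [1..<l + 1])))"
    and ch: "\<And>t. t \<in> {1..l} \<Longrightarrow> (n t, U t, y t) \<in> atlas X"
    using assms(2) by (auto simp: cpow_def)
  have "length (concat (map (\<lambda>t. map (y t (p t)) [0..<n t]) [1..<l + 1])) = N" for p
    unfolding eq by (induction l) (auto simp: length_concat)
  then have "w p \<in> cspace N" for p
    by (simp add: eq(3) cspace_def nth_default_beyond)
  moreover have "w p ((\<Sum>s=1..<t. n s) + i) = y t (p t) i" if "t \<in> {1..l}" "i < n t" for p t i
    unfolding eq(3) using that by (rule nth_default_concat_blocks)
  ultimately show thesis using eq(1,2) ch that by blast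
qed

lemma charted_cpow:
  assumes X: "charted X"
  shows "charted (cpow X l)"
proof (rule chartedI)
  fix p assume "p \<in> pts (cpow X l)"
  then have p: "p \<in> PiE {1..l} (\<lambda>_. pts X)" by simp
  then have "\<forall>t\<in>{1..l}. \<exists>c. c \<in> atlas X \<and> p t \<in> fst (snd c)"
    using charted_chart_at[OF X] by (metis PiE_mem fst_conv snd_conv)
  from bchoice[OF this] obtain c where c: "\<And>t. t \<in> {1..l} \<Longrightarrow> c t \<in> atlas X"
    "\<And>t. t \<in> {1..l} \<Longrightarrow> p t \<in> fst (snd (c t))" by blast
  have "(\<Sum>t=1..l. fst (c t), PiE {1..l} (\<lambda>t. fst (snd (c t))),
      \<lambda>p. nth_default 0 (concat (map (\<lambda>t. map (snd (snd (c t)) (p t)) [0..<fst (c t)]) [1..<l + 1])))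
      \<in> atlas (cpow X l)"
    unfolding cpow_def cmanifold.simps
    by (rule CollectI, rule exI[of _ "\<lambda>t. fst (c t)"], rule exI[of _ "\<lambda>t. fst (snd (c t))"],
        rule exI[of _ "\<lambda>t. snd (snd (c t))"]) (use c in simp)
  moreover have "p \<in> PiE {1..l} (\<lambda>t. fst (snd (c t)))"
    using p c(2) by (auto simp: PiE_iff)
  ultimately show "\<exists>n U x. (n, U, x) \<in> atlas (cpow X l) \<and> p \<in> U" by blast
next
  fix N W w assume "(N, W, w) \<in> atlas (cpow X l)"
  then obtain n U y where eq: "N = (\<Sum>t=1..l. n t)" "W = PiE {1..l} U"
    and ch0: "\<forall>t\<in>{1..l}. (n t, U t, y t) \<in> atlas X"
    and w0: "\<forall>p. w p \<in> cspace N"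
      "\<forall>p. \<forall>t\<in>{1..l}. \<forall>i<n t. w p ((\<Sum>s=1..<t. n s) + i) = y t (p t) i"
    by (rule atlas_cpowE[OF X])
  note ch = ch0[rule_format] and w = w0[rule_format]
  define off where "off t = (\<Sum>s=1..<t. n s)" for t
  have sl: "slice (off t) (n t) (w p) = y t (p t)" if "t \<in> {1..l}" "p t \<in> U t" for t p
    using charted_in_cspace[OF X ch[OF that(1)] that(2)] w(2)[OF that(1)]
    by (auto simp: slice_def fun_eq_iff cspace_def off_def)
  show "openin (mtop (cpow X l)) W"
    using charted_open[OF X ch] by (auto simp: cpow_def eq openin_PiE_gen)
  show "inj_on w W"
  proof (rule inj_onI)
    fix p q assume p: "p \<in> W" and q: "q \<in> W" and "w p = w q"
    have "p t = q t" if t: "t \<in> {1..l}" for t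
    proof -
      have U: "p t \<in> U t" "q t \<in> U t" using p q t by (auto simp: eq)
      then have "y t (p t) = y t (q t)" using sl[OF t] \<open>w p = w q\<close> by metis
      then show ?thesis using charted_inj[OF X ch[OF t]] U by (auto dest: inj_onD)
    qed
    then show "p = q" using p q unfolding eq by (intro PiE_ext) auto
  qed
  fix p assume p: "p \<in> W"
  show "w p \<in> cspace N" by (rule w)
  fix Q assume "openin (mtop (cpow X l)) Q" "p \<in> Q"
  then have Q: "openin (product_topology (\<lambda>_. mtop X) {1..l}) Q" "p \<in> Q" by (simp_all add: cpow_def)
  obtain A where A: "p \<in> PiE {1..l} A" "\<And>t. openin (mtop X) (A t)" "PiE {1..l} A \<subseteq> Q"
    using product_topology_open_contains_basis[OF Q] by blast
  have "\<forall>t\<in>{1..l}. \<exists>S. open S \<and> y t ` (U t \<inter> A t) = cspace (n t) \<inter> S"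
    using charted_open_image_ex[OF X ch A(2)] by metis
  from bchoice[OF this] obtain S where S: "\<And>t. t \<in> {1..l} \<Longrightarrow> open (S t)"
    "\<And>t. t \<in> {1..l} \<Longrightarrow> y t ` (U t \<inter> A t) = cspace (n t) \<inter> S t" by blast
  show "\<exists>R. open R \<and> w p \<in> R \<and> R \<inter> cspace N \<subseteq> w ` (W \<inter> Q)"
  proof (intro exI conjI)
    \<comment> \<open>One open condition for each block; there are only finitely many blocks, so the
      intersection is open.\<close>
    show "open (\<Inter>t\<in>{1..l}. slice (off t) (n t) -` S t)"
      by (intro open_INT ballI open_slice_vimage S(1)) simp_all
    show "w p \<in> (\<Inter>t\<in>{1..l}. slice (off t) (n t) -` S t)"
    proof
      fix t assume t: "t \<in> {1..l}"
      then have "p t \<in> U t" "p t \<in> A t" using p A(1) by (auto simp: eq)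
      then show "w p \<in> slice (off t) (n t) -` S t" using S(2)[OF t] sl[OF t] by auto
    qed
    show "(\<Inter>t\<in>{1..l}. slice (off t) (n t) -` S t) \<inter> cspace N \<subseteq> w ` (W \<inter> Q)"
    proof
      fix z assume z: "z \<in> (\<Inter>t\<in>{1..l}. slice (off t) (n t) -` S t) \<inter> cspace N"
      have "\<exists>q. q \<in> U t \<inter> A t \<and> slice (off t) (n t) z = y t q" if t: "t \<in> {1..l}" for t
      proof -
        have "slice (off t) (n t) z \<in> y t ` (U t \<inter> A t)"
          using z t unfolding S(2)[OF t] by (auto simp: slice_in_cspace)
        then show ?thesis by blast
      qed
      then have "\<forall>t\<in>{1..l}. \<exists>q. q \<in> U t \<inter> A t \<and> slice (off t) (n t) z = y t q" by blast
      from bchoice[OF this] obtain q where q: "\<And>t. t \<in> {1..l} \<Longrightarrow> q t \<in> U t \<inter> A t"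
        "\<And>t. t \<in> {1..l} \<Longrightarrow> slice (off t) (n t) z = y t (q t)" by blast
      define q' where "q' = restrict q {1..l}"
      have "z k = w q' k" for k
      proof (cases "k < N")
        case True
        then obtain t i where ti: "t \<in> {1..l}" "i < n t" "k = off t + i"
          unfolding eq off_def by (rule block_index)
        have "z k = slice (off t) (n t) z i" using ti by (simp add: slice_def)
        also have "\<dots> = w q' k" using ti w(2)[of t i q'] q(2)[OF ti(1)] by (simp add: off_def q'_def)
        finally show ?thesis .
      qed (use z w(1)[of q'] in \<open>simp add: cspace_def\<close>)
      moreover have "q' \<in> W" "q' \<in> PiE {1..l} A" using q(1) by (auto simp: q'_def eq)
      ultimately show "z \<in> w ` (W \<inter> Q)" using A(3) by blast
    qed
  qed
qed

lemma holo_map_cpow_component: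
  assumes X: "charted X" and id: "holo_map X X (\<lambda>q. q)" and t: "t \<in> {1..l}"
  shows "holo_map (cpow X l) X (\<lambda>p. p t)"
  unfolding holo_map_def
proof (intro conjI ballI)
  show "continuous_map (mtop (cpow X l)) (mtop X) (\<lambda>p. p t)"
    using continuous_map_product_coordinates[OF t] by (simp add: cpow_def)
  fix p assume p: "p \<in> pts (cpow X l)"
  fix c assume c: "c \<in> atlas X"
  obtain n V y where [simp]: "c = (n, V, y)" by (cases c)
  have "cdiff_at (cpow X l) (\<lambda>q. y (q t) i) p" if *: "p t \<in> V" "i < n" for i
  proof (rule cdiff_at_projection[OF charted_cpow[OF X] X p, where g = "\<lambda>q. y q i"])
    have "p t \<in> pts X" using p t by auto
    then show "cdiff_at X (\<lambda>q. y q i) (p t)"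
      using cdiff_map_at_coordinate[OF holo_map_imp_cdiff_map_at[OF id]] c * by auto
    fix N W w assume "(N, W, w) \<in> atlas (cpow X l)"
    then obtain n U y where eq: "N = (\<Sum>t=1..l. n t)" "W = PiE {1..l} U"
      and ch0: "\<forall>t\<in>{1..l}. (n t, U t, y t) \<in> atlas X"
      and "\<forall>p. w p \<in> cspace N"
      and w0: "\<forall>p. \<forall>t\<in>{1..l}. \<forall>i<n t. w p ((\<Sum>s=1..<t. n s) + i) = y t (p t) i"
      by (rule atlas_cpowE[OF X])
    note ch = ch0[rule_format] and w = w0[rule_format]
    show "\<exists>n U x a. (n, U, x) \<in> atlas X \<and> a + n \<le> N \<and>
        (\<forall>q\<in>W. q t \<in> U \<and> (\<forall>i<n. w q (a + i) = x (q t) i))"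
    proof (intro exI conjI ballI allI impI)
      show "(n t, U t, y t) \<in> atlas X" by (rule ch[OF t])
      show "(\<Sum>s=1..<t. n s) + n t \<le> N" unfolding eq by (rule block_bound[OF t])
      show "q t \<in> U t" if "q \<in> W" for q using that t by (auto simp: eq)
      show "w q ((\<Sum>s=1..<t. n s) + i) = y t (q t) i" if "i < n t" for q i by (rule w[OF t that])
    qed
  qed
  then show "case c of (n, V, y) \<Rightarrow> p t \<in> V \<longrightarrow> (\<forall>i<n. cdiff_at (cpow X l) (\<lambda>q. y (q t) i) p)"
    by simp
qed

section \<open>Holomorphic germs and tangent vectors\<close>

lemma holo_near_const: "p \<in> pts X \<Longrightarrow> holo_near X p (\<lambda>_. c)"
  unfolding holo_near_def by (rule near_mono[OF near_pts]) (auto intro: cdiff_at_const)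

lemma holo_near_add:
  "holo_near X p f \<Longrightarrow> holo_near X p g \<Longrightarrow> holo_near X p (\<lambda>q. f q + g q)"
  unfolding holo_near_def by (drule (1) near_conj, erule near_mono) (auto intro: cdiff_at_add)

lemma holo_near_mult:
  "holo_near X p f \<Longrightarrow> holo_near X p g \<Longrightarrow> holo_near X p (\<lambda>q. f q * g q)"
  unfolding holo_near_def by (drule (1) near_conj, erule near_mono) (auto intro: cdiff_at_mult)

lemma holo_near_sum:
  "finite I \<Longrightarrow> p \<in> pts X \<Longrightarrow> (\<And>i. i \<in> I \<Longrightarrow> holo_near X p (f i)) \<Longrightarrow>
    holo_near X p (\<lambda>q. \<Sum>i\<in>I. f i q)"
  by (induction I rule: finite_induct) (auto intro: holo_near_const holo_near_add)

lemma holo_near_cong: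
  assumes "charted X" "holo_near X p g" "near X p (\<lambda>q. f q = g q)"
  shows "holo_near X p f"
  using near_conj[OF assms(2)[unfolded holo_near_def] near_near[OF assms(3)]]
  unfolding holo_near_def by (rule near_mono) (auto intro: cdiff_at_cong[OF assms(1)])

lemma holo_near_compose:
  assumes "charted X" "charted Y" "holo_map X Y f" "p \<in> pts X" "holo_near Y (f p) g"
  shows "holo_near X p (\<lambda>q. g (f q))"
  using cdiff_map_at_imp_near[OF holo_map_imp_cdiff_map_at[OF assms(3,4)] assms(5)[unfolded holo_near_def]]
  unfolding holo_near_def
  by (rule near_mono) (auto intro: cdiff_at_compose[OF assms(1,2)] holo_map_imp_cdiff_map_at[OF assms(3)])

lemma tangent_add:
  "D \<in> tangent X p \<Longrightarrow> holo_near X p f \<Longrightarrow> holo_near X p g \<Longrightarrow> D (\<lambda>q. f q + g q) = D f + D g"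
  and tangent_mult:
  "D \<in> tangent X p \<Longrightarrow> holo_near X p f \<Longrightarrow> holo_near X p g \<Longrightarrow>
    D (\<lambda>q. f q * g q) = f p * D g + D f * g p"
  and tangent_cmult:
  "D \<in> tangent X p \<Longrightarrow> holo_near X p f \<Longrightarrow> D (\<lambda>q. c * f q) = c * D f"
  and tangent_cong:
  "D \<in> tangent X p \<Longrightarrow> holo_near X p f \<Longrightarrow> near X p (\<lambda>q. f q = g q) \<Longrightarrow> D f = D g"
  and tangent_not_holo:
  "D \<in> tangent X p \<Longrightarrow> \<not> holo_near X p f \<Longrightarrow> D f = 0"
  unfolding tangent_def by blast+

lemma tangent_sum:
  assumes D: "D \<in> tangent X p" and "p \<in> pts X" "finite I" "\<And>i. i \<in> I \<Longrightarrow> holo_near X p (f i)"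
  shows "D (\<lambda>q. \<Sum>i\<in>I. f i q) = (\<Sum>i\<in>I. D (f i))"
  using assms(3,4)
proof (induction I rule: finite_induct)
  case empty
  show ?case using tangent_cmult[OF D holo_near_const[OF assms(2)], of 0 0] by simp
next
  case (insert i I)
  then show ?case
    using tangent_add[OF D, of "f i" "\<lambda>q. \<Sum>i\<in>I. f i q"] holo_near_sum[OF insert(1) assms(2)] by simp
qed

text \<open>Composition with \<open>f\<close> is a homomorphism of algebras from the holomorphic
  germs at \<open>f p\<close> to those at \<open>p\<close>, so derivations can be
  transported.\<close>

lemma push_tangent:
  assumes X: "charted X" and Y: "charted Y" and f: "holo_map X Y f" and p: "p \<in> pts X"
    and D: "D \<in> tangent X p"
  shows "push X Y f p D \<in> tangent Y (f p)"
proof -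
  note hc = holo_near_compose[OF X Y f p]
  have fd: "cdiff_map_at X Y f p" by (rule holo_map_imp_cdiff_map_at[OF f p])
  have fp: "f p \<in> pts Y" using fd by (simp add: cdiff_map_at_def)
  show ?thesis
    unfolding tangent_def
  proof (intro CollectI conjI allI impI)
    fix g h assume gh: "holo_near Y (f p) g" "holo_near Y (f p) h"
    show "push X Y f p D (\<lambda>q. g q + h q) = push X Y f p D g + push X Y f p D h"
      using gh hc[OF gh(1)] hc[OF gh(2)] holo_near_add[OF gh] tangent_add[OF D]
      by (simp add: push_def comp_def)
    show "push X Y f p D (\<lambda>q. g q * h q) = g (f p) * push X Y f p D h + push X Y f p D g * h (f p)"
      using gh hc[OF gh(1)] hc[OF gh(2)] holo_near_mult[OF gh] tangent_mult[OF D]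
      by (simp add: push_def comp_def)
  next
    fix c g assume g: "holo_near Y (f p) g"
    show "push X Y f p D (\<lambda>q. c * g q) = c * push X Y f p D g"
      using g hc[OF g] holo_near_mult[OF holo_near_const[OF fp] g, of c] tangent_cmult[OF D]
      by (simp add: push_def comp_def)
  next
    fix g h assume g: "holo_near Y (f p) g" and eq: "near Y (f p) (\<lambda>q. g q = h q)"
    have "near Y (f p) (\<lambda>q. h q = g q)" using eq by (rule near_mono) simp
    then have "holo_near Y (f p) h" by (rule holo_near_cong[OF Y g])
    then show "push X Y f p D g = push X Y f p D h"
      using g tangent_cong[OF D hc[OF g] cdiff_map_at_imp_near[OF fd eq]]
      by (simp add: push_def comp_def)
  qed (simp add: push_def)
qed

text \<open>An equation of functionals on all functions: on functions that are not holomorphic near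
  \<open>p\<close>, both sides are zero by the normalisation of \<open>tangent\<close>.\<close>

lemma push_id: "D \<in> tangent X p \<Longrightarrow> push X X (\<lambda>q. q) p D = D"
  using tangent_not_holo by (fastforce simp: push_def comp_def fun_eq_iff)

text \<open>The composite is given as a separate \<open>h\<close> agreeing with it on the points of
  \<open>X\<close> only, as vertex maps and group products satisfy their identities only there. A
  tangent vector does not see the difference, since it depends on germs.\<close>

lemma push_compose:
  assumes X: "charted X" and Y: "charted Y" and Z: "charted Z"
    and f: "holo_map X Y f" and g: "holo_map Y Z g" and p: "p \<in> pts X" and D: "D \<in> tangent X p"
    and h: "\<And>q. q \<in> pts X \<Longrightarrow> h q = g (f q)"
  shows "push X Z h p D = push Y Z g (f p) (push X Y f p D)"
proof
  fix k
  have fp: "f p \<in> pts Y" using holo_map_imp_cdiff_map_at[OF f p] by (simp add: cdiff_map_at_def)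
  show "push X Z h p D k = push Y Z g (f p) (push X Y f p D) k"
  proof (cases "holo_near Z (g (f p)) k")
    case True
    have kg: "holo_near Y (f p) (\<lambda>q. k (g q))" by (rule holo_near_compose[OF Y Z g fp True])
    have "near X p (\<lambda>q. k (g (f q)) = k (h q))"
      by (rule near_mono[OF near_pts[OF p]]) (simp add: h)
    then show ?thesis
      using True kg tangent_cong[OF D holo_near_compose[OF X Y f p kg]] p
      by (simp add: push_def comp_def h)
  qed (simp add: push_def h[OF p])
qed

section \<open>Linear functionals and traces\<close>

text \<open>Vectors in a fibre are compared through functionals, mainly the coordinates of a
  trivialisation. This turns sums in an abstract module into sums of complex numbers.\<close>

definition linear_functional :: "'e cvs \<Rightarrow> ('e \<Rightarrow> complex) \<Rightarrow> bool" where
  "linear_functional V L \<longleftrightarrow>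
     (\<forall>a\<in>carrier V. \<forall>b\<in>carrier V. L (a \<oplus>\<^bsub>V\<^esub> b) = L a + L b) \<and>
     (\<forall>c. \<forall>a\<in>carrier V. L (c \<odot>\<^bsub>V\<^esub> a) = c * L a)"

lemma linear_coords_functional: "linear_coords V \<psi> \<Longrightarrow> linear_functional V (\<lambda>e. \<psi> e i)"
  by (simp add: linear_coords_def linear_functional_def)

context
  fixes V :: "'e cvs"
  assumes V: "complex_vs V"
begin

interpretation module complex_field V by (rule V)

lemma carrier_complex_field [simp]: "carrier complex_field = UNIV"
  by (simp add: complex_field_def)

lemma linear_functional_zero:
  assumes "linear_functional V L"
  shows "L \<zero>\<^bsub>V\<^esub> = 0"
proof -
  have "L (\<zero>\<^bsub>V\<^esub> \<oplus>\<^bsub>V\<^esub> \<zero>\<^bsub>V\<^esub>) = L \<zero>\<^bsub>V\<^esub> + L \<zero>\<^bsub>V\<^esub>"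
    using assms M.zero_closed unfolding linear_functional_def by blast
  then show ?thesis by simp
qed

lemma linear_functional_minus:
  assumes L: "linear_functional V L" and "a \<in> carrier V" "b \<in> carrier V"
  shows "L (a \<ominus>\<^bsub>V\<^esub> b) = L a - L b"
proof -
  have "L (a \<ominus>\<^bsub>V\<^esub> b \<oplus>\<^bsub>V\<^esub> b) = L (a \<ominus>\<^bsub>V\<^esub> b) + L b"
    using assms M.minus_closed unfolding linear_functional_def by blast
  moreover have "a \<ominus>\<^bsub>V\<^esub> b \<oplus>\<^bsub>V\<^esub> b = a"
    using assms(2,3) by (simp add: M.minus_eq M.a_assoc M.l_neg)
  ultimately show ?thesis by simp
qed

lemma linear_functional_finsum:
  assumes L: "linear_functional V L" and "finite I" "f \<in> I \<rightarrow> carrier V"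
  shows "L (finsum V f I) = (\<Sum>i\<in>I. L (f i))"
  using assms(2,3)
proof (induction I rule: finite_induct)
  case (insert i I)
  then have "L (f i \<oplus>\<^bsub>V\<^esub> finsum V f I) = L (f i) + L (finsum V f I)"
    using L M.finsum_closed[of f I] unfolding linear_functional_def by auto
  then show ?case using insert by (simp add: M.finsum_insert)
qed (simp add: linear_functional_zero[OF L])

lemma linear_functional_combination:
  assumes L: "linear_functional V L" and "b \<in> {..<r::nat} \<rightarrow> carrier V"
  shows "L (finsum V (\<lambda>j. c j \<odot>\<^bsub>V\<^esub> b j) {..<r}) = (\<Sum>j<r. c j * L (b j))"
proof -
  have "L (finsum V (\<lambda>j. c j \<odot>\<^bsub>V\<^esub> b j) {..<r}) = (\<Sum>j<r. L (c j \<odot>\<^bsub>V\<^esub> b j))"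
    using assms(2) by (intro linear_functional_finsum[OF L]) auto
  also have "\<dots> = (\<Sum>j<r. c j * L (b j))"
    using L assms(2) by (intro sum.cong) (auto simp: linear_functional_def Pi_iff)
  finally show ?thesis .
qed

lemma combination_closed:
  "b \<in> {..<r::nat} \<rightarrow> carrier V \<Longrightarrow> finsum V (\<lambda>j. c j \<odot>\<^bsub>V\<^esub> b j) {..<r} \<in> carrier V"
  by (rule M.finsum_closed) auto

text \<open>\<open>trace\<close> uses a basis picked by \<open>SOME\<close> of the least possible
  length. The given basis, of whatever length, guarantees that the pick succeeds; the unique
  coordinates of the zero vector are then zero.\<close>

lemma trace_zero:
  assumes b: "is_basis V r b" and A: "\<And>e. e \<in> carrier V \<Longrightarrow> A e = \<zero>\<^bsub>V\<^esub>"
  shows "trace V A = 0"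
proof -
  define d where "d = vdim V"
  define b' where "b' = (SOME b. is_basis V d b)"
  have "\<exists>b. is_basis V d b"
    unfolding d_def vdim_def by (rule LeastI_ex) (use b in blast)
  then have b': "is_basis V d b'" unfolding b'_def by (rule someI_ex)
  have "\<zero>\<^bsub>V\<^esub> = finsum V (\<lambda>j. 0 \<odot>\<^bsub>V\<^esub> b' j) {..<d}"
  proof -
    have "finsum V (\<lambda>j. 0 \<odot>\<^bsub>V\<^esub> b' j) {..<d} = finsum V (\<lambda>j. \<zero>\<^bsub>V\<^esub>) {..<d}"
      using b' smult_l_null by (intro M.finsum_cong') (auto simp: is_basis_def complex_field_def)
    then show ?thesis by simp
  qed
  moreover have "(\<lambda>_. 0) \<in> cspace d" by (simp add: cspace_def)
  moreover have "\<exists>!c. c \<in> cspace d \<and> \<zero>\<^bsub>V\<^esub> = finsum V (\<lambda>j. c j \<odot>\<^bsub>V\<^esub> b' j) {..<d}"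
    using b' M.zero_closed unfolding is_basis_def by blast
  ultimately have "coords V d b' \<zero>\<^bsub>V\<^esub> = (\<lambda>_. 0)"
    unfolding coords_def by (intro the1_equality) auto
  moreover have "A (b' j) = \<zero>\<^bsub>V\<^esub>" if "j < d" for j
    using b' that by (intro A) (auto simp: is_basis_def)
  ultimately show ?thesis
    by (simp add: trace_def Let_def d_def[symmetric] b'_def[symmetric])
qed

section \<open>Frames of a vector space with linear coordinates\<close>

context
  fixes r :: nat and \<psi> :: "'e \<Rightarrow> nat \<Rightarrow> complex"
  assumes lin: "linear_coords V \<psi>" and bij: "bij_betw \<psi> (carrier V) (cspace r)"
begin

lemma unit_vec_in_cspace: "j < r \<Longrightarrow> unit_vec j \<in> cspace r"
  by (simp add: unit_vec_def cspace_def)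

lemma coords_inv_into: "c \<in> cspace r \<Longrightarrow> \<psi> (inv_into (carrier V) \<psi> c) = c"
  and inv_coords_closed: "c \<in> cspace r \<Longrightarrow> inv_into (carrier V) \<psi> c \<in> carrier V"
  using bij by (auto simp: bij_betw_def f_inv_into_f intro: inv_into_into)

lemma coords_frame_combination:
  assumes "c \<in> cspace r"
  shows "\<psi> (finsum V (\<lambda>j. c j \<odot>\<^bsub>V\<^esub> inv_into (carrier V) \<psi> (unit_vec j)) {..<r}) = c"
proof
  fix i
  have "\<psi> (finsum V (\<lambda>j. c j \<odot>\<^bsub>V\<^esub> inv_into (carrier V) \<psi> (unit_vec j)) {..<r}) i
      = (\<Sum>j<r. c j * \<psi> (inv_into (carrier V) \<psi> (unit_vec j)) i)"
    by (intro linear_functional_combination linear_coords_functional lin)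
      (auto intro: inv_coords_closed unit_vec_in_cspace)
  also have "\<dots> = (\<Sum>j<r. if i = j then c j else 0)"
    by (intro sum.cong) (auto simp: coords_inv_into unit_vec_in_cspace, auto simp: unit_vec_def)
  also have "\<dots> = c i" using assms by (simp add: cspace_def)
  finally show "\<psi> (finsum V (\<lambda>j. c j \<odot>\<^bsub>V\<^esub> inv_into (carrier V) \<psi> (unit_vec j)) {..<r}) i = c i" .
qed

text \<open>Both sides have the same coordinates, and \<open>\<psi>\<close> is injective on the
  space.\<close>

lemma frame_expansion:
  assumes "e \<in> carrier V"
  shows "e = finsum V (\<lambda>j. \<psi> e j \<odot>\<^bsub>V\<^esub> inv_into (carrier V) \<psi> (unit_vec j)) {..<r}"
proof (rule inj_onD[of \<psi> "carrier V"])
  show "inj_on \<psi> (carrier V)" using bij by (simp add: bij_betw_def)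
  have "\<psi> e \<in> cspace r" using bij assms by (auto simp: bij_betw_def)
  then show "\<psi> e = \<psi> (finsum V (\<lambda>j. \<psi> e j \<odot>\<^bsub>V\<^esub> inv_into (carrier V) \<psi> (unit_vec j)) {..<r})"
    by (simp add: coords_frame_combination)
  show "finsum V (\<lambda>j. \<psi> e j \<odot>\<^bsub>V\<^esub> inv_into (carrier V) \<psi> (unit_vec j)) {..<r} \<in> carrier V"
    by (rule combination_closed) (auto intro: inv_coords_closed unit_vec_in_cspace)
qed (rule assms)

lemma is_basis_frame: "is_basis V r (\<lambda>j. inv_into (carrier V) \<psi> (unit_vec j))"
  unfolding is_basis_def
proof (intro conjI ballI)
  show "(\<lambda>j. inv_into (carrier V) \<psi> (unit_vec j)) \<in> {..<r} \<rightarrow> carrier V"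
    by (auto intro: inv_coords_closed unit_vec_in_cspace)
  fix e assume e: "e \<in> carrier V"
  show "\<exists>!c. c \<in> cspace r \<and> e = finsum V (\<lambda>j. c j \<odot>\<^bsub>V\<^esub> inv_into (carrier V) \<psi> (unit_vec j)) {..<r}"
  proof (rule ex1I[of _ "\<psi> e"])
    show "\<psi> e \<in> cspace r \<and> e = finsum V (\<lambda>j. \<psi> e j \<odot>\<^bsub>V\<^esub> inv_into (carrier V) \<psi> (unit_vec j)) {..<r}"
      using bij e frame_expansion by (auto simp: bij_betw_def)
  qed (auto simp: coords_frame_combination)
qed

lemma functional_frame_expansion:
  assumes L: "linear_functional V L" and e: "e \<in> carrier V"
  shows "L e = (\<Sum>j<r. \<psi> e j * L (inv_into (carrier V) \<psi> (unit_vec j)))"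
  by (subst frame_expansion[OF e], rule linear_functional_combination[OF L])
    (auto intro: inv_coords_closed unit_vec_in_cspace)

end

end

section \<open>Local trivialisations and sections\<close>

locale hol_vector_bundle =
  fixes E :: "'e cmanifold" and M :: "'m cmanifold" and \<pi> :: "'e \<Rightarrow> 'm" and V :: "'m \<Rightarrow> 'e cvs"
  assumes vector_bundle: "holomorphic_vector_bundle E M \<pi> V"
begin

lemma charted_E: "charted E" and charted_M: "charted M"
  and holo_map_id_M: "holo_map M M (\<lambda>q. q)" and holo_map_id_E: "holo_map E E (\<lambda>q. q)"
  using vector_bundle
  by (auto simp: holomorphic_vector_bundle_def complex_manifold_charted complex_manifold_holo_map_id)

lemma holo_map_proj: "holo_map E M \<pi>"
  using vector_bundle by (simp add: holomorphic_vector_bundle_def)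

lemma fibre_vs: "m \<in> pts M \<Longrightarrow> complex_vs (V m)"
  and carrier_fibre: "m \<in> pts M \<Longrightarrow> carrier (V m) = {e \<in> pts E. \<pi> e = m}"
  using vector_bundle by (simp_all add: holomorphic_vector_bundle_def)

context
  fixes U :: "'m set" and r :: nat and \<Psi> :: "'e \<Rightarrow> 'm \<times> (nat \<Rightarrow> complex)"
  assumes triv: "local_trivialization E M \<pi> V U r \<Psi>"
begin

lemma triv_open: "openin (mtop M) U"
  using triv by (simp add: local_trivialization_def)

lemma triv_pts: "m \<in> U \<Longrightarrow> m \<in> pts M"
  using openin_subset[OF triv_open] by blast

lemma triv_preimage_open: "openin (mtop E) {e \<in> pts E. \<pi> e \<in> U}"
  using holo_map_proj triv_open by (auto simp: holo_map_def intro: openin_continuous_map_preimage)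

lemma triv_linear: "m \<in> U \<Longrightarrow> linear_coords (V m) (\<lambda>e. snd (\<Psi> e))"
  using triv by (simp add: local_trivialization_def Let_def)

lemma charted_triv_codomain: "charted (cprod (open_sub M U) (affine_cspace r))"
  by (intro charted_cprod charted_open_sub charted_M triv_open charted_affine_cspace)

lemma triv_cdiff_map_at:
  assumes "e \<in> pts E" "\<pi> e \<in> U"
  shows "cdiff_map_at E (cprod (open_sub M U) (affine_cspace r)) \<Psi> e"
proof -
  have "cdiff_map_at (open_sub E {e \<in> pts E. \<pi> e \<in> U}) (cprod (open_sub M U) (affine_cspace r)) \<Psi> e"
    using triv assms by (intro holo_map_imp_cdiff_map_at) (auto simp: local_trivialization_def Let_def)
  then show ?thesis
    using assms by (simp add: cdiff_map_at_open_sub_domain[OF charted_E triv_preimage_open])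
qed

text \<open>Since \<open>\<Psi>\<close> covers the identity of \<open>U\<close>, its inverse
  \<open>\<Theta>\<close> maps the slice over \<open>m\<close> back into the fibre over
  \<open>m\<close> and inverts the fibre coordinates there.\<close>

lemma triv_bij:
  assumes m: "m \<in> U"
  shows "bij_betw (\<lambda>e. snd (\<Psi> e)) (carrier (V m)) (cspace r)"
proof -
  let ?P = "open_sub E {e \<in> pts E. \<pi> e \<in> U}" and ?Q = "cprod (open_sub M U) (affine_cspace r)"
  obtain \<Theta> where \<Theta>: "holo_map ?Q ?P \<Theta>" "\<And>e. e \<in> pts ?P \<Longrightarrow> \<Theta> (\<Psi> e) = e"
    "\<And>z. z \<in> pts ?Q \<Longrightarrow> \<Psi> (\<Theta> z) = z" and fst: "\<And>e. e \<in> pts ?P \<Longrightarrow> fst (\<Psi> e) = \<pi> e"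
    using triv unfolding local_trivialization_def Let_def by blast
  have c: "carrier (V m) = {e \<in> pts E. \<pi> e = m}" using carrier_fibre[OF triv_pts[OF m]] .
  have \<Psi>: "\<Psi> e = (m, snd (\<Psi> e))" if "e \<in> carrier (V m)" for e
    using fst[of e] that m by (auto simp: c prod_eq_iff)
  show ?thesis
  proof (rule bij_betw_byWitness[where f' = "\<lambda>z. \<Theta> (m, z)"])
    show "\<forall>e\<in>carrier (V m). \<Theta> (m, snd (\<Psi> e)) = e"
      using \<Psi> \<Theta>(2) m by (auto simp: c)
    show "\<forall>z\<in>cspace r. snd (\<Psi> (\<Theta> (m, z))) = z"
      using \<Theta>(3) m triv_pts by auto
    show "(\<lambda>e. snd (\<Psi> e)) ` carrier (V m) \<subseteq> cspace r"
    proof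
      fix z assume "z \<in> (\<lambda>e. snd (\<Psi> e)) ` carrier (V m)"
      then obtain e where e: "e \<in> carrier (V m)" "z = snd (\<Psi> e)" by blast
      have "\<Psi> e \<in> pts ?Q"
        using triv_cdiff_map_at[of e] e(1) m by (auto simp: cdiff_map_at_def c)
      then show "z \<in> cspace r" by (auto simp: e(2) mem_Times_iff)
    qed
    show "(\<lambda>z. \<Theta> (m, z)) ` cspace r \<subseteq> carrier (V m)"
    proof
      fix e assume "e \<in> (\<lambda>z. \<Theta> (m, z)) ` cspace r"
      then obtain z where z: "z \<in> cspace r" "e = \<Theta> (m, z)" by blast
      have mz: "(m, z) \<in> pts ?Q" using z m triv_pts by simp
      then have e: "e \<in> pts ?P"
        using holo_map_imp_cdiff_map_at[OF \<Theta>(1) mz] z(2) unfolding cdiff_map_at_def by simp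
      then have "\<pi> e = m" using fst[OF e] \<Theta>(3)[OF mz] z(2) by simp
      then show "e \<in> carrier (V m)" using e by (simp add: c)
    qed
  qed
qed

lemma triv_coordinate_cdiff:
  assumes e: "e \<in> pts E" "\<pi> e \<in> U" and i: "i < r"
  shows "cdiff_at E (\<lambda>e. snd (\<Psi> e) i) e"
proof -
  have \<Psi>: "cdiff_map_at E (cprod (open_sub M U) (affine_cspace r)) \<Psi> e"
    by (rule triv_cdiff_map_at[OF e])
  have "cdiff_map_at (cprod (open_sub M U) (affine_cspace r)) (affine_cspace r) snd (\<Psi> e)"
    using \<Psi> by (intro holo_map_imp_cdiff_map_at holo_map_snd charted_open_sub charted_M triv_open
        charted_affine_cspace holo_map_affine_id) (simp add: cdiff_map_at_def)
  from cdiff_map_at_compose[OF charted_E charted_triv_codomain \<Psi> this]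
  have "cdiff_map_at E (affine_cspace r) (\<lambda>e. snd (\<Psi> e)) e" .
  then show ?thesis
    by (rule cdiff_at_compose[OF charted_E charted_affine_cspace, where g = "\<lambda>z. z i"])
      (rule cdiff_at_affine_coordinate[OF i])
qed

text \<open>Over \<open>U\<close> the section with constant coordinates \<open>c\<close> is
  \<open>\<Theta> (m', c)\<close>, so it is holomorphic because the inverse trivialisation is. Unit
  vectors \<open>c\<close> yield the local frames, other values sections through a prescribed
  vector.\<close>

lemma constant_section_cdiff:
  assumes m: "m \<in> U" and c: "c \<in> cspace r"
  shows "cdiff_map_at M E (\<lambda>m'. inv_into (carrier (V m')) (\<lambda>e. snd (\<Psi> e)) c) m"
proof -
  let ?P = "open_sub E {e \<in> pts E. \<pi> e \<in> U}" and ?Q = "cprod (open_sub M U) (affine_cspace r)"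
  obtain \<Theta> where \<Theta>: "holo_map ?Q ?P \<Theta>"
    "\<And>z. z \<in> pts ?Q \<Longrightarrow> \<Psi> (\<Theta> z) = z" and fst: "\<And>e. e \<in> pts ?P \<Longrightarrow> fst (\<Psi> e) = \<pi> e"
    using triv unfolding local_trivialization_def Let_def by blast
  have \<Theta>P: "\<Theta> (m', c) \<in> pts E" "\<pi> (\<Theta> (m', c)) = m'" if "m' \<in> U" for m'
  proof -
    have mc: "(m', c) \<in> pts ?Q" using that c triv_pts by simp
    then have e: "\<Theta> (m', c) \<in> pts ?P"
      using holo_map_imp_cdiff_map_at[OF \<Theta>(1) mc] unfolding cdiff_map_at_def by simp
    with fst[OF e] \<Theta>(2)[OF mc] show "\<Theta> (m', c) \<in> pts E" "\<pi> (\<Theta> (m', c)) = m'" by simp_all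
  qed
  \<comment> \<open>The identification holds over \<open>U\<close> only, which is why the conclusion
    is transferred by a congruence of germs.\<close>
  have eq: "inv_into (carrier (V m')) (\<lambda>e. snd (\<Psi> e)) c = \<Theta> (m', c)" if m': "m' \<in> U" for m'
  proof (rule inv_into_f_eq)
    show "inj_on (\<lambda>e. snd (\<Psi> e)) (carrier (V m'))" using triv_bij[OF m'] by (simp add: bij_betw_def)
    show "\<Theta> (m', c) \<in> carrier (V m')" using \<Theta>P[OF m'] triv_pts[OF m'] by (simp add: carrier_fibre)
    show "snd (\<Psi> (\<Theta> (m', c))) = c" using \<Theta>(2)[of "(m', c)"] m' c triv_pts by simp
  qed
  have mc: "(m, c) \<in> pts ?Q" using m c triv_pts by simp
  have "cdiff_map_at M (open_sub M U) (\<lambda>m. m) m"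
    using holo_map_imp_cdiff_map_at[OF holo_map_id_M triv_pts[OF m]] m
    by (subst cdiff_map_at_open_sub_codomain[OF triv_open])
  then have "cdiff_map_at M ?Q (\<lambda>m. (m, c)) m"
    using c triv_pts[OF m] by (intro cdiff_map_at_pair cdiff_map_at_const) auto
  moreover have "cdiff_map_at ?Q E \<Theta> (m, c)"
    using holo_map_imp_cdiff_map_at[OF \<Theta>(1) mc] \<Theta>P[OF m] m
    by (subst (asm) cdiff_map_at_open_sub_codomain[OF triv_preimage_open]) auto
  ultimately have "cdiff_map_at M E (\<lambda>m. \<Theta> (m, c)) m"
    by (rule cdiff_map_at_compose[OF charted_M charted_triv_codomain])
  then show ?thesis
    by (rule cdiff_map_at_cong[OF charted_M])
      (rule near_mono[OF near_openI[OF triv_open m]], simp add: eq)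
qed

end

lemma holo_section_on_bundle:
  assumes W: "openin (mtop M) W" and s: "\<And>q. q \<in> W \<Longrightarrow> cdiff_map_at M E s q"
    "\<And>q. q \<in> W \<Longrightarrow> s q \<in> carrier (V q)"
  shows "holo_section_on M (bundle_of E M \<pi> V nabla) W s"
  unfolding holo_section_on_def
proof (intro conjI ballI W)
  fix q assume q: "q \<in> W"
  then show "s q \<in> carrier (fib (bundle_of E M \<pi> V nabla) q)" by (simp add: bundle_of_def s)
  have sq: "s q \<in> pts E" "\<pi> (s q) = q"
    using s(2)[OF q] openin_subset[OF W] q by (auto simp: carrier_fibre subsetD)
  fix \<tau> assume "\<tau> \<in> trivs (bundle_of E M \<pi> V nabla)"
  then obtain U r \<Psi> where t: "local_trivialization E M \<pi> V U r \<Psi>" and [simp]: "\<tau> = (U, r, \<lambda>m e. snd (\<Psi> e))"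
    by (auto simp: bundle_of_def)
  have "cdiff_at M (\<lambda>q. snd (\<Psi> (s q)) i) q" if "q \<in> U" "i < r" for i
    using that sq by (intro cdiff_at_compose[OF charted_M charted_E s(1)[OF q], where g = "\<lambda>e. snd (\<Psi> e) i"]
        triv_coordinate_cdiff[OF t]) auto
  then show "case \<tau> of (U, r, \<psi>) \<Rightarrow> q \<in> U \<longrightarrow> (\<forall>i<r. cdiff_at M (\<lambda>q'. \<psi> q' (s q') i) q)" by simp
qed

lemma holo_section_on_pull:
  assumes X: "charted X" and f: "holo_map X M f"
    and W: "openin (mtop X) W" and s: "\<And>q. q \<in> W \<Longrightarrow> cdiff_map_at X E s q"
    "\<And>q. q \<in> W \<Longrightarrow> s q \<in> carrier (V (f q))"
  shows "holo_section_on X (pull X M f (bundle_of E M \<pi> V nabla)) W s"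
  unfolding holo_section_on_def
proof (intro conjI ballI W)
  fix q assume q: "q \<in> W"
  then show "s q \<in> carrier (fib (pull X M f (bundle_of E M \<pi> V nabla)) q)"
    by (simp add: bundle_of_def pull_def s)
  have "q \<in> pts X" using openin_subset[OF W] q by blast
  then have "f q \<in> pts M" using holo_map_imp_cdiff_map_at[OF f] by (simp add: cdiff_map_at_def)
  then have sq: "s q \<in> pts E" "\<pi> (s q) = f q"
    using s(2)[OF q] by (auto simp: carrier_fibre)
  fix \<tau> assume "\<tau> \<in> trivs (pull X M f (bundle_of E M \<pi> V nabla))"
  then obtain U r \<Psi> where t: "local_trivialization E M \<pi> V U r \<Psi>"
    and [simp]: "\<tau> = ({x \<in> pts X. f x \<in> U}, r, \<lambda>m e. snd (\<Psi> e))"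
    by (auto simp: bundle_of_def pull_def)
  have "cdiff_at X (\<lambda>q. snd (\<Psi> (s q)) i) q" if "f q \<in> U" "i < r" for i
    using that sq by (intro cdiff_at_compose[OF X charted_E s(1)[OF q], where g = "\<lambda>e. snd (\<Psi> e) i"]
        triv_coordinate_cdiff[OF t]) auto
  then show "case \<tau> of (U, r, \<psi>) \<Rightarrow> q \<in> U \<longrightarrow> (\<forall>i<r. cdiff_at X (\<lambda>q'. \<psi> q' (s q') i) q)" by simp
qed

lemma pull_section_coordinate:
  assumes f: "holo_map X M f" and s: "holo_section_near X (pull X M f (bundle_of E M \<pi> V nabla)) p s"
    and t: "local_trivialization E M \<pi> V U r \<Psi>" "f p \<in> U" "j < r"
  shows "holo_near X p (\<lambda>q. snd (\<Psi> (s q)) j)"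
proof -
  obtain W where W: "p \<in> W" "holo_section_on X (pull X M f (bundle_of E M \<pi> V nabla)) W s"
    using s by (auto simp: holo_section_near_def)
  then have op: "openin (mtop X) W" by (simp add: holo_section_on_def)
  then have p: "p \<in> pts X" using W(1) openin_subset by blast
  have "({x \<in> pts X. f x \<in> U}, r, \<lambda>m e. snd (\<Psi> e)) \<in> trivs (pull X M f (bundle_of E M \<pi> V nabla))"
    unfolding pull_def bundle_of_def cbundle.simps
    by (rule CollectI, rule exI[of _ U], rule exI[of _ r], rule exI[of _ "\<lambda>m e. snd (\<Psi> e)"])
      (use t(1) in blast)
  then have *: "cdiff_at X (\<lambda>q. snd (\<Psi> (s q)) j) q" if "q \<in> W" "q \<in> pts X" "f q \<in> U" for q
    using W(2) that t(3) unfolding holo_section_on_def by fastforce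
  have "near X p (\<lambda>q. f q \<in> U)"
    by (rule cdiff_map_at_imp_near[OF holo_map_imp_cdiff_map_at[OF f p] near_openI[OF triv_open[OF t(1)] t(2)]])
  from near_conj[OF near_openI[OF op W(1)] this] show ?thesis
    unfolding holo_near_def by (rule near_mono) (use * in auto)
qed

lemma pull_section_in_fibre:
  assumes s: "holo_section_near X (pull X M f (bundle_of E M \<pi> V nabla)) p s"
  shows "near X p (\<lambda>q. s q \<in> carrier (V (f q)))"
  using s unfolding holo_section_near_def holo_section_on_def near_def
  by (auto simp: pull_def bundle_of_def)

text \<open>Ensures that the choice of a section in \<open>nabla_hom\<close> can be met:
  \<open>e\<close> is extended with constant coordinates near \<open>f p\<close>, and the extension
  is pulled back along \<open>f\<close>.\<close>

lemma pull_section_exists: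
  assumes X: "charted X" and f: "holo_map X M f" and p: "p \<in> pts X" and e: "e \<in> carrier (V (f p))"
  shows "\<exists>s. holo_section_near X (pull X M f (bundle_of E M \<pi> V nabla)) p s \<and> s p = e"
proof -
  have fp: "f p \<in> pts M" using holo_map_imp_cdiff_map_at[OF f p] by (simp add: cdiff_map_at_def)
  then obtain U r \<Psi> where U: "f p \<in> U" and t: "local_trivialization E M \<pi> V U r \<Psi>"
    using vector_bundle by (auto simp: holomorphic_vector_bundle_def)
  define W where "W = {q \<in> pts X. f q \<in> U}"
  define c where "c = snd (\<Psi> e)"
  have c: "c \<in> cspace r" using triv_bij[OF t U] e by (auto simp: bij_betw_def c_def)
  define s where "s q = inv_into (carrier (V (f q))) (\<lambda>e. snd (\<Psi> e)) c" for q
  have "holo_section_on X (pull X M f (bundle_of E M \<pi> V nabla)) W s"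
  proof (rule holo_section_on_pull[OF X f])
    show "openin (mtop X) W"
      unfolding W_def using f triv_open[OF t] by (auto simp: holo_map_def intro: openin_continuous_map_preimage)
    fix q assume q: "q \<in> W"
    show "cdiff_map_at X E s q"
      unfolding s_def
      by (rule cdiff_map_at_compose[OF X charted_M holo_map_imp_cdiff_map_at[OF f]
            constant_section_cdiff[OF t _ c]]) (use q in \<open>simp_all add: W_def\<close>)
    show "s q \<in> carrier (V (f q))"
      unfolding s_def using triv_bij[OF t, of "f q"] c q
      by (auto simp: bij_betw_def W_def intro: inv_into_into)
  qed
  moreover have "s p = e"
    using triv_bij[OF t U] inv_into_f_f[of "\<lambda>e. snd (\<Psi> e)", OF _ e]
    by (simp add: s_def c_def bij_betw_def)
  ultimately show ?thesis
    using p U unfolding holo_section_near_def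
    by (intro exI[of _ s] conjI exI[of _ W]) (simp_all add: W_def)
qed

end

section \<open>Pulled back connections\<close>

locale hol_connection = hol_vector_bundle E M \<pi> V
  for E :: "'e cmanifold" and M :: "'m cmanifold" and \<pi> :: "'e \<Rightarrow> 'm" and V :: "'m \<Rightarrow> 'e cvs" +
  fixes nabla :: "'m \<Rightarrow> 'm tvec \<Rightarrow> ('m \<Rightarrow> 'e) \<Rightarrow> 'e"
  assumes connection: "holomorphic_connection M (bundle_of E M \<pi> V nabla)"
begin

abbreviation bdl :: "('m, 'e) cbundle" where
  "bdl \<equiv> bundle_of E M \<pi> V nabla"

abbreviation loc_frame :: "('e \<Rightarrow> 'm \<times> (nat \<Rightarrow> complex)) \<Rightarrow> nat \<Rightarrow> 'm \<Rightarrow> 'e" where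
  "loc_frame \<Psi> \<equiv> frame bdl (\<lambda>_ e. snd (\<Psi> e))"

text \<open>Pins down the trivialisation that \<open>SOME\<close> selects inside
  \<open>pull\<close>. Only the point \<open>m\<close> of \<open>M\<close> enters, so pullbacks
  along different maps that reach the same point work with the same frame.\<close>

definition chosen_triv :: "'m \<Rightarrow> 'm set \<Rightarrow> nat \<Rightarrow> ('e \<Rightarrow> 'm \<times> (nat \<Rightarrow> complex)) \<Rightarrow> bool" where
  "chosen_triv m U r \<Psi> \<longleftrightarrow> local_trivialization E M \<pi> V U r \<Psi> \<and> m \<in> U \<and>
     (SOME \<tau>. \<tau> \<in> trivs bdl \<and> m \<in> fst \<tau>) = (U, r, \<lambda>_ e. snd (\<Psi> e))"

lemma chosen_triv_exists:
  assumes "m \<in> pts M"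
  obtains U r \<Psi> where "chosen_triv m U r \<Psi>"
proof -
  define \<tau> where "\<tau> = (SOME \<tau>. \<tau> \<in> trivs bdl \<and> m \<in> fst \<tau>)"
  obtain U r \<Psi> where "m \<in> U" "local_trivialization E M \<pi> V U r \<Psi>"
    using vector_bundle assms by (auto simp: holomorphic_vector_bundle_def)
  then have "(U, r, \<lambda>m e. snd (\<Psi> e)) \<in> trivs bdl \<and> m \<in> fst (U, r, \<lambda>m e. snd (\<Psi> e))"
    by (auto simp: bundle_of_def)
  from someI[of "\<lambda>\<tau>. \<tau> \<in> trivs bdl \<and> m \<in> fst \<tau>", OF this] have "\<tau> \<in> trivs bdl" "m \<in> fst \<tau>"
    unfolding \<tau>_def by blast+
  then show thesis
    using that unfolding chosen_triv_def \<tau>_def[symmetric] by (auto simp: bundle_of_def)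
qed

lemma loc_frame_eq: "loc_frame \<Psi> j m = inv_into (carrier (V m)) (\<lambda>e. snd (\<Psi> e)) (unit_vec j)"
  by (simp add: frame_def bundle_of_def)

context
  fixes U :: "'m set" and r :: nat and \<Psi> :: "'e \<Rightarrow> 'm \<times> (nat \<Rightarrow> complex)"
  assumes triv: "local_trivialization E M \<pi> V U r \<Psi>"
begin

lemma loc_frame_closed: "m \<in> U \<Longrightarrow> j < r \<Longrightarrow> loc_frame \<Psi> j m \<in> carrier (V m)"
  unfolding loc_frame_eq using triv_bij[OF triv, of m]
  by (auto simp: bij_betw_def unit_vec_def cspace_def intro: inv_into_into)

lemma loc_frame_coords: "m \<in> U \<Longrightarrow> j < r \<Longrightarrow> snd (\<Psi> (loc_frame \<Psi> j m)) = unit_vec j"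
  unfolding loc_frame_eq
  by (rule coords_inv_into[OF fibre_vs[OF triv_pts[OF triv]] triv_linear[OF triv] triv_bij[OF triv]])
    (auto simp: unit_vec_def cspace_def)

lemma loc_frame_cdiff: "m \<in> U \<Longrightarrow> j < r \<Longrightarrow> cdiff_map_at M E (loc_frame \<Psi> j) m"
  unfolding loc_frame_eq
  by (rule constant_section_cdiff[OF triv]) (auto simp: unit_vec_def cspace_def)

lemma functional_loc_frame:
  "m \<in> U \<Longrightarrow> linear_functional (V m) L \<Longrightarrow> e \<in> carrier (V m) \<Longrightarrow>
    L e = (\<Sum>j<r. snd (\<Psi> e) j * L (loc_frame \<Psi> j m))"
  unfolding loc_frame_eq
  by (rule functional_frame_expansion[OF fibre_vs[OF triv_pts[OF triv]] triv_linear[OF triv] triv_bij[OF triv]])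

text \<open>The frame vectors form holomorphic sections over all of \<open>U\<close>, so the axioms
  of the connection apply to them.\<close>

lemma connection_loc_frame_closed:
  assumes m: "m \<in> U" and j: "j < r" and w: "w \<in> tangent M m"
  shows "nabla m w (loc_frame \<Psi> j) \<in> carrier (V m)"
proof -
  have "holo_section_on M bdl U (loc_frame \<Psi> j)"
    by (intro holo_section_on_bundle triv_open[OF triv] loc_frame_cdiff loc_frame_closed j)
  then have "holo_section_near M bdl m (loc_frame \<Psi> j)"
    using m by (auto simp: holo_section_near_def)
  then have "conn bdl m w (loc_frame \<Psi> j) \<in> carrier (fib bdl m)"
    using connection triv_pts[OF triv m] w unfolding holomorphic_connection_def by blast
  then show ?thesis by (simp add: bundle_of_def)
qed

end

text \<open>Evaluates the definition of \<open>pull\<close> in the selected frame. The covariant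
  derivatives of the frame lie in the fibre because the push-forward of \<open>v\<close> is a
  genuine tangent vector of \<open>M\<close>.\<close>

lemma pull_conn:
  assumes X: "charted X" and f: "holo_map X M f" and p: "p \<in> pts X" and v: "v \<in> tangent X p"
    and U: "chosen_triv (f p) U r \<Psi>"
  shows pull_conn_closed: "conn (pull X M f bdl) p v t \<in> carrier (V (f p))"
    and functional_pull_conn: "linear_functional (V (f p)) L \<Longrightarrow> L (conn (pull X M f bdl) p v t) =
      (\<Sum>j<r. v (\<lambda>q. snd (\<Psi> (t q)) j) * L (loc_frame \<Psi> j (f p)) +
        snd (\<Psi> (t p)) j * L (nabla (f p) (push X M f p v) (loc_frame \<Psi> j)))"
proof -
  have t: "local_trivialization E M \<pi> V U r \<Psi>" and fU: "f p \<in> U"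
    and ch: "(SOME \<tau>. \<tau> \<in> trivs bdl \<and> f p \<in> fst \<tau>) = (U, r, \<lambda>_ e. snd (\<Psi> e))"
    using U by (auto simp: chosen_triv_def)
  interpret module complex_field "V (f p)" by (rule fibre_vs[OF triv_pts[OF t fU]])
  have [simp]: "carrier complex_field = UNIV" by (simp add: complex_field_def)
  define a where "a j = v (\<lambda>q. snd (\<Psi> (t q)) j) \<odot>\<^bsub>V (f p)\<^esub> loc_frame \<Psi> j (f p)" for j
  define b where "b j = snd (\<Psi> (t p)) j \<odot>\<^bsub>V (f p)\<^esub> nabla (f p) (push X M f p v) (loc_frame \<Psi> j)" for j
  have eq: "conn (pull X M f bdl) p v t = finsum (V (f p)) (\<lambda>j. a j \<oplus>\<^bsub>V (f p)\<^esub> b j) {..<r}"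
    unfolding pull_def cbundle.simps ch Let_def by (simp add: a_def b_def bundle_of_def)
  have frame: "loc_frame \<Psi> j (f p) \<in> carrier (V (f p))"
      "nabla (f p) (push X M f p v) (loc_frame \<Psi> j) \<in> carrier (V (f p))" if "j < r" for j
    using loc_frame_closed[OF t fU that]
      connection_loc_frame_closed[OF t fU that push_tangent[OF X charted_M f p v]] by blast+
  have ab: "a j \<in> carrier (V (f p))" "b j \<in> carrier (V (f p))" if "j < r" for j
    using frame[OF that] by (simp_all add: a_def b_def)
  then show "conn (pull X M f bdl) p v t \<in> carrier (V (f p))"
    unfolding eq by (intro M.finsum_closed) auto
  assume L: "linear_functional (V (f p)) L"
  have "L (conn (pull X M f bdl) p v t) = (\<Sum>j<r. L (a j \<oplus>\<^bsub>V (f p)\<^esub> b j))"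
    unfolding eq using ab by (intro linear_functional_finsum[OF module_axioms L]) auto
  also have "\<dots> = (\<Sum>j<r. L (a j) + L (b j))"
    using L ab by (intro sum.cong) (auto simp: linear_functional_def)
  also have "\<dots> = (\<Sum>j<r. v (\<lambda>q. snd (\<Psi> (t q)) j) * L (loc_frame \<Psi> j (f p)) +
        snd (\<Psi> (t p)) j * L (nabla (f p) (push X M f p v) (loc_frame \<Psi> j)))"
    using L frame by (intro sum.cong) (auto simp: linear_functional_def a_def b_def)
  finally show "L (conn (pull X M f bdl) p v t) =
      (\<Sum>j<r. v (\<lambda>q. snd (\<Psi> (t q)) j) * L (loc_frame \<Psi> j (f p)) +
        snd (\<Psi> (t p)) j * L (nabla (f p) (push X M f p v) (loc_frame \<Psi> j)))" .
qed

end

section \<open>The covariant derivative of the action\<close>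

locale equivariant_connection = hol_connection E M \<pi> V nabla
  for E :: "'e cmanifold" and M :: "'m cmanifold" and \<pi> :: "'e \<Rightarrow> 'm" and V :: "'m \<Rightarrow> 'e cvs"
    and nabla :: "'m \<Rightarrow> 'm tvec \<Rightarrow> ('m \<Rightarrow> 'e) \<Rightarrow> 'e" +
  fixes G :: "'g lie_group" and \<rho> :: "'m \<times> 'g \<Rightarrow> 'm" and \<phi> :: "'e \<times> 'g \<Rightarrow> 'e"
  assumes lie_group: "complex_lie_group G"
    and action: "holomorphic_right_action M G \<rho>"
    and equivariant: "equivariant_bundle M G \<rho> E \<pi> V \<phi>"
begin

section \<open>The actions on the base and on the total space\<close>

abbreviation MG :: "('m \<times> 'g) cmanifold" where
  "MG \<equiv> cprod M (lie_mfd G)"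

lemma charted_G: "charted (lie_mfd G)" and holo_map_id_G: "holo_map (lie_mfd G) (lie_mfd G) (\<lambda>q. q)"
  and pts_G: "pts (lie_mfd G) = carrier G" and group_G: "group G"
  and holo_map_mult: "holo_map (cprod (lie_mfd G) (lie_mfd G)) (lie_mfd G) (\<lambda>(g, h). g \<otimes>\<^bsub>G\<^esub> h)"
  using lie_group
  by (auto simp: complex_lie_group_def complex_manifold_charted complex_manifold_holo_map_id)

lemma charted_MG: "charted MG"
  by (intro charted_cprod charted_M charted_G)

lemma holo_map_action: "holo_map MG M \<rho>"
  and action_mult: "x \<in> pts M \<Longrightarrow> g \<in> carrier G \<Longrightarrow> h \<in> carrier G \<Longrightarrow>
    \<rho> (\<rho> (x, g), h) = \<rho> (x, g \<otimes>\<^bsub>G\<^esub> h)"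
  using action by (auto simp: holomorphic_right_action_def)

lemma holo_map_bundle_action: "holo_map (cprod E (lie_mfd G)) E \<phi>"
  and bundle_action_one: "e \<in> pts E \<Longrightarrow> \<phi> (e, \<one>\<^bsub>G\<^esub>) = e"
  and bundle_action_mult: "e \<in> pts E \<Longrightarrow> g \<in> carrier G \<Longrightarrow> h \<in> carrier G \<Longrightarrow>
    \<phi> (\<phi> (e, g), h) = \<phi> (e, g \<otimes>\<^bsub>G\<^esub> h)"
  and proj_bundle_action: "e \<in> pts E \<Longrightarrow> g \<in> carrier G \<Longrightarrow> \<pi> (\<phi> (e, g)) = \<rho> (\<pi> e, g)"
  using equivariant by (auto simp: equivariant_bundle_def holomorphic_right_action_def)

lemma action_pts: "x \<in> pts M \<Longrightarrow> g \<in> carrier G \<Longrightarrow> \<rho> (x, g) \<in> pts M"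
  using holo_map_imp_cdiff_map_at[OF holo_map_action, of "(x, g)"] by (simp add: cdiff_map_at_def pts_G)

lemma bundle_action_closed:
  assumes "m \<in> pts M" "e \<in> carrier (V m)" "g \<in> carrier G"
  shows "\<phi> (e, g) \<in> carrier (V (\<rho> (m, g)))"
  using assms proj_bundle_action[of e g]
    holo_map_imp_cdiff_map_at[OF holo_map_bundle_action, of "(e, g)"]
  by (auto simp: carrier_fibre action_pts cdiff_map_at_def pts_G)

lemma functional_bundle_action:
  assumes m: "m \<in> pts M" and g: "g \<in> carrier G" and L: "linear_functional (V (\<rho> (m, g))) L"
  shows "linear_functional (V m) (\<lambda>e. L (\<phi> (e, g)))"
  using L bundle_action_closed[OF m _ g] equivariant m g
  by (simp add: linear_functional_def equivariant_bundle_def)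

text \<open>The matrix of the isomorphism \<open>\<phi>\<close> in local frames: \<open>j\<close> is
  the column index, for the source frame, and \<open>i\<close> the row index, for the target
  coordinates.\<close>

definition transition :: "('e \<Rightarrow> 'm \<times> (nat \<Rightarrow> complex)) \<Rightarrow> ('e \<Rightarrow> 'm \<times> (nat \<Rightarrow> complex)) \<Rightarrow>
    nat \<Rightarrow> nat \<Rightarrow> 'm \<times> 'g \<Rightarrow> complex" where
  "transition \<Psi> \<Psi>' i j y = snd (\<Psi>' (\<phi> (loc_frame \<Psi> j (fst y), snd y))) i"

text \<open>Holomorphy holds jointly in the base point and the group element, as
  \<open>\<phi>\<close> is holomorphic on the product. This matters because the group element
  \<open>\<gamma> q\<close> varies with the point in later applications.\<close>

lemma transition_holo:
  assumes t: "local_trivialization E M \<pi> V U r \<Psi>" "local_trivialization E M \<pi> V U' r' \<Psi>'"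
    and y: "y \<in> pts MG" "fst y \<in> U" "\<rho> y \<in> U'" and ij: "i < r'" "j < r"
  shows "holo_near MG y (transition \<Psi> \<Psi>' i j)"
proof -
  have fst: "holo_map MG M fst"
    by (intro holo_map_fst charted_M charted_G holo_map_id_M)
  have snd: "holo_map MG (lie_mfd G) snd"
    by (intro holo_map_snd charted_M charted_G holo_map_id_G)
  have "cdiff_at MG (transition \<Psi> \<Psi>' i j) z" if z: "z \<in> pts MG" "fst z \<in> U" "\<rho> z \<in> U'" for z
  proof -
    have z': "fst z \<in> pts M" "snd z \<in> carrier G" "z = (fst z, snd z)"
      using z(1) by (auto simp: pts_G)
    have e: "loc_frame \<Psi> j (fst z) \<in> carrier (V (fst z))" by (rule loc_frame_closed[OF t(1) z(2) ij(2)])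
    then have "\<phi> (loc_frame \<Psi> j (fst z), snd z) \<in> carrier (V (\<rho> z))"
      using bundle_action_closed[OF z'(1) e z'(2)] by simp
    then have \<phi>z: "\<phi> (loc_frame \<Psi> j (fst z), snd z) \<in> pts E" "\<pi> (\<phi> (loc_frame \<Psi> j (fst z), snd z)) \<in> U'"
      using z(3) triv_pts[OF t(2) z(3)] by (auto simp: carrier_fibre)
    have "cdiff_map_at MG E (\<lambda>z. loc_frame \<Psi> j (fst z)) z"
      by (rule cdiff_map_at_compose[OF charted_MG charted_M holo_map_imp_cdiff_map_at[OF fst z(1)]
            loc_frame_cdiff[OF t(1) z(2) ij(2)]])
    then have "cdiff_map_at MG (cprod E (lie_mfd G)) (\<lambda>z. (loc_frame \<Psi> j (fst z), snd z)) z"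
      by (intro cdiff_map_at_pair holo_map_imp_cdiff_map_at[OF snd z(1)])
    moreover from this have "cdiff_map_at (cprod E (lie_mfd G)) E \<phi> (loc_frame \<Psi> j (fst z), snd z)"
      by (intro holo_map_imp_cdiff_map_at holo_map_bundle_action) (simp add: cdiff_map_at_def)
    ultimately have "cdiff_map_at MG E (\<lambda>z. \<phi> (loc_frame \<Psi> j (fst z), snd z)) z"
      by (rule cdiff_map_at_compose[OF charted_MG charted_cprod[OF charted_E charted_G]])
    then show ?thesis
      unfolding transition_def
      by (rule cdiff_at_compose[OF charted_MG charted_E, where g = "\<lambda>e. snd (\<Psi>' e) i"])
        (rule triv_coordinate_cdiff[OF t(2) \<phi>z ij(1)])
  qed
  then have diff: "cdiff_at MG (transition \<Psi> \<Psi>' i j) z"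
    if "z \<in> pts MG" "fst z \<in> U \<and> \<rho> z \<in> U'" for z
    using that by blast
  have "near MG y (\<lambda>z. fst z \<in> U \<and> \<rho> z \<in> U')"
    by (rule near_conj[OF
          cdiff_map_at_imp_near[OF holo_map_imp_cdiff_map_at[OF fst y(1)]
            near_openI[OF triv_open[OF t(1)] y(2)]]
          cdiff_map_at_imp_near[OF holo_map_imp_cdiff_map_at[OF holo_map_action y(1)]
            near_openI[OF triv_open[OF t(2)] y(3)]]])
  then show ?thesis
    unfolding holo_near_def by (rule near_mono) (rule diff)
qed

text \<open>The point of this formula is that its right-hand side involves \<open>X\<close>, \<open>f\<^sub>0\<close>, \<open>f\<^sub>1\<close> and \<open>\<gamma>\<close> only
  through the point \<open>(f\<^sub>0 p, \<gamma> p)\<close> of \<open>M \<times> G\<close> and the image of \<open>v\<close> there.\<close>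

lemma nabla_hom_pull:
  assumes X: "charted X" and f0: "holo_map X M f0" and f1: "holo_map X M f1"
    and \<gamma>: "holo_map X (lie_mfd G) \<gamma>" and f01: "\<And>q. q \<in> pts X \<Longrightarrow> f1 q = \<rho> (f0 q, \<gamma> q)"
    and F: "\<And>q e. q \<in> pts X \<Longrightarrow> e \<in> carrier (V (f0 q)) \<Longrightarrow> F q e = \<phi> (e, \<gamma> q)"
    and p: "p \<in> pts X" and v: "v \<in> tangent X p" and e: "e \<in> carrier (V (f0 p))"
    and U: "chosen_triv (f0 p) U r \<Psi>" and U': "chosen_triv (\<rho> (f0 p, \<gamma> p)) U' r' \<Psi>'"
  defines "w \<equiv> push X MG (\<lambda>q. (f0 q, \<gamma> q)) p v"
  shows nabla_hom_pull_closed: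
      "nabla_hom X (pull X M f0 bdl) (pull X M f1 bdl) F p v e \<in> carrier (V (\<rho> (f0 p, \<gamma> p)))"
    and nabla_hom_pull_coords: "k < r' \<Longrightarrow>
      snd (\<Psi>' (nabla_hom X (pull X M f0 bdl) (pull X M f1 bdl) F p v e)) k =
      (\<Sum>j<r. snd (\<Psi> e) j * (w (transition \<Psi> \<Psi>' k j) +
         (\<Sum>i<r'. transition \<Psi> \<Psi>' i j (f0 p, \<gamma> p) *
            snd (\<Psi>' (nabla (\<rho> (f0 p, \<gamma> p)) (push MG M \<rho> (f0 p, \<gamma> p) w) (loc_frame \<Psi>' i))) k) -
         snd (\<Psi>' (\<phi> (nabla (f0 p) (push MG M fst (f0 p, \<gamma> p) w) (loc_frame \<Psi> j), \<gamma> p))) k))"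
proof -
  define h where "h q = (f0 q, \<gamma> q)" for q
  define m where "m = \<rho> (f0 p, \<gamma> p)"
  have t: "local_trivialization E M \<pi> V U r \<Psi>" "f0 p \<in> U"
    and t': "local_trivialization E M \<pi> V U' r' \<Psi>'" "m \<in> U'"
    using U U' by (auto simp: chosen_triv_def m_def)
  have f1p: "f1 p = m" using f01[OF p] by (simp add: m_def)
  have \<gamma>q: "\<gamma> q \<in> carrier G" and f0q: "f0 q \<in> pts M" if "q \<in> pts X" for q
    using holo_map_imp_cdiff_map_at[OF \<gamma> that] holo_map_imp_cdiff_map_at[OF f0 that]
    by (auto simp: cdiff_map_at_def pts_G)
  have h: "holo_map X MG h"
    unfolding h_def using f0 \<gamma> by (simp add: holo_map_iff_cdiff_map_at cdiff_map_at_pair)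
  have hp: "h p \<in> pts MG" using \<gamma>q[OF p] f0q[OF p] by (simp add: h_def pts_G)
  have fst: "holo_map MG M fst"
    by (intro holo_map_fst charted_M charted_G holo_map_id_M)
  \<comment> \<open>On the points of \<open>X\<close>, both \<open>f0\<close> and \<open>f1\<close>
    factor through \<open>h\<close>, namely as its composites with \<open>fst\<close> and with
    \<open>\<rho>\<close>.\<close>
  have push: "push X M f0 p v = push MG M fst (f0 p, \<gamma> p) w"
    "push X M f1 p v = push MG M \<rho> (f0 p, \<gamma> p) w"
    using push_compose[OF X charted_MG charted_M h fst p v, of f0]
      push_compose[OF X charted_MG charted_M h holo_map_action p v, of f1] f01
    by (simp_all add: w_def h_def[abs_def])

  \<comment> \<open>The very section that \<open>nabla_hom\<close> picks; from here on it is used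
    only through its coordinates.\<close>
  define s where "s = (SOME s. holo_section_near X (pull X M f0 bdl) p s \<and> s p = e)"
  have s: "holo_section_near X (pull X M f0 bdl) p s" "s p = e"
    using someI_ex[OF pull_section_exists[OF X f0 p e]] unfolding s_def by blast+
  define S where "S j q = snd (\<Psi> (s q)) j" for j q
  define A where "A = transition \<Psi> \<Psi>'"
  have S: "holo_near X p (S j)" if "j < r" for j
    unfolding S_def by (rule pull_section_coordinate[OF f0 s(1) t that])
  have A: "holo_near MG (h p) (A i j)" if "i < r'" "j < r" for i j
    unfolding A_def using t' t hp that by (intro transition_holo) (auto simp: h_def m_def)
  have Ah: "holo_near X p (\<lambda>q. A i j (h q))" if "i < r'" "j < r" for i j
    by (rule holo_near_compose[OF X charted_MG h p A[OF that]])
  \<comment> \<open>The chain rule is the definition of the push-forward \<open>w\<close>.\<close>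
  have vA: "v (\<lambda>q. A i j (h q)) = w (A i j)" if "i < r'" "j < r" for i j
    using A[OF that] unfolding w_def push_def h_def[symmetric] by (simp add: comp_def)

  have near: "near X p (\<lambda>q. q \<in> pts X \<and> s q \<in> carrier (V (f0 q)) \<and> f0 q \<in> U \<and> f1 q \<in> U')"
    using f1p t(2) t'(2)
    by (intro near_conj near_pts p pull_section_in_fibre[OF s(1)]
        cdiff_map_at_imp_near[OF holo_map_imp_cdiff_map_at[OF f0 p]] near_openI triv_open[OF t(1)]
        cdiff_map_at_imp_near[OF holo_map_imp_cdiff_map_at[OF f1 p]] triv_open[OF t'(1)]) auto
  \<comment> \<open>Fibrewise linearity of the action: the coordinates of the image section are the
    matrix \<open>A\<close> applied to those of \<open>s\<close>.\<close>
  have coord: "snd (\<Psi>' (F q (s q))) i = (\<Sum>j<r. S j q * A i j (h q))"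
    if q: "q \<in> pts X \<and> s q \<in> carrier (V (f0 q)) \<and> f0 q \<in> U \<and> f1 q \<in> U'" for q i
  proof -
    have "linear_functional (V (f0 q)) (\<lambda>e. snd (\<Psi>' (\<phi> (e, \<gamma> q))) i)"
      using q f01[of q] linear_coords_functional[OF triv_linear[OF t'(1)]]
      by (intro functional_bundle_action f0q \<gamma>q) auto
    from functional_loc_frame[OF t(1) _ this] q show ?thesis
      by (simp add: F S_def A_def transition_def h_def)
  qed
  have deriv: "v (\<lambda>q. snd (\<Psi>' (F q (s q))) i) = (\<Sum>j<r. S j p * w (A i j) + v (S j) * A i j (h p))"
    if i: "i < r'" for i
  proof -
    have "v (\<lambda>q. snd (\<Psi>' (F q (s q))) i) = v (\<lambda>q. \<Sum>j<r. S j q * A i j (h q))"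
    proof (rule tangent_cong[OF v, symmetric])
      show "holo_near X p (\<lambda>q. \<Sum>j<r. S j q * A i j (h q))"
        using i by (intro holo_near_sum p holo_near_mult S Ah) auto
      show "near X p (\<lambda>q. (\<Sum>j<r. S j q * A i j (h q)) = snd (\<Psi>' (F q (s q))) i)"
        using near by (rule near_mono) (use coord in simp)
    qed
    also have "\<dots> = (\<Sum>j<r. v (\<lambda>q. S j q * A i j (h q)))"
      using i by (intro tangent_sum[OF v p] holo_near_mult S Ah) auto
    also have "\<dots> = (\<Sum>j<r. S j p * w (A i j) + v (S j) * A i j (h p))"
      using i by (intro sum.cong) (auto simp: tangent_mult[OF v S Ah] vA)
    finally show ?thesis .
  qed

  define c0 where "c0 = conn (pull X M f0 bdl) p v s"
  define c1 where "c1 = conn (pull X M f1 bdl) p v (\<lambda>q. F q (s q))"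
  have c0: "c0 \<in> carrier (V (f0 p))" unfolding c0_def by (rule pull_conn_closed[OF X f0 p v U])
  have U'': "chosen_triv (f1 p) U' r' \<Psi>'" using U' f1p by (simp add: m_def)
  have c1: "c1 \<in> carrier (V m)" unfolding c1_def using pull_conn_closed[OF X f1 p v U''] f1p by simp
  have \<phi>c0: "\<phi> (c0, \<gamma> p) \<in> carrier (V m)"
    unfolding m_def by (rule bundle_action_closed[OF f0q[OF p] c0 \<gamma>q[OF p]])
  have eq: "nabla_hom X (pull X M f0 bdl) (pull X M f1 bdl) F p v e = c1 \<ominus>\<^bsub>V m\<^esub> \<phi> (c0, \<gamma> p)"
    unfolding nabla_hom_def s_def[symmetric] Let_def c0_def[symmetric] c1_def[symmetric]
    using F[OF p c0] by (simp add: pull_def bundle_of_def f1p)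
  interpret Vm: module complex_field "V m" by (rule fibre_vs[OF triv_pts[OF t']])
  show "nabla_hom X (pull X M f0 bdl) (pull X M f1 bdl) F p v e \<in> carrier (V (\<rho> (f0 p, \<gamma> p)))"
    unfolding eq m_def[symmetric] using c1 \<phi>c0 by (rule Vm.minus_closed)

  assume k: "k < r'"
  define C where "C i = snd (\<Psi>' (nabla m (push X M f1 p v) (loc_frame \<Psi>' i))) k" for i
  define D where "D j = snd (\<Psi>' (\<phi> (nabla (f0 p) (push X M f0 p v) (loc_frame \<Psi> j), \<gamma> p))) k" for j
  have L: "linear_functional (V m) (\<lambda>e. snd (\<Psi>' e) k)"
    by (rule linear_coords_functional[OF triv_linear[OF t']])
  have "snd (\<Psi>' c1) k = (\<Sum>i<r'. v (\<lambda>q. snd (\<Psi>' (F q (s q))) i) * snd (\<Psi>' (loc_frame \<Psi>' i m)) k +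
        snd (\<Psi>' (F p (s p))) i * C i)"
    using functional_pull_conn[OF X f1 p v U'', of "\<lambda>e. snd (\<Psi>' e) k"] L f1p
    by (simp add: c1_def C_def)
  also have "\<dots> = (\<Sum>i<r'. v (\<lambda>q. snd (\<Psi>' (F q (s q))) i) * unit_vec i k) +
      (\<Sum>i<r'. (\<Sum>j<r. S j p * A i j (h p)) * C i)"
    unfolding sum.distrib
    using coord[OF near_imp_self[OF near]] by (simp add: loc_frame_coords[OF t'])
  \<comment> \<open>Frame vectors have unit coordinates, so only row \<open>k\<close> of the
    differentiated part survives.\<close>
  also have "(\<Sum>i<r'. v (\<lambda>q. snd (\<Psi>' (F q (s q))) i) * unit_vec i k) =
      (\<Sum>i<r'. if i = k then v (\<lambda>q. snd (\<Psi>' (F q (s q))) i) else 0)"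
    by (intro sum.cong) (auto simp: unit_vec_def)
  also have "\<dots> = (\<Sum>j<r. S j p * w (A k j) + v (S j) * A k j (h p))"
    using k by (simp add: deriv)
  also have "(\<Sum>i<r'. (\<Sum>j<r. S j p * A i j (h p)) * C i) = (\<Sum>j<r. \<Sum>i<r'. S j p * A i j (h p) * C i)"
    unfolding sum_distrib_right by (rule sum.swap)
  finally have 1: "snd (\<Psi>' c1) k = (\<Sum>j<r. S j p * w (A k j) + v (S j) * A k j (h p)) +
      (\<Sum>j<r. \<Sum>i<r'. S j p * A i j (h p) * C i)" .
  have "linear_functional (V (f0 p)) (\<lambda>e. snd (\<Psi>' (\<phi> (e, \<gamma> p))) k)"
    by (rule functional_bundle_action[OF f0q[OF p] \<gamma>q[OF p] L[unfolded m_def]])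
  from functional_pull_conn[OF X f0 p v U this]
  have 2: "snd (\<Psi>' (\<phi> (c0, \<gamma> p))) k = (\<Sum>j<r. v (S j) * A k j (h p) + S j p * D j)"
    by (simp add: c0_def S_def[abs_def] D_def A_def transition_def h_def)
  have "snd (\<Psi>' (c1 \<ominus>\<^bsub>V m\<^esub> \<phi> (c0, \<gamma> p))) k = snd (\<Psi>' c1) k - snd (\<Psi>' (\<phi> (c0, \<gamma> p))) k"
    by (rule linear_functional_minus[OF Vm.module_axioms L c1 \<phi>c0])
  \<comment> \<open>The terms \<open>v (S j) * A k j (h p)\<close> of 1 and 2 cancel. What remains
    contains \<open>s\<close> only through its value at \<open>p\<close>: the covariant derivative
    of a bundle map is a tensor.\<close>
  also have "\<dots> = (\<Sum>j<r. S j p * (w (A k j) + (\<Sum>i<r'. A i j (h p) * C i) - D j))"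
    unfolding 1 2
    by (simp add: sum.distrib sum_subtractf algebra_simps sum_distrib_left)
  finally show "snd (\<Psi>' (nabla_hom X (pull X M f0 bdl) (pull X M f1 bdl) F p v e)) k =
      (\<Sum>j<r. snd (\<Psi> e) j * (w (transition \<Psi> \<Psi>' k j) +
         (\<Sum>i<r'. transition \<Psi> \<Psi>' i j (f0 p, \<gamma> p) *
            snd (\<Psi>' (nabla (\<rho> (f0 p, \<gamma> p)) (push MG M \<rho> (f0 p, \<gamma> p) w) (loc_frame \<Psi>' i))) k) -
         snd (\<Psi>' (\<phi> (nabla (f0 p) (push MG M fst (f0 p, \<gamma> p) w) (loc_frame \<Psi> j), \<gamma> p))) k))"
    unfolding eq by (simp add: S_def s(2) A_def C_def D_def push h_def m_def)
qed

text \<open>The coordinate formula is used twice, over \<open>X\<close> and over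
  \<open>M x G\<close> itself with the maps \<open>fst\<close>, \<open>\<rho>\<close>,
  \<open>snd\<close> and the vector \<open>w\<close>. The right-hand sides coincide, and invariance
  says that the second covariant derivative is zero.\<close>

lemma nabla_hom_pull_zero:
  assumes inv: "G_invariant M G \<rho> bdl \<phi>"
    and X: "charted X" and f0: "holo_map X M f0" and f1: "holo_map X M f1"
    and \<gamma>: "holo_map X (lie_mfd G) \<gamma>" and f01: "\<And>q. q \<in> pts X \<Longrightarrow> f1 q = \<rho> (f0 q, \<gamma> q)"
    and F: "\<And>q e. q \<in> pts X \<Longrightarrow> e \<in> carrier (V (f0 q)) \<Longrightarrow> F q e = \<phi> (e, \<gamma> q)"
    and p: "p \<in> pts X" and v: "v \<in> tangent X p" and e: "e \<in> carrier (V (f0 p))"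
  shows "nabla_hom X (pull X M f0 bdl) (pull X M f1 bdl) F p v e = \<zero>\<^bsub>V (f1 p)\<^esub>"
proof -
  define y where "y = (f0 p, \<gamma> p)"
  define w where "w = push X MG (\<lambda>q. (f0 q, \<gamma> q)) p v"
  have pts: "f0 p \<in> pts M" "\<gamma> p \<in> carrier G"
    using holo_map_imp_cdiff_map_at[OF \<gamma> p] holo_map_imp_cdiff_map_at[OF f0 p]
    by (auto simp: cdiff_map_at_def pts_G)
  then have y: "y \<in> pts MG" by (simp add: y_def pts_G)
  obtain U r \<Psi> where U: "chosen_triv (f0 p) U r \<Psi>" using chosen_triv_exists[OF pts(1)] .
  obtain U' r' \<Psi>' where U': "chosen_triv (\<rho> (f0 p, \<gamma> p)) U' r' \<Psi>'"
    using chosen_triv_exists[OF action_pts[OF pts]] .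
  have t': "local_trivialization E M \<pi> V U' r' \<Psi>'" "\<rho> (f0 p, \<gamma> p) \<in> U'"
    using U' by (auto simp: chosen_triv_def)
  have fst: "holo_map MG M fst" and snd: "holo_map MG (lie_mfd G) snd"
    by (intro holo_map_fst holo_map_snd charted_M charted_G holo_map_id_M holo_map_id_G)+
  have w: "w \<in> tangent MG y"
    unfolding w_def y_def
    by (rule push_tangent[OF X charted_MG _ p v])
      (use f0 \<gamma> in \<open>simp add: holo_map_iff_cdiff_map_at cdiff_map_at_pair\<close>)
  have act: "action_iso \<phi> q e = \<phi> (e, snd q)" for q e by (cases q) (simp add: action_iso_def)
  define N where "N = nabla_hom X (pull X M f0 bdl) (pull X M f1 bdl) F p v e"
  define N' where "N' = nabla_hom MG (pull MG M fst bdl) (pull MG M \<rho> bdl) (action_iso \<phi>) y w e"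
  \<comment> \<open>In the second use \<open>w\<close> is pushed along the pair of
    \<open>fst\<close> and \<open>snd\<close>, the identity of \<open>M x G\<close>;
    \<open>push_id\<close> removes this.\<close>
  have coords: "snd (\<Psi>' N) k = snd (\<Psi>' N') k" if "k < r'" for k
    using nabla_hom_pull_coords[OF X f0 f1 \<gamma> f01 F p v e U U' that]
      nabla_hom_pull_coords[OF charted_MG fst holo_map_action snd _ _ y w _ _ _ that,
        of "action_iso \<phi>" e U r \<Psi> U' \<Psi>'] e U U'
    by (simp add: N_def N'_def act y_def w_def[symmetric] push_id[OF w[unfolded y_def]])
  have "N' = \<zero>\<^bsub>V (\<rho> y)\<^esub>"
    using inv y w e unfolding N'_def G_invariant_def Let_def
    by (simp add: pull_def bundle_of_def y_def)
  interpret Vm: module complex_field "V (\<rho> (f0 p, \<gamma> p))" by (rule fibre_vs[OF action_pts[OF pts]])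
  have N: "N \<in> carrier (V (\<rho> (f0 p, \<gamma> p)))"
    unfolding N_def by (rule nabla_hom_pull_closed[OF X f0 f1 \<gamma> f01 F p v e U U'])
  have N': "N' \<in> carrier (V (\<rho> (f0 p, \<gamma> p)))"
    unfolding \<open>N' = \<zero>\<^bsub>V (\<rho> y)\<^esub>\<close> y_def by (rule Vm.zero_closed)
  \<comment> \<open>Both are points of \<open>cspace r'\<close>, so the coordinates from
    \<open>r'\<close> on vanish and those below \<open>r'\<close> decide.\<close>
  have "snd (\<Psi>' N) = snd (\<Psi>' N')"
  proof
    fix k
    have "snd (\<Psi>' N) \<in> cspace r'" "snd (\<Psi>' N') \<in> cspace r'"
      using triv_bij[OF t'] N N' by (auto simp: bij_betw_def)
    then show "snd (\<Psi>' N) k = snd (\<Psi>' N') k"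
      using coords by (cases "k < r'") (auto simp: cspace_def)
  qed
  then have "N = N'"
    using triv_bij[OF t'] N N' by (auto simp: bij_betw_def dest: inj_onD)
  then show ?thesis
    using \<open>N' = \<zero>\<^bsub>V (\<rho> y)\<^esub>\<close> f01[OF p] by (simp add: N_def y_def)
qed

end

section \<open>Strings of composable isomorphisms\<close>

lemma comp_seg_refl [simp]: "comp_seg f p p x = id"
  by (simp add: comp_seg_def)

lemma comp_seg_trans:
  assumes "a \<le> b" "b \<le> c"
  shows "comp_seg f c a x = comp_seg f c b x \<circ> comp_seg f b a x"
proof -
  have "[a + 1..<c + 1] = [a + 1..<b + 1] @ [b + 1..<c + 1]"
    using assms upt_add_eq_append[of "a + 1" "b + 1" "c - b"] by simp
  then show ?thesis by (simp add: comp_seg_def)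
qed

lemma comp_seg_step: "comp_seg f (Suc b) b x = f (Suc b) x"
  by (simp add: comp_seg_def)

text \<open>Telescoping: the segments from \<open>\<theta> (t - 1)\<close> to
  \<open>\<theta> t\<close> fit together because \<open>\<theta>\<close> is monotone, and where
  \<open>\<theta>\<close> repeats a vertex the segment is the identity.\<close>

lemma comp_seg_hvb_op:
  assumes "a \<le> b" "mono_on {a..b} \<theta>"
  shows "comp_seg (\<lambda>t. comp_seg f (\<theta> t) (\<theta> (t - 1))) b a x = comp_seg f (\<theta> b) (\<theta> a) x"
  using assms
proof (induction b rule: dec_induct)
  case (step b)
  have "\<theta> a \<le> \<theta> b" "\<theta> b \<le> \<theta> (Suc b)"
    using step by (auto intro: mono_onD)
  moreover have "mono_on {a..b} \<theta>" using step.prems by (rule mono_on_subset) auto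
  ultimately have "comp_seg f (\<theta> (Suc b)) (\<theta> a) x =
      comp_seg f (\<theta> (Suc b)) (\<theta> b) x \<circ> comp_seg (\<lambda>t. comp_seg f (\<theta> t) (\<theta> (t - 1))) b a x"
    using step.IH by (simp add: comp_seg_trans[of "\<theta> a" "\<theta> b" "\<theta> (Suc b)"])
  then show ?case
    using step.hyps comp_seg_trans[of a b "Suc b" "\<lambda>t. comp_seg f (\<theta> t) (\<theta> (t - 1))" x]
    by (simp add: comp_seg_step)
qed simp

section \<open>Products of consecutive group elements\<close>

lemma (in monoid) gseg_Suc:
  assumes "a \<le> b" "\<And>t. a < t \<Longrightarrow> t \<le> Suc b \<Longrightarrow> g t \<in> carrier G"
  shows "gseg G g a b \<in> carrier G" "gseg G g a (Suc b) = gseg G g a b \<otimes> g (Suc b)"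
proof -
  \<comment> \<open>\<open>foldr\<close> starts at the right end, so appending a last factor changes
    its start value; associativity lets an arbitrary start value \<open>z\<close> be split
    off.\<close>
  have *: "foldr (\<lambda>t h. g t \<otimes> h) ts \<one> \<in> carrier G \<and>
      foldr (\<lambda>t h. g t \<otimes> h) ts z = foldr (\<lambda>t h. g t \<otimes> h) ts \<one> \<otimes> z"
    if "\<forall>t\<in>set ts. g t \<in> carrier G" "z \<in> carrier G" for ts z
    using that by (induction ts) (auto simp: m_assoc)
  have upt: "[a + 1..<Suc b + 1] = [a + 1..<b + 1] @ [Suc b]"
    using assms(1) by simp
  have g: "\<forall>t\<in>set [a + 1..<b + 1]. g t \<in> carrier G" "g (Suc b) \<in> carrier G"
    using assms by auto
  show "gseg G g a b \<in> carrier G"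
    using *[OF g] by (simp only: gseg_def)
  show "gseg G g a (Suc b) = gseg G g a b \<otimes> g (Suc b)"
    using *[OF g] g(2) by (simp only: gseg_def upt foldr_append foldr.simps o_def id_def r_one)
qed

lemma (in monoid) gseg_closed:
  assumes "a \<le> b" "\<And>t. a < t \<Longrightarrow> t \<le> b \<Longrightarrow> g t \<in> carrier G"
  shows "gseg G g a b \<in> carrier G"
  using assms
proof (induction b rule: dec_induct)
  case (step b)
  then show ?case using gseg_Suc[of a b g] by simp
qed simp

lemma (in monoid) gseg_trans:
  assumes "a \<le> b" "b \<le> c" "\<And>t. a < t \<Longrightarrow> t \<le> c \<Longrightarrow> g t \<in> carrier G"
  shows "gseg G g a b \<otimes> gseg G g b c = gseg G g a c"
  using assms(2,3)
proof (induction c rule: dec_induct)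
  case base
  then show ?case using gseg_closed[OF assms(1)] by simp
next
  case (step c)
  have g: "gseg G g a b \<in> carrier G" "gseg G g b c \<in> carrier G" "g (Suc c) \<in> carrier G"
    using step assms(1) gseg_closed[of a b g] gseg_closed[of b c g] by auto
  have "gseg G g a b \<otimes> gseg G g b (Suc c) = gseg G g a b \<otimes> gseg G g b c \<otimes> g (Suc c)"
    using step.hyps step.prems assms(1) gseg_Suc[of b c g] g by (simp add: m_assoc)
  also have "gseg G g a b \<otimes> gseg G g b c = gseg G g a c"
    using step by simp
  also have "\<dots> \<otimes> g (Suc c) = gseg G g a (Suc c)"
    using step assms(1) gseg_Suc[of a c g] by simp
  finally show ?case .
qed

section \<open>The Chern character of an equivariant bundle\<close>

context equivariant_connection
begin

interpretation G: group G by (rule group_G)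

section \<open>Structure maps of \<open>[M/G]\<close>\<close>

lemma quot_pts: "p \<in> pts (quot M G l) \<Longrightarrow> fst p \<in> pts M"
  "p \<in> pts (quot M G l) \<Longrightarrow> t \<in> {1..l} \<Longrightarrow> snd p t \<in> carrier G"
  by (auto simp: quot_def pts_G)

lemma charted_quot: "charted (quot M G l)"
  unfolding quot_def by (intro charted_cprod charted_cpow charted_M charted_G)

lemma quot_seg_closed:
  "p \<in> pts (quot M G l) \<Longrightarrow> a \<le> b \<Longrightarrow> b \<le> l \<Longrightarrow> gseg G (snd p) a b \<in> carrier G"
  by (rule G.gseg_closed) (auto intro: quot_pts)

lemma quot_fst_cdiff: "p \<in> pts (quot M G l) \<Longrightarrow> cdiff_map_at (quot M G l) M fst p"
  unfolding quot_def
  by (intro holo_map_imp_cdiff_map_at holo_map_fst charted_M charted_cpow charted_G holo_map_id_M)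

lemma quot_component_cdiff:
  assumes p: "p \<in> pts (quot M G l)" and t: "t \<in> {1..l}"
  shows "cdiff_map_at (quot M G l) (lie_mfd G) (\<lambda>q. snd q t) p"
  unfolding holo_map_iff_cdiff_map_at cdiff_map_at_def
proof (intro conjI allI impI)
  show "p \<in> pts (quot M G l)" "snd p t \<in> pts (lie_mfd G)" using p t by (auto intro: quot_pts simp: pts_G)
  have pq: "fst p \<in> pts M" "snd p \<in> pts (cpow (lie_mfd G) l)" using p by (auto simp: quot_def)
  have comp: "cdiff_map_at (cpow (lie_mfd G) l) (lie_mfd G) (\<lambda>g. g t) (snd p)"
    by (intro holo_map_imp_cdiff_map_at holo_map_cpow_component charted_G holo_map_id_G t pq)
  fix W assume W: "openin (mtop (lie_mfd G)) W" "snd p t \<in> W"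
  from cdiff_map_at_imp_near[OF comp, of "\<lambda>h. h \<in> W"] near_openI[OF W]
  obtain A where A: "openin (mtop (cpow (lie_mfd G) l)) A" "snd p \<in> A" "\<forall>g\<in>A. g t \<in> W"
    by (auto simp: near_def)
  show "near (quot M G l) p (\<lambda>q. snd q t \<in> W)"
    unfolding near_def quot_def
    by (intro exI[of _ "pts M \<times> A"])
      (use A pq in \<open>auto simp: cprod_def openin_prod_Times_iff mem_Times_iff\<close>)
next
  have pq: "fst p \<in> pts M" "snd p \<in> pts (cpow (lie_mfd G) l)" using p by (auto simp: quot_def)
  have comp: "cdiff_map_at (cpow (lie_mfd G) l) (lie_mfd G) (\<lambda>g. g t) (snd p)"
    by (intro holo_map_imp_cdiff_map_at holo_map_cpow_component charted_G holo_map_id_G t pq)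
  show "\<forall>(n, V, y)\<in>atlas (lie_mfd G). snd p t \<in> V \<longrightarrow> (\<forall>i<n. cdiff_at (quot M G l) (\<lambda>q. y (snd q t) i) p)"
  proof clarify
    fix n V y i assume "(n, V, y) \<in> atlas (lie_mfd G)" "snd p t \<in> V" "i < n"
    then have "cdiff_at (cpow (lie_mfd G) l) (\<lambda>g. y (g t) i) (snd p)"
      using cdiff_map_at_coordinate[OF comp] by blast
    then show "cdiff_at (quot M G l) (\<lambda>q. y (snd q t) i) p"
      using cdiff_at_snd[OF charted_M charted_cpow[OF charted_G] pq(2,1), where g = "\<lambda>g. y (g t) i"]
      by (simp add: quot_def)
  qed
qed

text \<open>Split off the last factor and use that multiplication is holomorphic. The recursion for
  \<open>gseg\<close> needs components in \<open>G\<close>, so it holds at points of the manifold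
  only and enters as a congruence of germs.\<close>

lemma quot_seg_cdiff:
  assumes p: "p \<in> pts (quot M G l)" and "a \<le> b" "b \<le> l"
  shows "cdiff_map_at (quot M G l) (lie_mfd G) (\<lambda>q. gseg G (snd q) a b) p"
  using assms(2,3)
proof (induction b rule: dec_induct)
  case base
  show ?case using p by (simp add: cdiff_map_at_const pts_G)
next
  case (step b)
  have "cdiff_map_at (quot M G l) (cprod (lie_mfd G) (lie_mfd G)) (\<lambda>q. (gseg G (snd q) a b, snd q (Suc b))) p"
    using step by (intro cdiff_map_at_pair quot_component_cdiff p) auto
  moreover from this have "cdiff_map_at (cprod (lie_mfd G) (lie_mfd G)) (lie_mfd G)
      (\<lambda>(g, h). g \<otimes>\<^bsub>G\<^esub> h) (gseg G (snd p) a b, snd p (Suc b))"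
    by (intro holo_map_imp_cdiff_map_at holo_map_mult) (simp add: cdiff_map_at_def)
  ultimately have "cdiff_map_at (quot M G l) (lie_mfd G)
      (\<lambda>q. (\<lambda>(g, h). g \<otimes>\<^bsub>G\<^esub> h) (gseg G (snd q) a b, snd q (Suc b))) p"
    by (rule cdiff_map_at_compose[OF charted_quot charted_cprod[OF charted_G charted_G]])
  then show ?case
  proof (rule cdiff_map_at_cong[OF charted_quot])
    show "near (quot M G l) p (\<lambda>q. gseg G (snd q) a (Suc b) =
        (\<lambda>(g, h). g \<otimes>\<^bsub>G\<^esub> h) (gseg G (snd q) a b, snd q (Suc b)))"
    proof (rule near_mono[OF near_pts[OF p]])
      fix q assume "q \<in> pts (quot M G l)"
      then show "gseg G (snd q) a (Suc b) = (\<lambda>(g, h). g \<otimes>\<^bsub>G\<^esub> h) (gseg G (snd q) a b, snd q (Suc b))"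
        using step quot_pts(2)[of q l] G.gseg_Suc(2)[of a b "snd q"] by auto
    qed
  qed
qed

lemma vertex_map_eq: "vertex_map G \<rho> i p = \<rho> (fst p, gseg G (snd p) 0 i)"
  by (cases p) (simp add: vertex_map_def quot_op_def)

lemma vertex_map_pts: "p \<in> pts (quot M G l) \<Longrightarrow> i \<le> l \<Longrightarrow> vertex_map G \<rho> i p \<in> pts M"
  unfolding vertex_map_eq by (intro action_pts quot_pts quot_seg_closed) auto

lemma vertex_map_holo:
  assumes i: "i \<le> l"
  shows "holo_map (quot M G l) M (vertex_map G \<rho> i)"
  unfolding holo_map_iff_cdiff_map_at
proof
  fix p assume p: "p \<in> pts (quot M G l)"
  have pair: "cdiff_map_at (quot M G l) MG (\<lambda>q. (fst q, gseg G (snd q) 0 i)) p"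
    using i by (intro cdiff_map_at_pair quot_fst_cdiff quot_seg_cdiff p) auto
  then have "cdiff_map_at MG M \<rho> (fst p, gseg G (snd p) 0 i)"
    by (intro holo_map_imp_cdiff_map_at holo_map_action) (simp add: cdiff_map_at_def)
  from cdiff_map_at_compose[OF charted_quot charted_MG pair this]
  show "cdiff_map_at (quot M G l) M (vertex_map G \<rho> i) p"
    unfolding vertex_map_eq[abs_def] .
qed

lemma vertex_map_seg:
  assumes p: "p \<in> pts (quot M G l)" and "a \<le> b" "b \<le> l"
  shows "vertex_map G \<rho> b p = \<rho> (vertex_map G \<rho> a p, gseg G (snd p) a b)"
  using assms quot_pts[OF p] quot_seg_closed[OF p] G.gseg_trans[of 0 a b "snd p"]
  by (simp add: vertex_map_eq action_mult)

text \<open>The \<open>t\<close>-th isomorphism acts by the \<open>t\<close>-th component of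
  \<open>snd p\<close>. As the action is a right action, applying later isomorphisms multiplies on
  the right, which is the order of factors in \<open>gseg\<close>.\<close>

lemma comp_seg_top_string:
  assumes p: "p \<in> pts (quot M G l)" and "a \<le> b" "b \<le> l" and e: "e \<in> carrier (V (vertex_map G \<rho> a p))"
  shows "comp_seg (snd (top_string M G \<rho> bdl \<phi> l)) b a p e = \<phi> (e, gseg G (snd p) a b)"
  using assms(2,3)
proof (induction b rule: dec_induct)
  case base
  have "e \<in> pts E" using e vertex_map_pts[OF p] base by (simp add: carrier_fibre)
  then show ?case by (simp add: bundle_action_one)
next
  case (step b)
  have "e \<in> pts E" using e vertex_map_pts[OF p, of a] step by (simp add: carrier_fibre)
  moreover have "snd (top_string M G \<rho> bdl \<phi> l) (Suc b) p e' = \<phi> (e', snd p (Suc b))" for e'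
    using quot_pts(2)[OF p, of "Suc b"] step G.gseg_single[of "snd p" b]
    by (cases p) (simp add: top_string_def action_iso_def edge_map_def quot_op_def)
  ultimately show ?case
    using step quot_seg_closed[OF p, of a b] quot_pts(2)[OF p] G.gseg_Suc(2)[of a b "snd p"]
    by (simp add: comp_seg_trans[of a b "Suc b"] comp_seg_step bundle_action_mult)
qed

text \<open>Homogeneity of the action for the scalar \<open>0\<close>.\<close>

lemma bundle_action_zero:
  assumes m: "m \<in> pts M" and g: "g \<in> carrier G"
  shows "\<phi> (\<zero>\<^bsub>V m\<^esub>, g) = \<zero>\<^bsub>V (\<rho> (m, g))\<^esub>"
proof -
  interpret Vm: module complex_field "V m" by (rule fibre_vs[OF m])
  interpret Vg: module complex_field "V (\<rho> (m, g))" by (rule fibre_vs[OF action_pts[OF m g]])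
  have 0: "\<zero>\<^bsub>complex_field\<^esub> = 0" by (simp add: complex_field_def)
  have "\<phi> (0 \<odot>\<^bsub>V m\<^esub> \<zero>\<^bsub>V m\<^esub>, g) = 0 \<odot>\<^bsub>V (\<rho> (m, g))\<^esub> \<phi> (\<zero>\<^bsub>V m\<^esub>, g)"
    using equivariant m g Vm.zero_closed unfolding equivariant_bundle_def by blast
  then show ?thesis
    using Vm.smult_l_null[OF Vm.zero_closed] Vg.smult_l_null[OF bundle_action_closed[OF m Vm.zero_closed g]]
    by (simp add: 0)
qed

lemma bundle_action_inj:
  assumes m: "m \<in> pts M" and g: "g \<in> carrier G"
  shows "inj_on (\<lambda>e. \<phi> (e, g)) (carrier (V m))"
proof (rule inj_on_inverseI)
  fix e assume "e \<in> carrier (V m)"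
  then show "\<phi> (\<phi> (e, g), inv\<^bsub>G\<^esub> g) = e"
    using m g by (simp add: carrier_fibre bundle_action_mult bundle_action_one)
qed

section \<open>Vanishing of the Chern forms on a fixed simplex\<close>

context
  fixes l k :: nat and \<theta> :: "nat \<Rightarrow> nat"
  assumes inv: "G_invariant M G \<rho> bdl \<phi>"
    and \<theta>: "\<And>i. i \<le> k \<Longrightarrow> \<theta> i \<le> l" "mono_on {0..k} \<theta>"
begin

abbreviation simplex_edge :: "nat \<Rightarrow> nat \<Rightarrow> 'm \<times> (nat \<Rightarrow> 'g) \<Rightarrow> 'e \<Rightarrow> 'e" where
  "simplex_edge \<equiv> comp_seg (snd (hvb_op \<theta> (top_string M G \<rho> bdl \<phi> l)))"

abbreviation simplex_bundle :: "nat \<Rightarrow> ('m \<times> (nat \<Rightarrow> 'g), 'e) cbundle" where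
  "simplex_bundle \<equiv> fst (hvb_op \<theta> (top_string M G \<rho> bdl \<phi> l))"

lemma simplex_bundle_eq: "simplex_bundle i = pull (quot M G l) M (vertex_map G \<rho> (\<theta> i)) bdl"
  by (simp add: hvb_op_def top_string_def)

lemma fib_simplex_bundle: "fib (simplex_bundle i) p = V (vertex_map G \<rho> (\<theta> i) p)"
  unfolding simplex_bundle_eq by (simp add: pull_def bundle_of_def)

lemma simplex_edge_eq:
  assumes p: "p \<in> pts (quot M G l)" and ij: "i \<le> j" "j \<le> k"
    and e: "e \<in> carrier (V (vertex_map G \<rho> (\<theta> i) p))"
  shows "simplex_edge j i p e = \<phi> (e, gseg G (snd p) (\<theta> i) (\<theta> j))"
proof -
  have "mono_on {i..j} \<theta>" using \<theta>(2) ij by (auto intro: mono_on_subset)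
  then have "simplex_edge j i p = comp_seg (snd (top_string M G \<rho> bdl \<phi> l)) (\<theta> j) (\<theta> i) p"
    using comp_seg_hvb_op[OF ij(1)] by (simp add: hvb_op_def case_prod_beta)
  moreover have "\<theta> i \<le> \<theta> j" using ij \<theta>(2) by (auto intro: mono_onD)
  ultimately show ?thesis using comp_seg_top_string[OF p _ \<theta>(1)[OF ij(2)] e] by simp
qed

text \<open>The edge from \<open>i\<close> to \<open>j\<close> acts by the group element
  \<open>gseg G (snd q) (\<theta> i) (\<theta> j)\<close>, which depends holomorphically on
  \<open>q\<close>, so it is a pullback of the action isomorphism. Degenerate edges are covered,
  with the unit as group element.\<close>

lemma nabla_simplex_edge_zero:
  assumes p: "p \<in> pts (quot M G l)" and v: "v \<in> tangent (quot M G l) p" and ij: "i \<le> j" "j \<le> k"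
    and e: "e \<in> carrier (V (vertex_map G \<rho> (\<theta> i) p))"
  shows "nabla_hom (quot M G l) (simplex_bundle i) (simplex_bundle j) (simplex_edge j i) p v e =
    \<zero>\<^bsub>V (vertex_map G \<rho> (\<theta> j) p)\<^esub>"
  unfolding simplex_bundle_eq
proof (rule nabla_hom_pull_zero[OF inv charted_quot, where \<gamma> = "\<lambda>q. gseg G (snd q) (\<theta> i) (\<theta> j)"])
  have \<theta>ij: "\<theta> i \<le> \<theta> j" "\<theta> i \<le> l" "\<theta> j \<le> l" using ij \<theta> by (auto intro: mono_onD)
  show "holo_map (quot M G l) M (vertex_map G \<rho> (\<theta> i))" "holo_map (quot M G l) M (vertex_map G \<rho> (\<theta> j))"
    by (intro vertex_map_holo \<theta>ij)+
  show "holo_map (quot M G l) (lie_mfd G) (\<lambda>q. gseg G (snd q) (\<theta> i) (\<theta> j))"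
    unfolding holo_map_iff_cdiff_map_at using \<theta>ij by (auto intro: quot_seg_cdiff)
  show "vertex_map G \<rho> (\<theta> j) q = \<rho> (vertex_map G \<rho> (\<theta> i) q, gseg G (snd q) (\<theta> i) (\<theta> j))"
    if "q \<in> pts (quot M G l)" for q
    using that \<theta>ij by (intro vertex_map_seg)
  show "simplex_edge j i q e = \<phi> (e, gseg G (snd q) (\<theta> i) (\<theta> j))"
    if "q \<in> pts (quot M G l)" "e \<in> carrier (V (vertex_map G \<rho> (\<theta> i) q))" for q e
    using that ij by (intro simplex_edge_eq)
qed (use p v e in auto)

text \<open>For each permutation the trace is that of a map which is zero on the fibre: the first
  factor already yields the zero vector, later factors again give zero, and so does the inverse of
  the composite edge.\<close>

lemma ch_form_zero:
  assumes I: "I \<in> generators k" "length I > 1"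
    and p: "p \<in> pts (quot M G l)" and v: "\<And>i. i < length I - 1 \<Longrightarrow> v i \<in> tangent (quot M G l) p"
  shows "ch_form (quot M G l) (hvb_op \<theta> (top_string M G \<rho> bdl \<phi> l)) I p v = 0"
proof -
  define n where "n = length I - 1"
  have n: "n > 0" "length I = Suc n" using I(2) by (simp_all add: n_def)
  have le: "I ! i \<le> k" if "i \<le> n" for i
  proof -
    have "I ! i \<in> set I" using that n(2) by simp
    then show ?thesis using I(1) by (auto simp: generators_def)
  qed
  have mono: "I ! i \<le> I ! j" if "i \<le> j" "j \<le> n" for i j
    using I(1) that n(2) by (cases "i = j") (auto simp: generators_def sorted_wrt_iff_nth_less less_imp_le)
  define Vx where "Vx i = V (vertex_map G \<rho> (\<theta> (I ! i)) p)" for i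
  have pts: "vertex_map G \<rho> (\<theta> (I ! i)) p \<in> pts M" if "i \<le> n" for i
    by (intro vertex_map_pts[OF p] \<theta>(1) le that)
  have hd: "hd I = I ! 0" using n(2) by (intro hd_conv_nth) auto
  have last: "last I = I ! n" using n(2) by (subst last_conv_nth) auto
  define g where "g = gseg G (snd p) (\<theta> (I ! 0)) (\<theta> (I ! n))"
  have \<theta>0n: "\<theta> (I ! 0) \<le> \<theta> (I ! n)" using \<theta>(2) mono[of 0 n] le by (auto intro: mono_onD)
  have g: "g \<in> carrier G" unfolding g_def by (intro quot_seg_closed[OF p] \<theta>0n \<theta>(1) le) simp
  have \<rho>g: "\<rho> (vertex_map G \<rho> (\<theta> (I ! 0)) p, g) = vertex_map G \<rho> (\<theta> (I ! n)) p"
    unfolding g_def by (intro vertex_map_seg[OF p, symmetric] \<theta>0n \<theta>(1) le) simp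
  have edge: "simplex_edge (I ! n) (I ! 0) p e = \<phi> (e, g)" if "e \<in> carrier (Vx 0)" for e
    using that n mono[of 0 n] le unfolding g_def Vx_def by (intro simplex_edge_eq p) auto
  interpret V0: module complex_field "Vx 0" unfolding Vx_def by (rule fibre_vs[OF pts]) simp
  \<comment> \<open>\<open>inv_into\<close> picks some preimage; injectivity of the action on the
    fibre identifies it as the zero vector.\<close>
  have inv0: "inv_into (carrier (Vx 0)) (simplex_edge (I ! n) (I ! 0) p) \<zero>\<^bsub>Vx n\<^esub> = \<zero>\<^bsub>Vx 0\<^esub>"
  proof (rule inv_into_f_eq)
    show "inj_on (simplex_edge (I ! n) (I ! 0) p) (carrier (Vx 0))"
      using bundle_action_inj[OF pts[of 0] g]
        inj_on_cong[of "carrier (Vx 0)" "simplex_edge (I ! n) (I ! 0) p" "\<lambda>e. \<phi> (e, g)", OF edge]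
      by (simp add: Vx_def)
    show "simplex_edge (I ! n) (I ! 0) p \<zero>\<^bsub>Vx 0\<^esub> = \<zero>\<^bsub>Vx n\<^esub>"
      using bundle_action_zero[OF pts[of 0] g] \<rho>g edge[OF V0.zero_closed] by (simp add: Vx_def)
  qed (rule V0.zero_closed)
  obtain U r \<Psi> where "chosen_triv (vertex_map G \<rho> (\<theta> (I ! 0)) p) U r \<Psi>"
    using chosen_triv_exists[OF pts[of 0]] by blast
  then have t: "local_trivialization E M \<pi> V U r \<Psi>" "vertex_map G \<rho> (\<theta> (I ! 0)) p \<in> U"
    by (auto simp: chosen_triv_def)
  \<comment> \<open>Any local trivialisation at the first vertex provides the basis that makes the
    trace meaningful.\<close>
  have basis: "is_basis (Vx 0) r (\<lambda>j. inv_into (carrier (Vx 0)) (\<lambda>e. snd (\<Psi> e)) (unit_vec j))"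
    unfolding Vx_def by (rule is_basis_frame[OF fibre_vs[OF pts] triv_linear[OF t] triv_bij[OF t]]) simp
  have "trace (fib (simplex_bundle (hd I)) p) (\<lambda>e.
      inv_into (carrier (fib (simplex_bundle (hd I)) p)) (simplex_edge (last I) (hd I) p)
        (fold (\<lambda>r. nabla_hom (quot M G l) (simplex_bundle (I ! (r - 1))) (simplex_bundle (I ! r))
             (simplex_edge (I ! r) (I ! (r - 1))) p (v (\<sigma> (n - r)))) [1..<n + 1] e)) = 0"
    if \<sigma>: "\<sigma> permutes {..<n}" for \<sigma>
    unfolding fib_simplex_bundle hd last Vx_def[symmetric]
  proof (rule trace_zero[OF V0.module_axioms basis])
    fix e assume e: "e \<in> carrier (Vx 0)"
    define N where "N r = nabla_hom (quot M G l) (simplex_bundle (I ! (r - 1))) (simplex_bundle (I ! r))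
             (simplex_edge (I ! r) (I ! (r - 1))) p (v (\<sigma> (n - r)))" for r
    have N: "N (Suc i) x = \<zero>\<^bsub>Vx (Suc i)\<^esub>" if "i < n" "x \<in> carrier (Vx i)" for i x
    proof -
      \<comment> \<open>The vectors are consumed in reverse order; a permutation of
        \<open>{..<n}\<close> keeps the index where \<open>v\<close> is known to be tangent.\<close>
      have "\<sigma> (n - Suc i) < n" using permutes_in_image[OF \<sigma>, of "n - Suc i"] that by simp
      then show ?thesis
        unfolding N_def Vx_def using that mono[of i "Suc i"] le
        by (intro nabla_simplex_edge_zero[OF p v]) (auto simp: n_def Vx_def)
    qed
    \<comment> \<open>Each factor vanishes on its whole fibre, in particular at the zero vector left
      by the factor before it.\<close>
    have "fold N [1..<Suc i + 1] e = \<zero>\<^bsub>Vx (Suc i)\<^esub>" if "i < n" for i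
      using that
    proof (induction i)
      case 0
      then show ?case using N[OF _ e] by simp
    next
      case (Suc i)
      interpret Vi: module complex_field "Vx (Suc i)" unfolding Vx_def using Suc by (intro fibre_vs pts) simp
      have "[1..<Suc (Suc i) + 1] = [1..<Suc i + 1] @ [Suc (Suc i)]" by simp
      then show ?case using Suc N[OF _ Vi.zero_closed] by (simp del: upt_Suc)
    qed
    from this[of "n - 1"] n(1) have "fold N [1..<n + 1] e = \<zero>\<^bsub>Vx n\<^esub>" by simp
    then show "inv_into (carrier (Vx 0)) (simplex_edge (I ! n) (I ! 0) p)
        (fold (\<lambda>r. nabla_hom (quot M G l) (simplex_bundle (I ! (r - 1))) (simplex_bundle (I ! r))
             (simplex_edge (I ! r) (I ! (r - 1))) p (v (\<sigma> (n - r)))) [1..<n + 1] e) = \<zero>\<^bsub>Vx 0\<^esub>"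
      unfolding N_def[abs_def] by (simp only: inv0)
  qed
  then show ?thesis
    unfolding ch_form_def case_prod_beta Let_def n_def[symmetric] by (intro sum.neutral) auto
qed

end

end

theorem corollary5p5:
  fixes M :: "'m cmanifold" and G :: "'g lie_group" and \<rho> :: "'m \<times> 'g \<Rightarrow> 'm"
    and E :: "'e cmanifold" and \<pi> :: "'e \<Rightarrow> 'm" and V :: "'m \<Rightarrow> 'e cvs"
    and \<phi> :: "'e \<times> 'g \<Rightarrow> 'e"
    and nabla :: "'m \<Rightarrow> 'm tvec \<Rightarrow> ('m \<Rightarrow> 'e) \<Rightarrow> 'e"
  assumes "complex_manifold M"
    and "complex_lie_group G"
    and "holomorphic_right_action M G \<rho>"
    and "equivariant_bundle M G \<rho> E \<pi> V \<phi>"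
    and "holomorphic_connection M (bundle_of E M \<pi> V nabla)"
    and "G_invariant M G \<rho> (bundle_of E M \<pi> V nabla) \<phi>"
  shows "zero_in_positive_form_degrees M G
           (Tot_Ch M G (equivariant_simplex M G \<rho> (bundle_of E M \<pi> V nabla) \<phi>))"
proof -
  interpret equivariant_connection E M \<pi> V nabla G \<rho> \<phi>
    using assms by unfold_locales (auto simp: equivariant_bundle_def)
  show ?thesis
    unfolding zero_in_positive_form_degrees_def form_vanishes_def
  proof (intro allI ballI impI)
    fix l k a j :: nat and s c p v
    assume s: "s \<in> std_simplex l k \<times> std_simplex 0 k" and c: "c \<in> normalized_chains k"
      and j: "0 < j" and p: "p \<in> pts (quot M G l)" and v: "\<forall>i<j. v i \<in> tangent (quot M G l) p"
    obtain \<theta> \<eta> where [simp]: "s = (\<theta>, \<eta>)" by (cases s)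
    have \<theta>: "\<And>i. i \<le> k \<Longrightarrow> \<theta> i \<le> l" "mono_on {0..k} \<theta>"
      using s by (auto simp: std_simplex_def PiE_iff)
    \<comment> \<open>A generator contributes in form degree \<open>j\<close> only if
      \<open>j = length I - 1\<close>. Then \<open>0 < j\<close> gives \<open>length I > 1\<close>,
      and the hypothesis on \<open>v\<close> covers all the vectors that \<open>ch_form\<close>
      uses.\<close>
    have "ch_generator (quot M G l) (hvb_op \<theta> (top_string M G \<rho> bdl \<phi> l)) I a j p v = 0"
      if "I \<in> Poly_Mapping.keys c" for I
    proof -
      have I: "I \<in> generators k"
        using c that by (auto simp: normalized_chains_def carrier_free_Abelian_group_iff)
      then show ?thesis
        using j v ch_form_zero[OF assms(6) \<theta> I _ p, of v] by (auto simp: ch_generator_def)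
    qed
    then show "Tot_Ch M G (equivariant_simplex M G \<rho> bdl \<phi>) l k s c a j p v = 0"
      by (simp add: Tot_Ch_def Ch_def equivariant_simplex_def)
  qed
qed

end
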